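(* Let $I$ be a nonzero proper monomial ideal of $\mathbb{Z}[x_1,\ldots,x_n]$, let $p$ be a prime, and let $Z_I$ be the $p$-adic Igusa zeta function of $I$ (extended meromorphically to $\mathbb{C}$). For every pole $s$ of $Z_I$, there is a torus-invariant prime divisor $E$ on the normalized blowing-up of $\mathbb{A}^n$ along $I$, with $a_E(I)\neq0$, such that $$\mathrm{Re}(s)=-\frac{k_E+1}{a_E(I)} .$$
   Context: **Igusa zeta function.** Let $\mathbb{Z}_p$ be the ring of $p$-adic integers with valuation $\mathrm{ord}_p$ (with $\mathrm{ord}_p(0)=\infty$), and let $|dy|$ denote the Haar measure $\mu$ on $(\mathbb{Z}_p)^n$ with $\mu\left(\prod_{i=1}^n p^{m_i}\mathbb{Z}_p\right)=(1/p)^{\sum_i m_i}$. For an ideal $I$ of $\mathbb{Z}[x_1,\ldots,x_n]$ and $y\in(\mathbb{Z}_p)^n$ put $\mathrm{ord}_pI(y)=\min\{\mathrm{ord}_p(f(y))\mid f\in I\}$. For $I$ nonzero and proper, and $\mathrm{Re}(s)>0$, define $$Z_I(s)=\int_{(\mathbb{Z}_p)^n}\left(\frac1p\right)^{s\cdot \mathrm{ord}_pI(y)}|dy| .$$ It is a rational function of $(1/p)^s$, hence extends meromorphically to $\mathbb{C}$; poles refer to this extension. **Divisors on the normalized blow-up.** A monomial ideal is an ideal generated by monomials. Let $\pi\colon Y\to X=\mathbb{A}^n$ be the normalization of the blow-up of $\mathbb{A}^n$ (over $\mathbb{Q}$) along the ideal generated by $I$. Since $I$ is monomial, $Y$ is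 a normal toric variety for the standard torus of $\mathbb{A}^n$, and torus-invariant divisors are taken with respect to this torus. For a prime divisor $E$ on $Y$: $a_E(I)$ is the coefficient of $E$ in the Cartier divisor $\pi^{-1}(V(I))$ (the divisor defined by $I\cdot\mathcal{O}_Y$), and $k_E$ is the order along $E$ of the relative canonical divisor $K_{Y/X}$, i.e. the order of vanishing of $\det(\mathrm{Jac}(\pi))$ along $E$ (computed at the generic point of $E$, where $Y$ is smooth). *)

theory Defs
  imports
    "HOL-Complex_Analysis.Complex_Analysis"
    "HOL-Probability.Infinite_Product_Measure"
    "HOL-Library.Poly_Mapping"
    "HOL-Computational_Algebra.Fraction_Field"
    "HOL-Computational_Algebra.Polynomial"
begin

text \<open>
  The variables \<open>x\<^sub>1, \<dots>, x\<^sub>n\<close> are indexed by a finite type \<open>'n\<close>. The linear order on \<open>'n\<close> plays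
  no mathematical role; it is what the library needs to see that polynomials form an integral
  domain.
\<close>

type_synonym ('n, 'a) mpolynomial = "('n \<Rightarrow>\<^sub>0 nat) \<Rightarrow>\<^sub>0 'a"

type_synonym 'n funfield = "('n, rat) mpolynomial fract"


section \<open>Ideals\<close>

text \<open>The ideal of the subring \<open>A\<close> generated by \<open>S\<close> (if \<open>S\<close> is not contained in \<open>A\<close>, the
  \<open>A\<close>-submodule generated by \<open>S\<close>).\<close>

definition ideal_gen :: "'a::comm_ring_1 set \<Rightarrow> 'a set \<Rightarrow> 'a set" where
  "ideal_gen A S = {\<Sum>a\<in>T. r a * a | T r. finite T \<and> T \<subseteq> S \<and> r ` T \<subseteq> A}"

definition monomial_ideal :: "('n, int) mpolynomial set \<Rightarrow> bool" where
  "monomial_ideal I \<longleftrightarrow> (\<exists>M. I = ideal_gen UNIV ((\<lambda>m. Poly_Mapping.single m 1) ` M))"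


section \<open>The \<open>p\<close>-adic integers\<close>

text \<open>The inverse limit of the rings \<open>\<int>/p\<^sup>k\<close>: the \<open>k\<close>-th component of \<open>x\<close> is the representative of
  \<open>x mod p\<^sup>k\<close> in \<open>{0..<p\<^sup>k}\<close>. Ring operations are componentwise modulo \<open>p\<^sup>k\<close>.\<close>

definition zp :: "nat \<Rightarrow> (nat \<Rightarrow> int) set" where
  "zp p = {x. \<forall>k. 0 \<le> x k \<and> x k < int p ^ k \<and> x (Suc k) mod int p ^ k = x k}"

definition zp_add :: "nat \<Rightarrow> (nat \<Rightarrow> int) \<Rightarrow> (nat \<Rightarrow> int) \<Rightarrow> (nat \<Rightarrow> int)" where
  "zp_add p x y = (\<lambda>k. (x k + y k) mod int p ^ k)"

definition zp_scale :: "nat \<Rightarrow> int \<Rightarrow> (nat \<Rightarrow> int) \<Rightarrow> (nat \<Rightarrow> int)" where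
  "zp_scale p c x = (\<lambda>k. (c * x k) mod int p ^ k)"

definition zp_power_ideal :: "nat \<Rightarrow> nat \<Rightarrow> (nat \<Rightarrow> int) set" where
  "zp_power_ideal p m = zp_scale p (int p ^ m) ` zp p"

definition zp_ord :: "nat \<Rightarrow> (nat \<Rightarrow> int) \<Rightarrow> enat" where
  "zp_ord p x = Sup {enat m | m. x \<in> zp_power_ideal p m}"

definition zp_vec :: "nat \<Rightarrow> ('n \<Rightarrow> nat \<Rightarrow> int) set" where
  "zp_vec p = {y. \<forall>i. y i \<in> zp p}"

definition zp_eval :: "nat \<Rightarrow> ('n::finite, int) mpolynomial \<Rightarrow> ('n \<Rightarrow> nat \<Rightarrow> int) \<Rightarrow> (nat \<Rightarrow> int)" where
  "zp_eval p f y = (\<lambda>k. (\<Sum>m\<in>Poly_Mapping.keys f.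
      Poly_Mapping.lookup f m * (\<Prod>i\<in>UNIV. y i k ^ Poly_Mapping.lookup m i)) mod int p ^ k)"

definition ord_ideal :: "nat \<Rightarrow> ('n::finite, int) mpolynomial set \<Rightarrow> ('n \<Rightarrow> nat \<Rightarrow> int) \<Rightarrow> enat" where
  "ord_ideal p I y = (INF f\<in>I. zp_ord p (zp_eval p f y))"


section \<open>Haar measure and the Igusa zeta function\<close>

text \<open>The topology of \<open>(\<int>\<^sub>p)\<^sup>n\<close> is the one induced by the product topology on
  \<^typ>\<open>'n \<Rightarrow> nat \<Rightarrow> int\<close> with \<^typ>\<open>int\<close> discrete.\<close>

definition is_haar_measure :: "nat \<Rightarrow> ('n::finite \<Rightarrow> nat \<Rightarrow> int) measure \<Rightarrow> bool" where
  "is_haar_measure p \<mu> \<longleftrightarrow>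
     sets \<mu> = sets (restrict_space borel (zp_vec p)) \<and>
     (\<forall>a\<in>zp_vec p. \<forall>A\<in>sets \<mu>. emeasure \<mu> ((\<lambda>y i. zp_add p (a i) (y i)) ` A) = emeasure \<mu> A) \<and>
     (\<forall>m. emeasure \<mu> {y. \<forall>i. y i \<in> zp_power_ideal p (m i)}
            = ennreal ((1 / real p) ^ (\<Sum>i\<in>UNIV. m i)))"

text \<open>Existence and uniqueness are proved below.\<close>

definition zp_haar :: "nat \<Rightarrow> ('n::finite \<Rightarrow> nat \<Rightarrow> int) measure" where
  "zp_haar p = (THE \<mu>. is_haar_measure p \<mu>)"

text \<open>The value of \<open>(1/p)\<^sup>\<infinity>\<close> is \<open>0\<close>, as \<open>Re s > 0\<close> wherever the integral is used.\<close>

definition igusa_zeta :: "nat \<Rightarrow> ('n::finite, int) mpolynomial set \<Rightarrow> complex \<Rightarrow> complex" where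
  "igusa_zeta p I s = (\<integral>y. (case ord_ideal p I y of
       enat m \<Rightarrow> (1 / of_nat p) powr (s * of_nat m)
     | \<infinity> \<Rightarrow> 0) \<partial>(zp_haar p))"


section \<open>The normalized blow-up\<close>

text \<open>The ideal of \<open>\<rat>[x\<^sub>1, \<dots>, x\<^sub>n]\<close> generated by \<open>I\<close>.\<close>

definition rational_ideal :: "('n, int) mpolynomial set \<Rightarrow> ('n, rat) mpolynomial set" where
  "rational_ideal I = ideal_gen UNIV (Poly_Mapping.map rat_of_int ` I)"

definition embed :: "('n::{finite,linorder}, rat) mpolynomial \<Rightarrow> 'n funfield" where
  "embed f = Fract f 1"

definition coord :: "'n::{finite,linorder} \<Rightarrow> 'n funfield" where
  "coord i = embed (Poly_Mapping.single (Poly_Mapping.single i 1) 1)"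

definition is_subring :: "'a::comm_ring_1 set \<Rightarrow> bool" where
  "is_subring A \<longleftrightarrow> 1 \<in> A \<and> (\<forall>a\<in>A. \<forall>b\<in>A. a - b \<in> A \<and> a * b \<in> A)"

definition subring_gen :: "'a::comm_ring_1 set \<Rightarrow> 'a set" where
  "subring_gen S = \<Inter>{A. is_subring A \<and> S \<subseteq> A}"

definition integral_closure :: "'a::field set \<Rightarrow> 'a set" where
  "integral_closure A = {z. \<exists>q. lead_coeff q = 1 \<and> (\<forall>i. coeff q i \<in> A) \<and> poly q z = 0}"

definition prime_ideal_of :: "'a::comm_ring_1 set \<Rightarrow> 'a set \<Rightarrow> bool" where
  "prime_ideal_of A P \<longleftrightarrow> P \<subseteq> A \<and> ideal_gen A P = P \<and> 1 \<notin> P \<and>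
     (\<forall>a\<in>A. \<forall>b\<in>A. a * b \<in> P \<longrightarrow> a \<in> P \<or> b \<in> P)"

text \<open>Height one in a domain, where the zero ideal is the only prime of height zero.\<close>

definition height_one_prime :: "'a::idom set \<Rightarrow> 'a set \<Rightarrow> bool" where
  "height_one_prime A P \<longleftrightarrow> prime_ideal_of A P \<and> P \<noteq> {0} \<and>
     (\<forall>Q. prime_ideal_of A Q \<and> Q \<subseteq> P \<longrightarrow> Q = {0} \<or> Q = P)"

definition localization_at :: "'a::field set \<Rightarrow> 'a set \<Rightarrow> 'a set" where
  "localization_at A P = {a / b | a b. a \<in> A \<and> b \<in> A - P}"

text \<open>
  For an ideal \<open>J\<close> the blow-up \<open>Proj (\<Oplus>\<^sub>d J\<^sup>d)\<close> is covered by the charts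
  \<open>D\<^sub>+(f) = Spec \<rat>[x\<^sub>1, \<dots>, x\<^sub>n][g/f : g \<in> J]\<close> for nonzero \<open>f \<in> J\<close>; all of them have function
  field \<open>\<rat>(x\<^sub>1, \<dots>, x\<^sub>n)\<close>, and \<open>Y\<close> is covered by the spectra of their integral closures.
\<close>

definition blowup_chart ::
    "('n::{finite,linorder}, rat) mpolynomial set \<Rightarrow> ('n, rat) mpolynomial \<Rightarrow> 'n funfield set" where
  "blowup_chart J f = subring_gen (range embed \<union> {embed g / embed f | g. g \<in> J})"

text \<open>
  A prime divisor \<open>E\<close> on \<open>Y\<close> is given by its generic point, that is, by a prime ideal of height one in
  the coordinate ring of a normalized chart. The same \<open>E\<close> appears in several charts; we represent it
  by its local ring \<open>\<O>\<^sub>Y\<^sub>,\<^sub>E\<close> inside the function field, which determines the point, \<open>Y\<close> being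
  separated.
\<close>

definition prime_divisors ::
    "('n::{finite,linorder}, rat) mpolynomial set \<Rightarrow> 'n funfield set set" where
  "prime_divisors J = {localization_at (integral_closure (blowup_chart J f)) P | f P.
     f \<in> J \<and> f \<noteq> 0 \<and> height_one_prime (integral_closure (blowup_chart J f)) P}"

text \<open>
  The point \<open>t\<close> of the torus \<open>(\<rat>\<^sup>*)\<^sup>n\<close> acts on functions by \<open>x\<^sub>i \<mapsto> t\<^sub>i x\<^sub>i\<close>. Since the rational points
  are dense in the split torus, a divisor is invariant under the torus iff it is invariant under them.
\<close>

definition torus_act_poly ::
    "('n::finite \<Rightarrow> rat) \<Rightarrow> ('n, rat) mpolynomial \<Rightarrow> ('n, rat) mpolynomial" where
  "torus_act_poly t = Poly_Mapping.mapp (\<lambda>m c. c * (\<Prod>i\<in>UNIV. t i ^ Poly_Mapping.lookup m i))"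

definition torus_image ::
    "('n::{finite,linorder} \<Rightarrow> rat) \<Rightarrow> 'n funfield set \<Rightarrow> 'n funfield set" where
  "torus_image t A =
     {Fract (torus_act_poly t a) (torus_act_poly t b) | a b. b \<noteq> 0 \<and> Fract a b \<in> A}"

definition torus_invariant :: "'n::{finite,linorder} funfield set \<Rightarrow> bool" where
  "torus_invariant E \<longleftrightarrow> (\<forall>t. (\<forall>i. t i \<noteq> 0) \<longrightarrow> torus_image t E = E)"


section \<open>Orders along a prime divisor\<close>

text \<open>Below, \<open>E\<close> is the local ring of a prime divisor, a discrete valuation ring since \<open>Y\<close> is normal.\<close>

definition unit_along :: "'a::field set \<Rightarrow> 'a \<Rightarrow> bool" where
  "unit_along E u \<longleftrightarrow> u \<noteq> 0 \<and> u \<in> E \<and> inverse u \<in> E"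

definition uniformizer :: "'a::field set \<Rightarrow> 'a \<Rightarrow> bool" where
  "uniformizer E t \<longleftrightarrow> t \<noteq> 0 \<and> {x\<in>E. \<not> unit_along E x} = (\<lambda>x. t * x) ` E"

definition order_along :: "'a::field set \<Rightarrow> 'a \<Rightarrow> int" where
  "order_along E z = (THE k. \<exists>t u. uniformizer E t \<and> unit_along E u \<and> z = u * t powi k)"

text \<open>\<open>a\<^sub>E\<close>: the order along \<open>E\<close> of a local equation at \<open>E\<close> of the Cartier divisor of \<open>J \<cdot> \<O>\<^sub>Y\<close>.\<close>

definition ideal_order ::
    "'n::{finite,linorder} funfield set \<Rightarrow> ('n, rat) mpolynomial set \<Rightarrow> int" where
  "ideal_order E J =
     (THE k. \<exists>g. ideal_gen E (embed ` J) = (\<lambda>x. g * x) ` E \<and> g \<noteq> 0 \<and> k = order_along E g)"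

text \<open>Derivations of the function field over \<open>\<rat>\<close>; in characteristic \<open>0\<close> they are automatically
  \<open>\<rat>\<close>-linear.\<close>

definition derivation :: "('a::field \<Rightarrow> 'a) \<Rightarrow> bool" where
  "derivation D \<longleftrightarrow> (\<forall>a b. D (a + b) = D a + D b \<and> D (a * b) = a * D b + b * D a)"

text \<open>
  Local coordinates \<open>y\<close> of \<open>Y\<close> at the generic point of \<open>E\<close>, with the partial derivatives
  \<open>D j = \<partial>/\<partial>y\<^sub>j\<close>. That these preserve the local ring says that \<open>dy\<^sub>1, \<dots>, dy\<^sub>n\<close> split off a free
  direct summand of rank \<open>n\<close> from \<open>\<Omega>\<close> at \<open>E\<close>; as \<open>Y\<close> is smooth there, they form a basis of \<open>\<Omega>\<close>.
\<close>

definition local_coordinates ::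
    "'n::{finite,linorder} funfield set \<Rightarrow> ('n \<Rightarrow> 'n funfield) \<Rightarrow> ('n \<Rightarrow> 'n funfield \<Rightarrow> 'n funfield) \<Rightarrow> bool"
  where
  "local_coordinates E y D \<longleftrightarrow> (\<forall>i. y i \<in> E) \<and>
     (\<forall>j. derivation (D j) \<and> D j ` E \<subseteq> E \<and> (\<forall>i. D j (y i) = (if i = j then 1 else 0)))"

text \<open>\<open>k\<^sub>E\<close>: the order of vanishing along \<open>E\<close> of \<open>det (\<partial>x\<^sub>i/\<partial>y\<^sub>j)\<close>.\<close>

definition canonical_order :: "'n::{finite,linorder} funfield set \<Rightarrow> int" where
  "canonical_order E =
     (THE k. \<exists>y D. local_coordinates E y D \<and> k = order_along E (det (\<chi> i j. D j (coord i))))"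


section \<open>Existence and uniqueness of the Haar measure\<close>

instance int :: second_countable_topology
proof
  let ?B = "range (\<lambda>n::int. {n})"
  have "generate_topology ?B (\<Union>x\<in>S. {x})" for S
    by (intro generate_topology_Union) (auto intro: generate_topology.intros)
  then have "open = generate_topology ?B"
    by (auto intro!: ext simp: open_discrete)
  then show "\<exists>B::int set set. countable B \<and> open = generate_topology B"
    by (intro exI[of _ ?B]) simp
qed

definition zp_cyl :: "nat \<Rightarrow> ('n::finite \<Rightarrow> nat) \<Rightarrow> ('n \<Rightarrow> nat \<Rightarrow> int) \<Rightarrow> ('n \<Rightarrow> nat \<Rightarrow> int) set" where
  "zp_cyl p N c = {y\<in>zp_vec p. \<forall>i. y i (N i) = c i (N i)}"

lemma int_div_less:
  fixes x q b :: int
  assumes "0 < q" "x < b * q"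
  shows "x div q < b"
proof -
  have "x div q * q \<le> x"
    using div_mult_mod_eq[of x q] pos_mod_sign[OF assms(1), of x] by linarith
  then have "x div q * q < b * q" using assms(2) by linarith
  then show ?thesis using assms(1) by simp
qed

lemma zp_mod:
  assumes "x \<in> zp p" "k \<le> l"
  shows "x l mod int p ^ k = x k"
  using assms(2)
proof (induction l rule: dec_induct)
  case base
  then show ?case using assms(1) by (simp add: zp_def)
next
  case (step l)
  have "x (Suc l) mod int p ^ k = x (Suc l) mod int p ^ l mod int p ^ k"
    using step(1) by (simp add: mod_mod_cancel le_imp_power_dvd)
  also have "x (Suc l) mod int p ^ l = x l" using assms(1) by (simp add: zp_def)
  finally show ?case using step by simp
qed

lemma zp_bounds: "x \<in> zp p \<Longrightarrow> 0 \<le> x k" "x \<in> zp p \<Longrightarrow> x k < int p ^ k"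
  by (auto simp: zp_def)

lemma zpI_mod:
  assumes "p > 0" "\<And>k. x (Suc k) mod int p ^ k = x k mod int p ^ k"
  shows "(\<lambda>k. x k mod int p ^ k) \<in> zp p"
  using assms by (auto simp: zp_def mod_mod_cancel)

lemma zp_Suc_mod: "x \<in> zp p \<Longrightarrow> x (Suc k) mod int p ^ k = x k"
  by (simp add: zp_def)

lemma zp_add_closed:
  assumes "p > 0" "x \<in> zp p" "y \<in> zp p"
  shows "zp_add p x y \<in> zp p"
proof -
  have "(x (Suc k) + y (Suc k)) mod int p ^ k = (x k + y k) mod int p ^ k" for k
    using mod_add_eq[of "x (Suc k)" "int p ^ k" "y (Suc k)"] assms by (simp add: zp_Suc_mod)
  then show ?thesis unfolding zp_add_def using assms(1) by (intro zpI_mod)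
qed

definition zp_minus :: "nat \<Rightarrow> (nat \<Rightarrow> int) \<Rightarrow> (nat \<Rightarrow> int)" where
  "zp_minus p x = (\<lambda>k. (- x k) mod int p ^ k)"

lemma zp_minus_closed:
  assumes "p > 0" "x \<in> zp p"
  shows "zp_minus p x \<in> zp p"
proof -
  have "(- x (Suc k)) mod int p ^ k = (- x k) mod int p ^ k" for k
    using mod_minus_eq[of "x (Suc k)" "int p ^ k"] assms by (simp add: zp_Suc_mod)
  then show ?thesis unfolding zp_minus_def using assms(1) by (intro zpI_mod)
qed

lemma zp_add_minus:
  assumes "p > 0" "x \<in> zp p" "a \<in> zp p"
  shows "zp_add p a (zp_add p (zp_minus p a) x) = x" "zp_add p (zp_minus p a) (zp_add p a x) = x"
  using assms by (auto simp: zp_add_def zp_minus_def zp_def mod_simps fun_eq_iff)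

lemma zp_power_ideal_eq:
  assumes "p > 0"
  shows "zp_power_ideal p m = {x\<in>zp p. x m = 0}"
proof (intro equalityI subsetI)
  fix x assume "x \<in> zp_power_ideal p m"
  then obtain z where z: "z \<in> zp p" "x = zp_scale p (int p ^ m) z"
    by (auto simp: zp_power_ideal_def)
  have "(int p ^ m * z (Suc k)) mod int p ^ k = (int p ^ m * z k) mod int p ^ k" for k
    using mod_mult_right_eq[of "int p ^ m" "z (Suc k)" "int p ^ k"] z(1) by (simp add: zp_Suc_mod)
  then have "x \<in> zp p" unfolding z(2) zp_scale_def using assms by (intro zpI_mod)
  then show "x \<in> {x\<in>zp p. x m = 0}" using z by (simp add: zp_scale_def)
next
  fix x assume "x \<in> {x\<in>zp p. x m = 0}"
  then have x: "x \<in> zp p" "x m = 0" by auto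
  define z where "z = (\<lambda>k. x (k + m) div int p ^ m)"
  have dv: "int p ^ m dvd x (k + m)" for k
    using zp_mod[OF x(1), of m "k + m"] x(2) by (simp add: dvd_eq_mod_eq_0)
  have "x (k + m) < int p ^ k * int p ^ m" for k
    using zp_bounds(2)[OF x(1), of "k + m"] by (simp add: power_add)
  then have b: "z k < int p ^ k" for k
    unfolding z_def using assms by (intro int_div_less) auto
  have "z (Suc k) mod int p ^ k = z k" for k
  proof -
    have "(x (Suc k + m) mod (int p ^ m * int p ^ k)) div int p ^ m
            = x (Suc k + m) div int p ^ m mod int p ^ k"
      using assms by (simp add: zmod_zmult2_eq)
    moreover have "x (Suc k + m) mod (int p ^ m * int p ^ k) = x (k + m)"
      using zp_mod[OF x(1), of "k + m" "Suc k + m"] by (simp add: power_add mult.commute)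
    ultimately show ?thesis by (simp add: z_def)
  qed
  then have "z \<in> zp p"
    using b zp_bounds(1)[OF x(1)] assms by (auto simp: zp_def z_def pos_imp_zdiv_nonneg_iff)
  moreover have "x = zp_scale p (int p ^ m) z"
    using dv zp_mod[OF x(1)] by (auto simp: zp_scale_def z_def fun_eq_iff)
  ultimately show "x \<in> zp_power_ideal p m" by (auto simp: zp_power_ideal_def)
qed

lemma zp_zero: "p > 0 \<Longrightarrow> (\<lambda>_. 0) \<in> zp p"
  by (simp add: zp_def)

lemma zp_box_eq_cyl:
  assumes "p > 0"
  shows "{y. \<forall>i. y i \<in> zp_power_ideal p (m i)} = zp_cyl p m (\<lambda>_ _. 0)"
  using assms by (auto simp: zp_cyl_def zp_power_ideal_eq zp_vec_def)

definition zp_balls :: "nat \<Rightarrow> ('n::finite \<Rightarrow> nat \<Rightarrow> int) set set" where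
  "zp_balls p = insert {} {zp_cyl p (\<lambda>_. k) c | k c. c \<in> zp_vec p}"

lemma zp_ball_in: "{y\<in>zp_vec p. \<forall>i. y i k = d i} \<in> zp_balls p"
proof (cases "\<exists>c\<in>zp_vec p. \<forall>i. c i k = d i")
  case True
  then obtain c where "c \<in> zp_vec p" "\<forall>i. c i k = d i" by blast
  then have "{y\<in>zp_vec p. \<forall>i. y i k = d i} = zp_cyl p (\<lambda>_. k) c" by (auto simp: zp_cyl_def)
  with \<open>c \<in> zp_vec p\<close> show ?thesis by (auto simp: zp_balls_def)
next
  case False
  then have "{y\<in>zp_vec p. \<forall>i. y i k = d i} = {}" by blast
  then show ?thesis unfolding zp_balls_def by blast
qed

lemma zp_balls_Int_stable: "Int_stable (zp_balls p)"
proof -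
  have *: "zp_cyl p (\<lambda>_. k) c \<inter> zp_cyl p (\<lambda>_. l) d \<in> zp_balls p"
    if "c \<in> zp_vec p" "d \<in> zp_vec p" "k \<le> l" for k l c d
  proof (cases "\<forall>i. d i k = c i k")
    case True
    have "y i k = d i k" if "y \<in> zp_cyl p (\<lambda>_. l) d" for y i
      using that zp_mod[of "y i" p k l] zp_mod[of "d i" p k l] \<open>d \<in> _\<close> \<open>k \<le> l\<close>
      by (auto simp: zp_cyl_def zp_vec_def)
    then have "zp_cyl p (\<lambda>_. k) c \<inter> zp_cyl p (\<lambda>_. l) d = zp_cyl p (\<lambda>_. l) d"
      using True by (auto simp: zp_cyl_def)
    then show ?thesis using that by (auto simp: zp_balls_def)
  next
    case False
    have "y i k = d i k" if "y \<in> zp_cyl p (\<lambda>_. l) d" for y i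
      using that zp_mod[of "y i" p k l] zp_mod[of "d i" p k l] \<open>d \<in> _\<close> \<open>k \<le> l\<close>
      by (auto simp: zp_cyl_def zp_vec_def)
    then have "zp_cyl p (\<lambda>_. k) c \<inter> zp_cyl p (\<lambda>_. l) d = {}"
      using False by (fastforce simp: zp_cyl_def)
    then show ?thesis unfolding zp_balls_def by (metis insertI1)
  qed
  show ?thesis
  proof (rule Int_stableI)
    fix A B assume "A \<in> (zp_balls p :: ('a \<Rightarrow> nat \<Rightarrow> int) set set)" "B \<in> (zp_balls p :: ('a \<Rightarrow> nat \<Rightarrow> int) set set)"
    then consider "A = {} \<or> B = {}"
      | k l c d where "c \<in> zp_vec p" "d \<in> zp_vec p" "A = zp_cyl p (\<lambda>_. k) c" "B = zp_cyl p (\<lambda>_. l) d"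
      by (auto simp: zp_balls_def)
    then show "A \<inter> B \<in> zp_balls p"
    proof cases
      case 1
      then show ?thesis by (auto simp: zp_balls_def)
    next
      case (2 k l c d)
      then show ?thesis using *[of c d k l] *[of d c l k]
        by (cases "k \<le> l") (simp_all add: Int_commute)
    qed
  qed
qed

lemma zp_vec_in_balls:
  assumes "p > 0"
  shows "(zp_vec p :: ('n::finite \<Rightarrow> nat \<Rightarrow> int) set) \<in> zp_balls p"
proof -
  have "y i 0 = 0" if "y \<in> zp_vec p" for y :: "'n \<Rightarrow> nat \<Rightarrow> int" and i
    using that zp_bounds[of "y i" p 0] by (auto simp: zp_vec_def)
  then have "{y\<in>zp_vec p. \<forall>i::'n. y i 0 = 0} = zp_vec p" by auto
  then show ?thesis using zp_ball_in[of p 0 "\<lambda>_::'n. 0"] by simp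
qed

lemma zp_coord_measurable: "(\<lambda>y. y i k) \<in> borel_measurable (borel :: ('n::finite \<Rightarrow> nat \<Rightarrow> int) measure)"
  by (rule measurable_product_then_coordinatewise[OF measurable_product_coordinates])

lemma zp_cyl_sets:
  fixes c :: "'n::finite \<Rightarrow> nat \<Rightarrow> int"
  shows "zp_cyl p N c \<in> sets (restrict_space borel (zp_vec p))"
proof -
  let ?B = "\<lambda>i. {y :: 'n \<Rightarrow> nat \<Rightarrow> int. y i (N i) = c i (N i)}"
  have "?B i \<in> sets borel" for i
    using measurable_sets[OF zp_coord_measurable[of i "N i"], of "{c i (N i)}"]
    by (simp add: vimage_def)
  then have "(\<Inter>i\<in>UNIV. ?B i) \<in> sets borel"
    using sets.finite_INT[of UNIV ?B borel] by simp
  moreover have "zp_cyl p N c = zp_vec p \<inter> (\<Inter>i\<in>UNIV. ?B i)"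
    by (auto simp: zp_cyl_def)
  ultimately show ?thesis by (auto simp: sets_restrict_space)
qed

lemma zp_borel_eq:
  assumes "p > 0"
  shows "sets (restrict_space borel (zp_vec p :: ('n::finite \<Rightarrow> nat \<Rightarrow> int) set))
           = sigma_sets (zp_vec p) (zp_balls p)"
proof
  let ?V = "zp_vec p :: ('n \<Rightarrow> nat \<Rightarrow> int) set"
  have sub: "zp_balls p \<subseteq> Pow ?V" by (auto simp: zp_balls_def zp_cyl_def)
  have "zp_balls p \<subseteq> sets (restrict_space borel ?V)"
    using zp_cyl_sets by (auto simp: zp_balls_def)
  then show "sigma_sets ?V (zp_balls p) \<subseteq> sets (restrict_space borel ?V)"
    using sets.sigma_sets_subset[of "zp_balls p" "restrict_space borel ?V"]
    by (simp add: space_restrict_space)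
  let ?S = "sigma ?V (zp_balls p)"
  have S: "space ?S = ?V" "sets ?S = sigma_sets ?V (zp_balls p)"
    using sub by (auto simp: space_measure_of sets_measure_of)
  have "(\<lambda>y. y i k) \<in> borel_measurable ?S" for i k
  proof -
    have "(\<lambda>y. y i k) \<in> measurable ?S (count_space UNIV)"
    proof (rule measurable_count_space_eq2_countable[THEN iffD2, rule_format], intro conjI ballI)
      fix c :: int
      have "(\<lambda>y. y i k) -` {c} \<inter> space ?S
              = (\<Union>d\<in>{d::'n \<Rightarrow> int. d i = c}. {y\<in>zp_vec p. \<forall>i. y i k = d i})"
        by (auto simp: S)
      also have "\<dots> \<in> sets ?S"
        unfolding S(2) by (intro sigma_sets_UNION) (auto intro!: zp_ball_in)
      finally show "(\<lambda>y. y i k) -` {c} \<inter> space ?S \<in> sets ?S" .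
    qed auto
    then show ?thesis
      using measurable_cong_sets[OF refl sets_borel_eq_count_space, of ?S] by blast
  qed
  then have "(\<lambda>y. y) \<in> borel_measurable ?S"
    by (intro measurable_coordinatewise_then_product)
  then show "sets (restrict_space borel ?V) \<subseteq> sigma_sets ?V (zp_balls p)"
    using measurable_sets[of "\<lambda>y. y" ?S borel]
    by (fastforce simp: sets_restrict_space S Int_commute)
qed

lemma zp_translate_cyl:
  assumes "p > 0" "a \<in> zp_vec p" "c \<in> zp_vec p"
  shows "(\<lambda>y i. zp_add p (a i) (y i)) ` zp_cyl p N c
           = zp_cyl p N (\<lambda>i. zp_add p (a i) (c i))"
    (is "?f ` _ = _")
proof (intro equalityI subsetI)
  fix z assume "z \<in> ?f ` zp_cyl p N c"
  then obtain y where "y \<in> zp_cyl p N c" "z = ?f y" by blast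
  then show "z \<in> zp_cyl p N (\<lambda>i. zp_add p (a i) (c i))"
    using assms zp_add_closed[OF assms(1)]
    by (auto simp: zp_cyl_def zp_vec_def) (simp add: zp_add_def)
next
  fix z assume z: "z \<in> zp_cyl p N (\<lambda>i. zp_add p (a i) (c i))"
  define y where "y = (\<lambda>i. zp_add p (zp_minus p (a i)) (z i))"
  have zv: "z i \<in> zp p" "a i \<in> zp p" "c i \<in> zp p" for i
    using z assms by (auto simp: zp_cyl_def zp_vec_def)
  have "?f y = z" using zv assms(1) by (simp add: y_def zp_add_minus)
  moreover have "y i (N i) = c i (N i)" for i
  proof -
    have "y i (N i) = zp_add p (zp_minus p (a i)) (zp_add p (a i) (c i)) (N i)"
      using z by (simp add: y_def zp_cyl_def zp_add_def)
    then show ?thesis using zv assms(1) by (simp add: zp_add_minus)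
  qed
  moreover have "y \<in> zp_vec p"
    using zv assms(1) by (auto simp: y_def zp_vec_def zp_add_closed zp_minus_closed)
  ultimately show "z \<in> ?f ` zp_cyl p N c"
    by (intro image_eqI[of z ?f y]) (simp_all add: zp_cyl_def)
qed

lemma zp_haar_unique:
  fixes \<mu> \<nu> :: "('n::finite \<Rightarrow> nat \<Rightarrow> int) measure"
  assumes "p > 0" "is_haar_measure p \<mu>" "is_haar_measure p \<nu>"
  shows "\<mu> = \<nu>"
proof -
  have ball: "emeasure \<rho> (zp_cyl p (\<lambda>_. k) c) = ennreal ((1 / real p) ^ (\<Sum>i\<in>(UNIV::'n set). k))"
    if "is_haar_measure p \<rho>" "c \<in> zp_vec p" for \<rho> k and c :: "'n \<Rightarrow> nat \<Rightarrow> int"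
  proof -
    have *: "(\<lambda>y i. zp_add p (c i) (y i)) ` zp_cyl p (\<lambda>_. k) (\<lambda>_ _. 0) = zp_cyl p (\<lambda>_. k) c"
    proof -
      have "zp_add p (c i) (\<lambda>_. 0) = c i" for i
        using that(2) by (auto simp: zp_add_def zp_vec_def zp_def fun_eq_iff)
      then show ?thesis using assms(1) that(2)
        by (subst zp_translate_cyl) (auto simp: zp_vec_def zp_zero)
    qed
    have tr: "emeasure \<rho> ((\<lambda>y i. zp_add p (a i) (y i)) ` A) = emeasure \<rho> A"
      if "a \<in> zp_vec p" "A \<in> sets \<rho>" for a A
      using \<open>is_haar_measure p \<rho>\<close> that by (simp add: is_haar_measure_def)
    have box: "emeasure \<rho> {y. \<forall>i. y i \<in> zp_power_ideal p (m i)}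
            = ennreal ((1 / real p) ^ (\<Sum>i\<in>UNIV. m i))" for m
      using \<open>is_haar_measure p \<rho>\<close> by (simp add: is_haar_measure_def)
    have "zp_cyl p (\<lambda>_. k) (\<lambda>_ _. 0) \<in> sets \<rho>"
      using \<open>is_haar_measure p \<rho>\<close> zp_cyl_sets by (simp add: is_haar_measure_def)
    from tr[OF that(2) this]
    have "emeasure \<rho> (zp_cyl p (\<lambda>_. k) c) = emeasure \<rho> (zp_cyl p (\<lambda>_. k) (\<lambda>_ _. 0))"
      by (simp only: *)
    also have "\<dots> = ennreal ((1 / real p) ^ (\<Sum>i\<in>(UNIV::'n set). k))"
      using box[of "\<lambda>_. k"] by (simp only: zp_box_eq_cyl[OF assms(1)])
    finally show ?thesis .
  qed
  show ?thesis
  proof (rule measure_eqI_generator_eq[where E = "zp_balls p" and \<Omega> = "zp_vec p" and A = "\<lambda>_. zp_vec p"])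
    show "zp_balls p \<subseteq> Pow (zp_vec p)" by (auto simp: zp_balls_def zp_cyl_def)
    show "emeasure \<mu> X = emeasure \<nu> X" if X: "X \<in> zp_balls p" for X
    proof (cases "X = {}")
      case False
      then obtain k c where "X = zp_cyl p (\<lambda>_. k) c" "c \<in> zp_vec p"
        using X by (auto simp: zp_balls_def)
      then show ?thesis by (simp add: ball[OF assms(2)] ball[OF assms(3)])
    qed simp
    have "zp_vec p \<noteq> ({} :: ('n \<Rightarrow> nat \<Rightarrow> int) set)"
      using zp_zero[OF assms(1)] by (auto simp: zp_vec_def)
    then obtain k c where "zp_vec p = zp_cyl p (\<lambda>_. k) c" "(c :: 'n \<Rightarrow> nat \<Rightarrow> int) \<in> zp_vec p"
      using zp_vec_in_balls[OF assms(1), where 'n = 'n] by (auto simp: zp_balls_def)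
    then show "emeasure \<mu> (zp_vec p) \<noteq> \<infinity>"
      using ball[OF assms(2), of c k] by simp
    show "sets \<mu> = sigma_sets (zp_vec p) (zp_balls p)" "sets \<nu> = sigma_sets (zp_vec p) (zp_balls p)"
      using assms zp_borel_eq by (simp_all add: is_haar_measure_def)
  qed (use zp_balls_Int_stable zp_vec_in_balls[OF assms(1)] in auto)
qed

text \<open>Existence: the law of \<open>\<Sum>\<^sub>j d\<^sub>j p\<^sup>j\<close> for independent uniformly distributed digits.\<close>

lemma base_expansion_sum:
  fixes d :: "nat \<Rightarrow> int"
  assumes "p > 0" "\<And>j. j < N \<Longrightarrow> 0 \<le> d j \<and> d j < int p"
  shows "0 \<le> (\<Sum>j<N. d j * int p ^ j) \<and> (\<Sum>j<N. d j * int p ^ j) < int p ^ N"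
  using assms(2)
proof (induction N)
  case (Suc N)
  have "d N * int p ^ N \<le> (int p - 1) * int p ^ N"
    using Suc.prems[of N] by (intro mult_right_mono) auto
  moreover have "0 \<le> d N * int p ^ N" using Suc.prems[of N] by simp
  ultimately show ?case using Suc.IH Suc.prems by (auto simp: algebra_simps)
qed simp

lemma base_expansion_eq_iff:
  fixes d e :: "nat \<Rightarrow> int"
  assumes "p > 0" "\<And>j. j < N \<Longrightarrow> 0 \<le> d j \<and> d j < int p"
    and v: "0 \<le> v" "v < int p ^ N"
  shows "(\<Sum>j<N. d j * int p ^ j) = v \<longleftrightarrow> (\<forall>j<N. d j = v div int p ^ j mod int p)"
  using assms(2) v
proof (induction N arbitrary: v)
  case (Suc N)
  let ?s = "\<Sum>j<N. d j * int p ^ j" and ?q = "int p ^ N"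
  have q: "?q > 0" using assms(1) by simp
  have s: "0 \<le> ?s" "?s < ?q" using base_expansion_sum[of p N d] assms(1) Suc.prems(1) by auto
  have vq: "0 \<le> v div ?q" "v div ?q < int p"
    using Suc.prems(2,3) q by (auto simp: pos_imp_zdiv_nonneg_iff mult.commute intro!: int_div_less)
  have "?s + d N * ?q = v \<longleftrightarrow> ?s = v mod ?q \<and> d N = v div ?q"
  proof
    assume *: "?s + d N * ?q = v"
    then have "v mod ?q = ?s" "v div ?q = d N" using s q by auto
    then show "?s = v mod ?q \<and> d N = v div ?q" by simp
  next
    assume "?s = v mod ?q \<and> d N = v div ?q"
    then show "?s + d N * ?q = v" by (simp add: mod_div_mult_eq)
  qed
  also have "?s = v mod ?q \<longleftrightarrow> (\<forall>j<N. d j = v mod ?q div int p ^ j mod int p)"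
    using Suc.prems(1) q by (intro Suc.IH) auto
  also have "(\<forall>j<N. d j = v mod ?q div int p ^ j mod int p) \<longleftrightarrow> (\<forall>j<N. d j = v div int p ^ j mod int p)"
  proof -
    have "v mod ?q div int p ^ j mod int p = v div int p ^ j mod int p" if "j < N" for j
    proof -
      have "?q = int p ^ j * int p ^ (N - j)" using that by (simp flip: power_add)
      then have "v mod ?q div int p ^ j = v div int p ^ j mod int p ^ (N - j)"
        using assms(1) by (simp add: zmod_zmult2_eq)
      moreover have "int p dvd int p ^ (N - j)" using that by simp
      ultimately show ?thesis by (simp add: mod_mod_cancel)
    qed
    then show ?thesis by auto
  qed
  finally have "(\<Sum>j<Suc N. d j * int p ^ j) = v
      \<longleftrightarrow> (\<forall>j<N. d j = v div int p ^ j mod int p) \<and> d N = v div ?q" by simp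
  also have "v div ?q = v div ?q mod int p" using vq by simp
  finally show ?case by (auto simp: less_Suc_eq)
qed simp

definition zp_digit_measure :: "nat \<Rightarrow> ('n::finite \<times> nat \<Rightarrow> int) measure" where
  "zp_digit_measure p = PiM UNIV (\<lambda>_. uniform_count_measure {0..<int p})"

definition zp_of_digits :: "nat \<Rightarrow> ('n::finite \<times> nat \<Rightarrow> int) \<Rightarrow> ('n \<Rightarrow> nat \<Rightarrow> int)" where
  "zp_of_digits p d = (\<lambda>i k. \<Sum>j<k. d (i, j) * int p ^ j)"

definition zp_product_measure :: "nat \<Rightarrow> ('n::finite \<Rightarrow> nat \<Rightarrow> int) measure" where
  "zp_product_measure p = distr (zp_digit_measure p) (restrict_space borel (zp_vec p)) (zp_of_digits p)"

lemma zp_digit_space: "d \<in> space (zp_digit_measure p) \<longleftrightarrow> (\<forall>ij. 0 \<le> d ij \<and> d ij < int p)"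
  by (auto simp: zp_digit_measure_def space_PiM PiE_UNIV_domain space_uniform_count_measure)

lemma zp_of_digits_in:
  assumes "p > 0" "d \<in> space (zp_digit_measure p)"
  shows "zp_of_digits p d \<in> zp_vec p"
proof -
  have "0 \<le> (\<Sum>j<k. d (i, j) * int p ^ j) \<and> (\<Sum>j<k. d (i, j) * int p ^ j) < int p ^ k" for i k
    using assms by (intro base_expansion_sum) (auto simp: zp_digit_space)
  then show ?thesis by (auto simp: zp_vec_def zp_def zp_of_digits_def)
qed

lemma borel_measurable_int_op:
  fixes f g :: "'a \<Rightarrow> int" and h :: "int \<Rightarrow> int \<Rightarrow> int"
  assumes "f \<in> borel_measurable M" "g \<in> borel_measurable M"
  shows "(\<lambda>x. h (f x) (g x)) \<in> borel_measurable M"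
proof -
  have eq: "borel_measurable M = measurable M (count_space (UNIV :: int set))"
    by (rule measurable_cong_sets[OF refl sets_borel_eq_count_space])
  have "(\<lambda>x. h a (g x)) \<in> borel_measurable M" for a
    using assms(2) unfolding eq by (rule measurable_compose) simp
  then show ?thesis using assms(1) unfolding eq by (rule measurable_compose_countable)
qed

lemma zp_of_digits_measurable:
  assumes "p > 0"
  shows "zp_of_digits p \<in> measurable (zp_digit_measure p) (restrict_space borel (zp_vec p))"
proof (rule measurable_restrict_space2)
  show "zp_of_digits p \<in> space (zp_digit_measure p) \<rightarrow> zp_vec p"
    using assms by (auto simp: zp_of_digits_in)
  have "(\<lambda>d. d ij) \<in> borel_measurable (zp_digit_measure p)" for ij
  proof -
    have "(\<lambda>d. d ij) \<in> measurable (zp_digit_measure p) (uniform_count_measure {0..<int p})"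
      unfolding zp_digit_measure_def by (intro measurable_component_singleton) auto
    moreover have "(\<lambda>x. x) \<in> borel_measurable (uniform_count_measure {0..<int p})"
      using measurable_cong_sets[OF sets_uniform_count_measure_count_space refl]
      by (simp add: measurable_count_space_eq1)
    ultimately show ?thesis by (rule measurable_compose)
  qed
  note coord = this
  have "(\<lambda>d. zp_of_digits p d i k) \<in> borel_measurable (zp_digit_measure p)" for i k
  proof (induction k)
    case (Suc k)
    have "(\<lambda>d. zp_of_digits p d i k + d (i, k) * int p ^ k) \<in> borel_measurable (zp_digit_measure p)"
      by (rule borel_measurable_int_op[OF Suc coord])
    then show ?case by (simp add: zp_of_digits_def)
  qed (simp add: zp_of_digits_def)
  then show "zp_of_digits p \<in> borel_measurable (zp_digit_measure p)"
    by (intro measurable_coordinatewise_then_product)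
qed

lemma zp_product_measure_cyl:
  fixes c :: "'n::finite \<Rightarrow> nat \<Rightarrow> int"
  assumes "p > 0" "c \<in> zp_vec p"
  shows "emeasure (zp_product_measure p) (zp_cyl p N c) = ennreal ((1 / real p) ^ (\<Sum>i\<in>UNIV. N i))"
proof -
  let ?U = "\<lambda>_::'n \<times> nat. uniform_count_measure {0..<int p}"
  let ?J = "SIGMA i:UNIV. {..<N i}"
  let ?e = "\<lambda>(i, j). c i (N i) div int p ^ j mod int p"
  have "zp_of_digits p d i (N i) = c i (N i) \<longleftrightarrow> (\<forall>j<N i. d (i, j) = ?e (i, j))"
    if "d \<in> space (zp_digit_measure p)" for d i
    unfolding zp_of_digits_def using that assms zp_bounds[of "c i" p "N i"]
    by (subst base_expansion_eq_iff) (auto simp: zp_digit_space zp_vec_def)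
  then have "zp_of_digits p -` zp_cyl p N c \<inter> space (zp_digit_measure p)
      = {d\<in>space (zp_digit_measure p). \<forall>ij\<in>?J. d ij = ?e ij}"
    using assms by (auto simp: zp_cyl_def zp_of_digits_in)
  also have "\<dots> = prod_emb UNIV ?U ?J (Pi\<^sub>E ?J (\<lambda>ij. {?e ij}))"
    by (auto simp: prod_emb_def zp_digit_measure_def space_PiM PiE_iff split: prod.splits)
  finally have "emeasure (zp_product_measure p) (zp_cyl p N c)
      = emeasure (zp_digit_measure p) (prod_emb UNIV ?U ?J (Pi\<^sub>E ?J (\<lambda>ij. {?e ij})))"
    unfolding zp_product_measure_def
    by (simp add: emeasure_distr zp_of_digits_measurable assms zp_cyl_sets)
  also have "\<dots> = (\<Prod>ij\<in>?J. emeasure (?U ij) {?e ij})"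
    unfolding zp_digit_measure_def
    using assms(1)
    by (intro emeasure_PiM_emb prob_space_uniform_count_measure)
       (auto simp: sets_uniform_count_measure)
  also have "\<dots> = (\<Prod>ij\<in>?J. ennreal (1 / real p))"
    using assms(1) by (intro prod.cong) (auto simp: emeasure_uniform_count_measure)
  also have "\<dots> = ennreal ((1 / real p) ^ (\<Sum>i\<in>UNIV. N i))"
    by (simp add: ennreal_power)
  finally show ?thesis .
qed

lemma zp_product_measure_haar:
  assumes "p > 0"
  shows "is_haar_measure p (zp_product_measure p :: ('n::finite \<Rightarrow> nat \<Rightarrow> int) measure)"
proof -
  let ?\<nu> = "zp_product_measure p :: ('n \<Rightarrow> nat \<Rightarrow> int) measure"
  let ?R = "restrict_space borel (zp_vec p) :: ('n \<Rightarrow> nat \<Rightarrow> int) measure"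
  have sets: "sets ?\<nu> = sets ?R" by (simp add: zp_product_measure_def)
  then have space: "space ?\<nu> = zp_vec p"
    using sets_eq_imp_space_eq[OF sets] by (simp add: space_restrict_space)
  have zv: "y i \<in> zp p" if "y \<in> zp_vec p" for y :: "'n \<Rightarrow> nat \<Rightarrow> int" and i
    using that by (simp add: zp_vec_def)
  have addv: "(\<lambda>i. zp_add p (a i) (y i)) \<in> zp_vec p"
    if "a \<in> zp_vec p" "y \<in> zp_vec p" for a y :: "'n \<Rightarrow> nat \<Rightarrow> int"
    using that assms by (simp add: zp_vec_def zp_add_closed)
  have minv: "(\<lambda>i. zp_minus p (a i)) \<in> zp_vec p" if "a \<in> zp_vec p" for a :: "'n \<Rightarrow> nat \<Rightarrow> int"
    using that assms by (simp add: zp_vec_def zp_minus_closed)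
  have "emeasure ?\<nu> ((\<lambda>y i. zp_add p (a i) (y i)) ` A) = emeasure ?\<nu> A"
    if a: "a \<in> zp_vec p" and A: "A \<in> sets ?\<nu>" for a A
  proof -
    let ?f = "\<lambda>y i. zp_add p (a i) (y i)"
    let ?g = "\<lambda>y i. zp_add p (zp_minus p (a i)) (y i)"
    have pre: "?g -` B \<inter> zp_vec p = ?f ` B" if "B \<subseteq> zp_vec p" for B
    proof (intro equalityI subsetI)
      fix y assume "y \<in> ?g -` B \<inter> zp_vec p"
      then have "?g y \<in> B" "y = ?f (?g y)"
        using zv a assms by (auto simp: zp_add_minus)
      then show "y \<in> ?f ` B" by (intro image_eqI[of y ?f "?g y"])
    next
      fix y assume "y \<in> ?f ` B"
      then obtain z where z: "z \<in> B" "y = ?f z" by (elim imageE)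
      then have "?g y = z" using zv a assms \<open>B \<subseteq> _\<close> by (auto simp: zp_add_minus)
      then show "y \<in> ?g -` B \<inter> zp_vec p" using z addv a \<open>B \<subseteq> _\<close> by auto
    qed
    have gm: "?g \<in> measurable ?\<nu> ?R"
    proof (rule measurable_restrict_space2)
      show "?g \<in> space ?\<nu> \<rightarrow> zp_vec p" using addv[OF minv[OF a]] space by auto
      have [measurable]: "(\<lambda>y. y i k) \<in> borel_measurable ?\<nu>" for i k
        using measurable_restrict_space1[OF zp_coord_measurable] measurable_cong_sets[OF sets refl]
        by blast
      have "(\<lambda>y. ?g y i k) \<in> borel_measurable ?\<nu>" for i k
        unfolding zp_add_def
        using borel_measurable_int_op[of "\<lambda>y. y i k" ?\<nu> "\<lambda>y. y i k"
            "\<lambda>x _. (zp_minus p (a i) k + x) mod int p ^ k"] by simp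
      then show "?g \<in> borel_measurable ?\<nu>"
        by (intro measurable_coordinatewise_then_product)
    qed
    have "distr ?\<nu> ?R ?g = ?\<nu>"
    proof (rule measure_eqI_generator_eq[where E = "zp_balls p" and \<Omega> = "zp_vec p" and A = "\<lambda>_. zp_vec p"])
      show sub: "zp_balls p \<subseteq> Pow (zp_vec p)" by (auto simp: zp_balls_def zp_cyl_def)
      show "emeasure (distr ?\<nu> ?R ?g) X = emeasure ?\<nu> X" if X: "X \<in> zp_balls p" for X
      proof (cases "X = {}")
        case False
        then obtain k c where c: "X = zp_cyl p (\<lambda>_. k) c" "c \<in> zp_vec p"
          using X by (auto simp: zp_balls_def)
        have "emeasure (distr ?\<nu> ?R ?g) X = emeasure ?\<nu> (?f ` X)"
          using c gm zp_cyl_sets[of p "\<lambda>_. k" c] pre[of X] sub X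
          by (subst emeasure_distr) (auto simp: space)
        also have "?f ` X = zp_cyl p (\<lambda>_. k) (\<lambda>i. zp_add p (a i) (c i))"
          using c a assms by (simp add: zp_translate_cyl)
        finally show ?thesis using c a assms addv by (simp add: zp_product_measure_cyl)
      qed simp
      have "zp_vec p \<noteq> ({} :: ('n \<Rightarrow> nat \<Rightarrow> int) set)"
        using a by auto
      then obtain k c where "zp_vec p = zp_cyl p (\<lambda>_. k) c" "(c :: 'n \<Rightarrow> nat \<Rightarrow> int) \<in> zp_vec p"
        using zp_vec_in_balls[OF assms, where 'n = 'n] by (auto simp: zp_balls_def)
      then have "emeasure ?\<nu> (zp_vec p) = ennreal ((1 / real p) ^ (\<Sum>i\<in>(UNIV::'n set). k))"
        using zp_product_measure_cyl[OF assms, of c "\<lambda>_. k"] by simp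
      moreover have "emeasure (distr ?\<nu> ?R ?g) (zp_vec p) = emeasure ?\<nu> (?f ` zp_vec p)"
        using gm pre[of "zp_vec p"] sets.top[of ?R]
        by (subst emeasure_distr) (auto simp: space space_restrict_space)
      moreover have "?f ` zp_vec p = zp_vec p"
        using pre[of "zp_vec p"] addv[OF minv[OF a]] by blast
      ultimately show "emeasure (distr ?\<nu> ?R ?g) (zp_vec p) \<noteq> \<infinity>" by simp
      show "sets (distr ?\<nu> ?R ?g) = sigma_sets (zp_vec p) (zp_balls p)"
        "sets ?\<nu> = sigma_sets (zp_vec p) (zp_balls p)"
        using sets zp_borel_eq[OF assms] by simp_all
    qed (use zp_balls_Int_stable zp_vec_in_balls[OF assms] in auto)
    then have "emeasure ?\<nu> A = emeasure (distr ?\<nu> ?R ?g) A" by simp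
    also have "\<dots> = emeasure ?\<nu> (?f ` A)"
      using gm A sets pre[of A] sets.sets_into_space[OF A]
      by (subst emeasure_distr) (auto simp: space)
    finally show ?thesis by simp
  qed
  moreover have "(\<lambda>_ _. 0) \<in> (zp_vec p :: ('n \<Rightarrow> nat \<Rightarrow> int) set)"
    using assms by (simp add: zp_vec_def zp_zero)
  ultimately show ?thesis
    using sets assms by (auto simp: is_haar_measure_def zp_box_eq_cyl zp_product_measure_cyl)
qed

theorem is_haar_measure_zp_haar:
  assumes "p > 0"
  shows "is_haar_measure p (zp_haar p)"
  unfolding zp_haar_def
  by (rule theI[of _ "zp_product_measure p"])
     (use assms zp_product_measure_haar zp_haar_unique in blast)+

end

theory Submission
  imports Defs
begin

text \<open>
  Let \<open>M\<close> be the set of exponents of monomials generating \<open>I\<close>. At a point with coordinate orders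
  \<open>v \<in> \<nat>\<^sup>n\<close> the ideal has order \<open>\<phi>(v) = min {m \<cdot> v | m \<in> M}\<close>, so up to a constant the zeta function is the
  sum of \<open>p\<^bsup>-|v| - s \<phi>(v)\<^esup>\<close> over \<open>v \<in> \<nat>\<^sup>n\<close>. The rays of the fan on which \<open>\<phi>\<close> is piecewise linear are spanned
  by the primitive facet normals \<open>w\<close> of the Newton polyhedron, and every \<open>v\<close> is a bounded remainder plus
  a combination of such normals on which \<open>\<phi>\<close> is additive. Selecting the lexicographically least
  combination for each \<open>v\<close> exhibits the sum as an entire function divided by the product of the factors
  \<open>1 - p\<^bsup>-|w| - s \<phi>(w)\<^esup>\<close>. Hence a pole satisfies \<open>Re s = -|w| / \<phi>(w)\<close> for some \<open>w\<close> with \<open>\<phi>(w) \<noteq> 0\<close>.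

  The divisor belonging to \<open>w\<close> is the center of the monomial valuation \<open>x\<^sup>m \<mapsto> m \<cdot> w\<close>: because \<open>w\<close> is
  normal to a facet, the valuation ring is the localization at a height one prime of the normalized
  chart of any monomial on that facet. The ideal has value \<open>\<phi>(w)\<close>, and the Jacobian determinant has
  value \<open>|w| - 1\<close>, as monomial local coordinates and their logarithmic derivations show.
\<close>

section \<open>The Newton polyhedron and its facet normals\<close>

text \<open>The fan is not subdivided into simplicial cones, which would call for a triangulation
  and a choice of cone for each lattice point. Instead a vector is pushed to the boundary of its
  cone until only rays are left, and the overlap between different combinations is removed
  afterwards by the lexicographic choice. Because that choice yields downsets, Dickson's lemma and
  inclusion-exclusion over orthants suffice, and all numerators stay entire over one common
  denominator.

  The denominator runs over all facet normals. A normal with \<phi>(w) = 0 contributes the constant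
  1 - p^(-|w|), which never vanishes.

  On the geometric side a divisor is present only through its local ring, and its orders are
  definite descriptions: each order has to be computed once and then shown independent of the
  generator or the coordinates. The facet condition places a monomial of nonnegative value in a
  chart only up to a power and up to factors of value 0; the integral closure removes the power, and
  a common factor of numerator and denominator removes the rest.\<close>

lemma dickson_on:
  fixes U :: "('w \<Rightarrow> nat) set"
  assumes "finite W"
  shows "\<exists>B\<subseteq>U. finite B \<and> (\<forall>u\<in>U. \<exists>b\<in>B. \<forall>w\<in>W. b w \<le> u w)"
  using assms
proof (induction W arbitrary: U rule: finite_induct)
  case empty
  then show ?case by (cases "U = {}") (auto intro: exI[of _ "{SOME u. u \<in> U}"] simp: some_in_eq)
next
  case (insert a W)
  obtain B where B: "B \<subseteq> U" "finite B" "\<And>u. u \<in> U \<Longrightarrow> \<exists>b\<in>B. \<forall>w\<in>W. b w \<le> u w"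
    using insert.IH[of U] by blast
  have "\<exists>C\<subseteq>{u\<in>U. u a = j}. finite C \<and> (\<forall>u\<in>{u\<in>U. u a = j}. \<exists>b\<in>C. \<forall>w\<in>W. b w \<le> u w)" for j
    by (rule insert.IH)
  then have "\<exists>C. \<forall>j. C j \<subseteq> {u\<in>U. u a = j} \<and> finite (C j) \<and>
      (\<forall>u\<in>{u\<in>U. u a = j}. \<exists>b\<in>C j. \<forall>w\<in>W. b w \<le> u w)"
    by (intro choice) simp
  then obtain C where C0: "\<forall>j. C j \<subseteq> {u\<in>U. u a = j} \<and> finite (C j) \<and>
      (\<forall>u\<in>{u\<in>U. u a = j}. \<exists>b\<in>C j. \<forall>w\<in>W. b w \<le> u w)"
    by (elim exE)
  have C: "C j \<subseteq> {u\<in>U. u a = j}" "finite (C j)" for j using C0[rule_format, of j] by simp_all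
  have C3: "\<exists>b\<in>C j. \<forall>w\<in>W. b w \<le> u w" if "u \<in> U" "u a = j" for j u using C0[rule_format, of j] that by simp
  \<comment> \<open>A vector whose entry at \<open>a\<close> is at least \<open>K\<close> is
    dominated by \<open>B\<close> in that coordinate too; the finitely many slices with a smaller
    entry get bases \<open>C j\<close> of their own.\<close>
  obtain K where K: "\<And>b. b \<in> B \<Longrightarrow> b a \<le> K"
    using finite_nat_set_iff_bounded_le[of "(\<lambda>b. b a) ` B"] B(2) by auto
  show ?case
  proof (intro exI[of _ "B \<union> (\<Union>j<K. C j)"] conjI ballI)
    show "B \<union> (\<Union>j<K. C j) \<subseteq> U" "finite (B \<union> (\<Union>j<K. C j))" using B C by blast+
    fix u assume u: "u \<in> U"
    show "\<exists>b\<in>B \<union> (\<Union>j<K. C j). \<forall>w\<in>insert a W. b w \<le> u w"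
    proof (cases "u a < K")
      case True
      obtain b where "b \<in> C (u a)" "\<forall>w\<in>W. b w \<le> u w" using C3[OF u refl] by blast
      then show ?thesis using C(1)[of "u a"] True by (intro bexI[of _ b]) auto
    next
      case False
      then show ?thesis using B(3)[OF u] K by (metis UnI1 insert_iff leI le_trans)
    qed
  qed
qed

definition dotp :: "('n::finite \<Rightarrow> nat) \<Rightarrow> ('n \<Rightarrow> 'a::linordered_semidom) \<Rightarrow> 'a" where
  "dotp m v = (\<Sum>i\<in>UNIV. of_nat (m i) * v i)"

text \<open>This is \<phi>, the support function of the Newton polyhedron. It is polymorphic because
  lattice points have natural entries while the convexity argument scales vectors by
  rationals.\<close>

definition newton :: "('n::finite \<Rightarrow> nat) set \<Rightarrow> ('n \<Rightarrow> 'a::linordered_semidom) \<Rightarrow> 'a" where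
  "newton N v = Min ((\<lambda>m. dotp m v) ` N)"

definition tight :: "('n::finite \<Rightarrow> nat) set \<Rightarrow> ('n \<Rightarrow> 'a::linordered_semidom) \<Rightarrow> ('n \<Rightarrow> nat) set" where
  "tight N v = {m\<in>N. dotp m v = newton N v}"

text \<open>The directions in which all constraints active at \<open>v\<close> stay active.\<close>

definition face_dirs ::
    "('n::finite \<Rightarrow> nat) set \<Rightarrow> ('n \<Rightarrow> 'a::linordered_semidom) \<Rightarrow> ('n \<Rightarrow> rat) set" where
  "face_dirs N v = {d. (\<forall>i. v i = 0 \<longrightarrow> d i = 0) \<and>
     (\<forall>m\<in>tight N v. \<forall>m'\<in>tight N v. dotp m d = dotp m' d)}"

text \<open>The constraints active at the primitive vector \<open>w\<close> determine it up to a scalar, that is,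
  \<open>w\<close> is orthogonal to a facet of the Newton polyhedron of \<open>N\<close>.\<close>

definition facet_normal :: "('n::finite \<Rightarrow> nat) set \<Rightarrow> ('n \<Rightarrow> nat) \<Rightarrow> bool" where
  "facet_normal N w \<longleftrightarrow> (\<exists>i. w i \<noteq> 0) \<and> Gcd (range w) = 1 \<and>
     (\<forall>d\<in>face_dirs N w. \<exists>c. \<forall>i. d i = c * of_nat (w i))"

lemma dotp_add: "dotp m (\<lambda>i. v i + v' i) = dotp m v + dotp m v'"
  by (simp add: dotp_def algebra_simps sum.distrib)

lemma dotp_scale: "dotp m (\<lambda>i. c * v i) = c * dotp m v"
  by (simp add: dotp_def algebra_simps sum_distrib_left)

lemma dotp_of_nat: "dotp m (\<lambda>i. of_nat (v i)) = of_nat (dotp m v)"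
  by (simp add: dotp_def)

context
  fixes N :: "('n::finite \<Rightarrow> nat) set"
  assumes fin: "finite N" and ne: "N \<noteq> {}"
begin

lemma newton_le: "m \<in> N \<Longrightarrow> newton N v \<le> dotp m v"
  using fin by (simp add: newton_def)

lemma tight_ex: "\<exists>m. m \<in> tight N v"
proof -
  have "newton N v \<in> (\<lambda>m. dotp m v) ` N" unfolding newton_def using fin ne by (intro Min_in) auto
  then show ?thesis by (auto simp: tight_def)
qed

lemma newton_eqI: "m \<in> N \<Longrightarrow> dotp m v = c \<Longrightarrow> (\<And>m. m \<in> N \<Longrightarrow> c \<le> dotp m v) \<Longrightarrow> newton N v = c"
  unfolding newton_def using fin by (intro Min_eqI) auto

lemma newton_superadd: "newton N v + newton N v' \<le> newton N (\<lambda>i. v i + v' i)"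
proof -
  obtain m where "m \<in> tight N (\<lambda>i. v i + v' i)" using tight_ex by blast
  then have "m \<in> N" "dotp m v + dotp m v' = newton N (\<lambda>i. v i + v' i)"
    by (auto simp: tight_def dotp_add)
  then show ?thesis using add_mono[OF newton_le[of m v] newton_le[of m v']] by simp
qed

lemma newton_scale:
  assumes "0 \<le> c"
  shows "newton N (\<lambda>i. c * v i) = c * newton N v"
proof -
  obtain m where m: "m \<in> tight N v" using tight_ex by blast
  show ?thesis
    by (rule newton_eqI[of m]) (use m newton_le assms in \<open>auto simp: tight_def dotp_scale intro: mult_left_mono\<close>)
qed

lemma newton_of_nat: "newton N (\<lambda>i. of_nat (v i)) = of_nat (newton N v)"
proof -
  obtain m where m: "m \<in> tight N v" using tight_ex by blast
  show ?thesis
    by (rule newton_eqI[of m]) (use m newton_le in \<open>auto simp: tight_def dotp_of_nat\<close>)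
qed

lemma newton_zero: "newton N (\<lambda>i. 0) = 0"
  using newton_scale[of 0 "\<lambda>_. 0"] by simp

lemma tight_scale: "0 < (c::'a::linordered_field) \<Longrightarrow> tight N (\<lambda>i. c * v i) = tight N v"
  by (simp add: tight_def dotp_scale newton_scale)

lemma tight_of_nat: "tight N (\<lambda>i. of_nat (v i) :: 'a::linordered_semidom) = tight N v"
  by (simp add: tight_def dotp_of_nat newton_of_nat)

lemma newton_superadd_sum:
  assumes "finite W"
  shows "(\<Sum>w\<in>W. newton N (f w)) \<le> newton N (\<lambda>i. \<Sum>w\<in>W. f w i)"
  using assms
proof (induction W rule: finite_induct)
  case (insert w W)
  then show ?case
    using newton_superadd[of "f w" "\<lambda>i. \<Sum>w\<in>W. f w i"] by (auto intro: order_trans add_left_mono)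
qed (simp add: newton_zero)

text \<open>Moving from \<open>v\<close> in a direction \<open>d\<close> with a negative entry until a further constraint becomes
  active.\<close>

lemma push_to_boundary:
  fixes v d :: "'n \<Rightarrow> rat"
  assumes v: "\<And>i. 0 \<le> v i" and d: "d \<in> face_dirs N v" "d j < 0" and m0: "m0 \<in> tight N v"
  obtains b v' where "0 < b" "\<And>i. v' i = v i + b * d i" "\<And>i. 0 \<le> v' i"
    "newton N v' = newton N v + b * dotp m0 d"
    "card {i. v i = 0} + card (tight N v) < card {i. v' i = 0} + card (tight N v')"
proof -
  define \<delta> where "\<delta> = dotp m0 d"
  have m0N: "m0 \<in> N" "dotp m0 v = newton N v" using m0 by (auto simp: tight_def)
  have tightd: "dotp m d = \<delta>" if "m \<in> tight N v" for m
    using d(1) m0 that unfolding face_dirs_def \<delta>_def by blast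
  \<comment> \<open>A step must end where a coordinate reaches 0 or where an inactive monomial
    catches up with the minimum, which moves with slope \<delta>. The entry \<open>d j < 0\<close>
    makes \<open>C\<close> nonempty.\<close>
  define C where "C = (\<lambda>i. v i / - d i) ` {i. d i < 0} \<union>
    (\<lambda>m. (dotp m v - newton N v) / (\<delta> - dotp m d)) ` {m\<in>N. dotp m d < \<delta>}"
  define b where "b = Min C"
  define v' where "v' = (\<lambda>i. v i + b * d i)"
  have finC: "finite C" "C \<noteq> {}" using fin d(2) by (auto simp: C_def)
  have bC: "b \<in> C" unfolding b_def using finC by (rule Min_in)
  have ble: "b \<le> c" if "c \<in> C" for c unfolding b_def using finC(1) that by (rule Min_le)
  have vpos: "0 < v i" if "d i < 0" for i
    using v[of i] d(1) that by (auto simp: face_dirs_def order.order_iff_strict)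
  have nt: "newton N v < dotp m v" if "m \<in> N" "dotp m d < \<delta>" for m
    using newton_le[OF that(1), of v] tightd[of m] that by (force simp: tight_def order.order_iff_strict)
  have "0 < c" if "c \<in> C" for c
    using that vpos nt by (auto simp: C_def divide_pos_neg)
  then have b: "0 < b" using bC by blast
  have nonneg: "0 \<le> v' i" for i
  proof (cases "d i < 0")
    case True
    then have "b \<le> v i / - d i" using ble by (auto simp: C_def)
    then show ?thesis using True by (simp add: v'_def field_simps)
  qed (use v b in \<open>auto simp: v'_def\<close>)
  have dm: "dotp m v' = dotp m v + b * dotp m d" for m
    by (simp add: v'_def dotp_add dotp_scale)
  have ge: "newton N v + b * \<delta> \<le> dotp m v + b * dotp m d" if "m \<in> N" for m
  proof (cases "dotp m d < \<delta>")
    case True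
    then have "b \<le> (dotp m v - newton N v) / (\<delta> - dotp m d)" using ble that by (auto simp: C_def)
    then show ?thesis using True by (simp add: field_simps)
  next
    case False
    then show ?thesis using newton_le[OF that, of v] b by (intro add_mono mult_left_mono) auto
  qed
  have newton: "newton N v' = newton N v + b * \<delta>"
    by (rule newton_eqI[of m0]) (use m0N ge in \<open>auto simp: dm \<delta>_def\<close>)
  have Z: "{i. v i = 0} \<subseteq> {i. v' i = 0}"
    using d(1) by (auto simp: face_dirs_def v'_def)
  have T: "tight N v \<subseteq> tight N v'"
    using tightd by (auto simp: tight_def newton dm)
  have finT: "finite (tight N v')" using fin by (simp add: tight_def)
  consider i where "d i < 0" "b = v i / - d i"
    | m where "m \<in> N" "dotp m d < \<delta>" "b = (dotp m v - newton N v) / (\<delta> - dotp m d)"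
    using bC by (auto simp: C_def)
  then have "card {i. v i = 0} + card (tight N v)
      < card {i. v' i = 0} + card (tight N v')"
  proof cases
    case 1
    then have "i \<in> {i. v' i = 0} - {i. v i = 0}" using vpos[of i] by (auto simp: v'_def)
    then have "card {i. v i = 0} < card {i. v' i = 0}"
      using Z by (intro psubset_card_mono) auto
    then show ?thesis using card_mono[OF finT T] by linarith
  next
    case 2
    then have "dotp m v + b * dotp m d = newton N v + b * \<delta>" by (simp add: field_simps)
    then have "m \<in> tight N v' - tight N v"
      using 2(1,2) tightd[of m] unfolding tight_def dm newton by fastforce
    then have "card (tight N v) < card (tight N v')"
      using T finT by (intro psubset_card_mono) auto
    then show ?thesis using card_mono[OF _ Z] by (simp add: add_le_less_mono)
  qed
  then show thesis using that[of b v'] b nonneg newton by (simp add: \<delta>_def v'_def)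
qed

text \<open>Clearing denominators and dividing by the gcd turns a rational ray into its primitive
  vector; the active constraints, hence \<open>face_dirs\<close>, do not change under positive
  scaling.\<close>

lemma facet_normal_of_ray:
  fixes v :: "'n \<Rightarrow> rat"
  assumes v: "\<And>i. 0 \<le> v i" "v j \<noteq> 0" and ray: "\<And>d. d \<in> face_dirs N v \<Longrightarrow> \<exists>c. \<forall>i. d i = c * v i"
  obtains w c where "facet_normal N w" "0 < c" "\<And>i. v i = c * of_nat (w i)"
proof -
  have "\<exists>K u. 0 < K \<and> v i = of_nat u / of_nat K" for i
  proof -
    obtain a b where ab: "quotient_of (v i) = (a, b)" by (cases "quotient_of (v i)")
    then have "v i = of_int a / of_int b" "0 < b"
      using quotient_of_div quotient_of_denom_pos by auto
    moreover from this have "0 \<le> a" using v(1)[of i] by (simp add: zero_le_divide_iff)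
    ultimately show ?thesis by (intro exI[of _ "nat b"] exI[of _ "nat a"]) simp
  qed
  then obtain K u where K: "\<And>i. 0 < K i" "\<And>i. v i = of_nat (u i) / of_nat (K i)" by metis
  define L where "L = (\<Prod>i\<in>UNIV. K i)"
  have L: "0 < L" using K(1) by (auto simp: L_def intro: prod_pos)
  have "K i dvd L" for i unfolding L_def by (rule dvd_prodI) auto
  define a where "a i = u i * (L div K i)" for i
  have va: "v i = of_nat (a i) / of_nat L" for i
    using K(1)[of i] L \<open>K i dvd L\<close> by (auto simp: a_def K(2) field_simps elim!: dvdE)
  define g where "g = Gcd (range a)"
  have "a j \<noteq> 0" using v(2) va[of j] by auto
  then have g: "g > 0" unfolding g_def by (metis Gcd_0_iff gr0I rangeI singletonD subsetD)
  define w where "w i = a i div g" for i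
  have aw: "a i = g * w i" for i by (simp add: w_def g_def)
  have "g * Gcd (range w) = Gcd ((*) g ` range w)" by (simp add: Gcd_mult)
  also have "(*) g ` range w = range a" by (auto simp: aw)
  finally have "g * Gcd (range w) = g * 1" by (simp add: g_def)
  then have gcd1: "Gcd (range w) = 1" using g by simp
  define c :: rat where "c = of_nat g / of_nat L"
  have c: "0 < c" using g L by (simp add: c_def)
  have vw: "v = (\<lambda>i. c * of_nat (w i))" by (auto simp: va aw c_def)
  have "tight N v = tight N w" unfolding vw tight_scale[OF c] by (rule tight_of_nat)
  then have "face_dirs N v = face_dirs N w"
    using c unfolding face_dirs_def by (auto simp: vw)
  moreover have "w j \<noteq> 0" using v(2) by (auto simp: vw)
  ultimately have "facet_normal N w"
    using ray gcd1 unfolding facet_normal_def vw by (metis mult.assoc)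
  then show thesis using that c vw by auto
qed

text \<open>The zero set and the tight set determine a facet normal: if two normals share them, one
  is a face direction of the other, so they are proportional, and both are primitive.\<close>

lemma finite_facet_normals: "finite {w. facet_normal N w}"
proof (rule inj_on_finite)
  let ?f = "\<lambda>w. ({i. w i = (0::nat)}, tight N w)"
  show "?f ` {w. facet_normal N w} \<subseteq> UNIV \<times> Pow N" by (auto simp: tight_def)
  show "inj_on ?f {w. facet_normal N w}"
  proof (rule inj_onI)
    fix w w' :: "'n \<Rightarrow> nat"
    assume "w \<in> {w. facet_normal N w}" "w' \<in> {w. facet_normal N w}" "?f w = ?f w'"
    then have w: "facet_normal N w" "facet_normal N w'" and eq: "{i. w i = 0} = {i. w' i = 0}" "tight N w = tight N w'" by auto
    have "(\<lambda>i. of_nat (w' i)) \<in> face_dirs N w"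
      using eq by (auto simp: face_dirs_def dotp_of_nat tight_def)
    then obtain c :: rat where c: "\<And>i. of_nat (w' i) = c * of_nat (w i)"
      using w(1) unfolding facet_normal_def by meson
    obtain j where j: "w j \<noteq> 0" using w by (auto simp: facet_normal_def)
    have cross: "w' i * w j = w i * w' j" for i
    proof -
      have "(of_nat (w' i) * of_nat (w j) :: rat) = of_nat (w i) * of_nat (w' j)" by (simp add: c)
      then show ?thesis by (metis of_nat_eq_iff of_nat_mult)
    qed
    have G: "Gcd (range w) = 1" "Gcd (range w') = 1" using w by (auto simp: facet_normal_def)
    have "w j = Gcd ((*) (w j) ` range w')" using G by (simp add: Gcd_mult)
    also have "(*) (w j) ` range w' = (*) (w' j) ` range w" using cross by (auto simp: image_image mult.commute)
    also have "Gcd \<dots> = w' j" using G by (simp add: Gcd_mult)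
    finally have "w j = w' j" .
    then have "w' i * w j = w i * w j" for i using cross[of i] by simp
    then show "w = w'" using j by auto
  qed
qed (use fin in auto)

text \<open>Induction on the number of inactive constraints. A vector that does not span a ray is a
  convex combination of two vectors with more active constraints, and on the segment between them
  \<open>newton N\<close> is affine, because all monomials active at the vector have the same
  slope.\<close>

theorem facet_normal_decomposition:
  fixes v :: "'n \<Rightarrow> rat"
  assumes "\<And>i. 0 \<le> v i"
  shows "\<exists>c. (\<forall>w. 0 \<le> c w) \<and> (\<forall>i. v i = (\<Sum>w | facet_normal N w. c w * of_nat (w i))) \<and>
    newton N v = (\<Sum>w | facet_normal N w. c w * of_nat (newton N w))"
  using assms
proof (induction "CARD('n) + card N - (card {i. v i = 0} + card (tight N v))" arbitrary: v rule: less_induct)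
  case less
  let ?F = "{w. facet_normal N w}"
  show ?case
  proof (cases "\<exists>j. v j \<noteq> 0")
    case False
    then have "v = (\<lambda>i. 0)" by auto
    then show ?thesis by (intro exI[of _ "\<lambda>_. 0"]) (simp add: newton_zero)
  next
    case True
    then obtain j where j: "v j \<noteq> 0" by blast
    show ?thesis
    proof (cases "\<forall>d\<in>face_dirs N v. \<exists>c. \<forall>i. d i = c * v i")
      case True
      then obtain w c where w: "facet_normal N w" "0 < c" "\<And>i. v i = c * of_nat (w i)"
        using facet_normal_of_ray[of v j] less.prems j by metis
      have "newton N v = c * of_nat (newton N w)"
        using w newton_scale[of c "\<lambda>i. of_nat (w i)"] newton_of_nat[of w, where 'a = rat]
        by (simp add: w(3)[abs_def])
      then show ?thesis using w finite_facet_normals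
        by (intro exI[of _ "\<lambda>w'. if w' = w then c else 0"]) (simp add: if_distrib[of "\<lambda>x. x * _"] sum.delta cong: if_cong)
    next
      case False
      then obtain d where d: "d \<in> face_dirs N v" "\<not> (\<exists>c. \<forall>i. d i = c * v i)" by blast
      obtain k where k: "d k \<noteq> d j / v j * v k" using d(2) by blast
      have vk: "v k \<noteq> 0" using d(1) k by (auto simp: face_dirs_def)
      \<comment> \<open>Subtracting the mean of the ratios of \<open>d\<close> to \<open>v\<close>
        at \<open>j\<close> and \<open>k\<close> gives \<open>e\<close> opposite signs at these two
        indices, so both \<open>e\<close> and its negative have a negative entry and can be pushed
        to the boundary.\<close>
      define c where "c = (d j / v j + d k / v k) / 2"
      define e where "e i = d i + (- c) * v i" for i
      have e_face: "dotp m e = dotp m' e" if "m \<in> tight N v" "m' \<in> tight N v" for m m'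
      proof -
        have "dotp m d = dotp m' d" using d(1) that unfolding face_dirs_def by blast
        moreover have "dotp m v = dotp m' v" using that by (simp add: tight_def)
        ultimately show ?thesis unfolding e_def dotp_add dotp_scale by simp
      qed
      have e0: "e i = 0" if "v i = 0" for i using d(1) that by (simp add: face_dirs_def e_def)
      have face: "(\<lambda>i. a * e i) \<in> face_dirs N v" for a
        using e0 e_face unfolding face_dirs_def mem_Collect_eq dotp_scale by (metis mult_zero_right)
      have vjk: "0 < v j" "0 < v k" using less.prems[of j] less.prems[of k] j vk by auto
      define r where "r = (d j / v j - d k / v k) / 2"
      have e: "e j = r * v j" "e k = - r * v k"
        using vjk by (simp_all add: e_def c_def r_def field_simps)
      have "r \<noteq> 0" using k vk by (auto simp: r_def field_simps)
      then have "e j < 0 \<and> 0 < e k \<or> 0 < e j \<and> e k < 0"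
        using vjk unfolding e by (cases "0 < r") (auto simp: mult_less_0_iff zero_less_mult_iff)
      then obtain x y where xy: "e x < 0" "0 < e y" by blast
      obtain m0 where m0: "m0 \<in> tight N v" using tight_ex by blast
      obtain b vb where b: "0 < b" "\<And>i. vb i = v i + b * (1 * e i)" "\<And>i. 0 \<le> vb i"
        "newton N vb = newton N v + b * dotp m0 (\<lambda>i. 1 * e i)"
        "card {i. v i = 0} + card (tight N v) < card {i. vb i = 0} + card (tight N vb)"
        by (rule push_to_boundary[OF less.prems face[of "1"] _ m0, of x]) (use xy in simp, rule that)
      obtain a va where a: "0 < a" "\<And>i. va i = v i + a * (- 1 * e i)" "\<And>i. 0 \<le> va i"
        "newton N va = newton N v + a * dotp m0 (\<lambda>i. - 1 * e i)"
        "card {i. v i = 0} + card (tight N v) < card {i. va i = 0} + card (tight N va)"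
        by (rule push_to_boundary[OF less.prems face[of "- 1"] _ m0, of y]) (use xy in simp, rule that)
      have bound: "card {i. u i = 0} + card (tight N u) \<le> CARD('n) + card N" for u :: "'n \<Rightarrow> rat"
        using fin by (intro add_mono card_mono) (auto simp: tight_def)
      have "CARD('n) + card N - (card {i. vb i = 0} + card (tight N vb))
          < CARD('n) + card N - (card {i. v i = 0} + card (tight N v))"
        using b(5) bound[of vb] by linarith
      from less.hyps[OF this b(3)] obtain cb where cb': "\<forall>w. 0 \<le> cb w"
        "\<forall>i. vb i = (\<Sum>w\<in>?F. cb w * of_nat (w i))"
        and cb3: "newton N vb = (\<Sum>w\<in>?F. cb w * of_nat (newton N w))"
        by (elim exE conjE)
      note cb = cb'[rule_format] cb3
      have "CARD('n) + card N - (card {i. va i = 0} + card (tight N va))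
          < CARD('n) + card N - (card {i. v i = 0} + card (tight N v))"
        using a(5) bound[of va] by linarith
      from less.hyps[OF this a(3)] obtain ca where ca': "\<forall>w. 0 \<le> ca w"
        "\<forall>i. va i = (\<Sum>w\<in>?F. ca w * of_nat (w i))"
        and ca3: "newton N va = (\<Sum>w\<in>?F. ca w * of_nat (newton N w))"
        by (elim exE conjE)
      note ca = ca'[rule_format] ca3
      \<comment> \<open>\<open>v\<close> divides the segment from \<open>va\<close> to
        \<open>vb\<close> in the ratio \<open>a\<close> to \<open>b\<close>, so the nearer end gets
        the larger weight.\<close>
      define c where "c w = (a * cb w + b * ca w) / (a + b)" for w
      have comb: "(\<Sum>w\<in>?F. c w * f w) = (a * (\<Sum>w\<in>?F. cb w * f w) + b * (\<Sum>w\<in>?F. ca w * f w)) / (a + b)" for f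
        by (simp add: c_def sum_distrib_left sum_divide_distrib sum.distrib[symmetric] field_simps)
      have "v i = (\<Sum>w\<in>?F. c w * of_nat (w i))" for i
        unfolding comb cb(2)[symmetric] ca(2)[symmetric] a(2) b(2) using a(1) b(1) by (simp add: field_simps)
      moreover have "newton N v = (\<Sum>w\<in>?F. c w * of_nat (newton N w))"
        unfolding comb cb(3)[symmetric] ca(3)[symmetric] b(4) a(4) dotp_scale
        using a(1) b(1) by (simp add: field_simps)
      moreover have "0 \<le> c w" for w using a(1) b(1) ca(1) cb(1) by (simp add: c_def)
      ultimately show ?thesis by blast
    qed
  qed
qed

text \<open>Splitting each coefficient into its integral and fractional part leaves a bounded remainder.\<close>

corollary facet_normal_remainder:
  fixes v :: "'n \<Rightarrow> nat"
  obtains f \<alpha> where "\<And>i. f i \<le> (\<Sum>w | facet_normal N w. w i)"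
    "\<And>i. v i = f i + (\<Sum>w | facet_normal N w. \<alpha> w * w i)"
    "newton N v = newton N f + (\<Sum>w | facet_normal N w. \<alpha> w * newton N w)"
proof -
  let ?F = "{w. facet_normal N w}"
  have "\<exists>c. (\<forall>w. 0 \<le> c w) \<and> (\<forall>i. of_nat (v i) = (\<Sum>w\<in>?F. c w * of_nat (w i))) \<and>
    newton N (\<lambda>i. of_nat (v i) :: rat) = (\<Sum>w\<in>?F. c w * of_nat (newton N w))"
    by (rule facet_normal_decomposition) simp
  then obtain c :: "('n \<Rightarrow> nat) \<Rightarrow> rat" where c': "\<forall>w. 0 \<le> c w"
    "\<forall>i. of_nat (v i) = (\<Sum>w\<in>?F. c w * of_nat (w i))"
    and c3: "newton N (\<lambda>i. of_nat (v i) :: rat) = (\<Sum>w\<in>?F. c w * of_nat (newton N w))"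
    by (elim exE conjE)
  note c = c'[rule_format] c3
  define \<alpha> where "\<alpha> w = nat \<lfloor>c w\<rfloor>" for w
  have \<alpha>: "of_nat (\<alpha> w) \<le> c w" "c w < of_nat (\<alpha> w) + 1" for w
    using c(1)[of w] by (simp_all add: \<alpha>_def) linarith+
  define s where "s i = (\<Sum>w\<in>?F. \<alpha> w * w i)" for i
  have "(of_nat (s i) :: rat) \<le> of_nat (v i)" for i
    unfolding s_def c(2) of_nat_sum of_nat_mult by (intro sum_mono mult_right_mono \<alpha>) auto
  then have sv: "s i \<le> v i" for i by simp
  define f where "f i = v i - s i" for i
  have f: "(of_nat (f i) :: rat) = (\<Sum>w\<in>?F. (c w - of_nat (\<alpha> w)) * of_nat (w i))" for i
    using sv[of i] by (simp add: f_def of_nat_diff c(2) s_def left_diff_distrib sum_subtractf)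
  have "(of_nat (f i) :: rat) \<le> of_nat (\<Sum>w\<in>?F. w i)" for i
    unfolding f of_nat_sum
  proof (rule sum_mono)
    fix w
    have "(c w - of_nat (\<alpha> w)) * of_nat (w i) \<le> 1 * of_nat (w i)"
      using \<alpha>(2)[of w] by (intro mult_right_mono) auto
    then show "(c w - of_nat (\<alpha> w)) * of_nat (w i) \<le> of_nat (w i)" by simp
  qed
  then have 1: "f i \<le> (\<Sum>w\<in>?F. w i)" for i by (simp only: of_nat_le_iff)
  have 2: "v i = f i + (\<Sum>w\<in>?F. \<alpha> w * w i)" for i using sv by (simp add: f_def s_def)
  \<comment> \<open>Superadditivity bounds \<open>newton N f\<close> below by the fractional parts,
    and the decomposition of \<open>v\<close> is additive; together they bound
    \<open>newton N v\<close> above. Superadditivity of the integral part gives the opposite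
    inequality.\<close>
  have "(\<Sum>w\<in>?F. newton N (\<lambda>i. (c w - of_nat (\<alpha> w)) * of_nat (w i))) \<le> newton N (\<lambda>i. of_nat (f i) :: rat)"
    unfolding f by (rule newton_superadd_sum[OF finite_facet_normals])
  also have "(\<Sum>w\<in>?F. newton N (\<lambda>i. (c w - of_nat (\<alpha> w)) * of_nat (w i)))
      = (\<Sum>w\<in>?F. (c w - of_nat (\<alpha> w)) * of_nat (newton N w))"
    using \<alpha>(1) by (intro sum.cong refl) (subst newton_scale, auto simp: newton_of_nat)
  also have "\<dots> = of_nat (newton N v) - of_nat (\<Sum>w\<in>?F. \<alpha> w * newton N w)"
    using c(3) by (simp add: newton_of_nat left_diff_distrib sum_subtractf)
  finally have "(of_nat (newton N v) :: rat) \<le> of_nat (newton N f + (\<Sum>w\<in>?F. \<alpha> w * newton N w))"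
    by (simp add: newton_of_nat)
  then have le: "newton N v \<le> newton N f + (\<Sum>w\<in>?F. \<alpha> w * newton N w)" by (simp only: of_nat_le_iff)
  have "(\<Sum>w\<in>?F. \<alpha> w * newton N w) = (\<Sum>w\<in>?F. newton N (\<lambda>i. \<alpha> w * w i))" by (simp add: newton_scale)
  also have "\<dots> \<le> newton N (\<lambda>i. \<Sum>w\<in>?F. \<alpha> w * w i)"
    by (rule newton_superadd_sum[OF finite_facet_normals])
  finally have "newton N f + (\<Sum>w\<in>?F. \<alpha> w * newton N w) \<le> newton N v"
    using newton_superadd[of f "\<lambda>i. \<Sum>w\<in>?F. \<alpha> w * w i"] by (simp flip: 2)
  with le have "newton N v = newton N f + (\<Sum>w\<in>?F. \<alpha> w * newton N w)" by simp
  with 1 2 show thesis by (rule that)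
qed

end

section \<open>Power series supported on a downset\<close>

lemma geometric_has_sum:
  fixes y :: complex
  assumes "norm y < 1"
  shows "(\<lambda>k. norm (y ^ k)) summable_on UNIV" "infsum (\<lambda>k. y ^ k) UNIV = 1 / (1 - y)"
proof -
  have s: "summable (\<lambda>k. norm (y ^ k))" using assms by (simp add: norm_power summable_geometric)
  then show "(\<lambda>k. norm (y ^ k)) summable_on UNIV"
    by (intro norm_summable_imp_summable_on) simp
  have "((\<lambda>k. y ^ k) has_sum (1 / (1 - y))) UNIV"
    using s geometric_sums[OF assms] by (rule norm_summable_imp_has_sum)
  then show "infsum (\<lambda>k. y ^ k) UNIV = 1 / (1 - y)" by (rule infsumI)
qed

lemma abs_summable_on_power_products:
  fixes y :: "'w \<Rightarrow> complex"
  assumes "finite W" "\<And>w. w \<in> W \<Longrightarrow> norm (y w) < 1"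
  shows "(\<lambda>\<alpha>. norm (\<Prod>w\<in>W. y w ^ \<alpha> w)) summable_on (PiE W (\<lambda>_. UNIV :: nat set))"
  using assms
proof (induction W rule: finite_induct)
  case (insert x W)
  let ?X = "PiE W (\<lambda>_. UNIV :: nat set)" and ?f = "\<lambda>(k, \<alpha>). y x ^ k * (\<Prod>w\<in>W. y w ^ \<alpha> w)"
  have "(\<lambda>z. norm (?f z)) summable_on (UNIV \<times> ?X)"
  proof (rule Infinite_Sum.abs_summable_on_Sigma_iff[THEN iffD2], intro conjI ballI)
    have IH: "(\<lambda>\<alpha>. norm (\<Prod>w\<in>W. y w ^ \<alpha> w)) summable_on ?X" using insert by auto
    fix k
    show "(\<lambda>\<alpha>. norm (?f (k, \<alpha>))) summable_on ?X"
      using summable_on_cmult_right[OF IH, of "norm (y x ^ k)"] by (simp add: norm_mult)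
  next
    have "(\<lambda>k. norm (y x ^ k)) summable_on UNIV"
      using geometric_has_sum(1)[of "y x"] insert.prems by simp
    from summable_on_cmult_left[OF this]
    show "(\<lambda>k. norm (\<Sum>\<^sub>\<infinity>\<alpha>\<in>?X. norm (?f (k, \<alpha>)))) summable_on UNIV"
      by (simp add: norm_mult infsum_cmult_right' abs_mult infsum_nonneg)
  qed
  moreover have "(\<lambda>\<alpha>. norm (\<Prod>w\<in>insert x W. y w ^ \<alpha> w)) \<circ> (\<lambda>(k, g). g(x := k))
      = (\<lambda>z. norm (?f z))"
  proof
    fix z :: "nat \<times> ('w \<Rightarrow> nat)"
    obtain k g where z: "z = (k, g)" by force
    have "(\<Prod>w\<in>W. y w ^ (g(x := k)) w) = (\<Prod>w\<in>W. y w ^ g w)"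
      using insert.hyps by (intro prod.cong) auto
    then show "((\<lambda>\<alpha>. norm (\<Prod>w\<in>insert x W. y w ^ \<alpha> w)) \<circ> (\<lambda>(k, g). g(x := k))) z
        = norm (?f z)"
      using insert.hyps by (simp add: z)
  qed
  ultimately show ?case
    unfolding PiE_insert_eq
    by (subst summable_on_reindex[OF inj_combinator[OF insert.hyps(2)]]) simp
qed simp

text \<open>Extensional functions, so that an exponent is determined by its values on
  \<open>W\<close>.\<close>

definition exponents :: "'w set \<Rightarrow> ('w \<Rightarrow> nat) set" where
  "exponents W = PiE W (\<lambda>_. UNIV)"

definition power_product :: "'w set \<Rightarrow> ('w \<Rightarrow> complex \<Rightarrow> complex) \<Rightarrow> complex \<Rightarrow> ('w \<Rightarrow> nat) \<Rightarrow> complex" where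
  "power_product W y s \<alpha> = (\<Prod>w\<in>W. y w s ^ \<alpha> w)"

text \<open>The denominator is fixed in advance and only the numerator depends on \<open>U\<close>;
  this lets the property pass to unions and differences of sets.\<close>

definition continuable ::
    "'w set \<Rightarrow> ('w \<Rightarrow> complex \<Rightarrow> complex) \<Rightarrow> complex set \<Rightarrow> ('w \<Rightarrow> nat) set \<Rightarrow> bool" where
  "continuable W y \<Omega> U \<longleftrightarrow> (\<exists>g. g holomorphic_on UNIV \<and>
     (\<forall>s\<in>\<Omega>. infsum (power_product W y s) U * (\<Prod>w\<in>W. 1 - y w s) = g s))"

context
  fixes W :: "'w set" and y :: "'w \<Rightarrow> complex \<Rightarrow> complex" and \<Omega> :: "complex set"
  assumes finW: "finite W"
    and hol: "\<And>w. w \<in> W \<Longrightarrow> y w holomorphic_on UNIV"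
    and small: "\<And>w s. w \<in> W \<Longrightarrow> s \<in> \<Omega> \<Longrightarrow> norm (y w s) < 1"
begin

lemma power_product_summable:
  assumes "s \<in> \<Omega>" "U \<subseteq> exponents W"
  shows "power_product W y s summable_on U"
proof -
  have "(\<lambda>\<alpha>. norm (power_product W y s \<alpha>)) summable_on (exponents W)"
    unfolding power_product_def[abs_def] exponents_def
    using abs_summable_on_power_products[OF finW, of "\<lambda>w. y w s"] small assms(1) by simp
  then show ?thesis
    using abs_summable_summable summable_on_subset_banach assms(2) by blast
qed

text \<open>A translated orthant sums to a product of geometric series, with the power product of
  its vertex as numerator.\<close>

lemma continuable_orthant: "continuable W y \<Omega> {\<alpha>\<in>exponents W. \<forall>w\<in>W. \<beta> w \<le> \<alpha> w}"
  unfolding continuable_def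
proof (intro exI[of _ "\<lambda>s. power_product W y s \<beta>"] conjI ballI)
  show "(\<lambda>s. power_product W y s \<beta>) holomorphic_on UNIV"
    unfolding power_product_def by (intro holomorphic_intros hol)
  fix s assume s: "s \<in> \<Omega>"
  let ?U = "{\<alpha>\<in>exponents W. \<forall>w\<in>W. \<beta> w \<le> \<alpha> w}"
  have "bij_betw (\<lambda>\<gamma>. restrict (\<lambda>w. \<beta> w + \<gamma> w) W) (exponents W) ?U"
    by (rule bij_betw_byWitness[where f' = "\<lambda>\<alpha>. restrict (\<lambda>w. \<alpha> w - \<beta> w) W"])
       (auto simp: exponents_def PiE_iff extensional_def fun_eq_iff restrict_def)
  then have "infsum (power_product W y s) ?U
      = infsum (\<lambda>\<gamma>. power_product W y s (restrict (\<lambda>w. \<beta> w + \<gamma> w) W)) (exponents W)"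
    by (rule infsum_reindex_bij_betw[symmetric])
  also have "\<dots> = infsum (\<lambda>\<gamma>. power_product W y s \<beta> * power_product W y s \<gamma>) (exponents W)"
    by (simp add: power_product_def power_add prod.distrib cong: prod.cong)
  also have "\<dots> = power_product W y s \<beta> * infsum (power_product W y s) (exponents W)"
    by (rule infsum_cmult_right')
  also have "infsum (power_product W y s) (exponents W) = (\<Prod>w\<in>W. infsum (\<lambda>k. y w s ^ k) UNIV)"
    unfolding power_product_def[abs_def] exponents_def
    by (rule infsum_prod_PiE_abs[OF finW]) (rule geometric_has_sum(1), rule small, assumption, rule s)
  also have "\<dots> = (\<Prod>w\<in>W. 1 / (1 - y w s))"
    using geometric_has_sum(2)[OF small[OF _ s]] by (intro prod.cong) auto
  finally have "infsum (power_product W y s) ?U * (\<Prod>w\<in>W. 1 - y w s)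
      = power_product W y s \<beta> * (\<Prod>w\<in>W. 1 / (1 - y w s) * (1 - y w s))"
    by (simp only: prod.distrib mult.assoc)
  also have "(\<Prod>w\<in>W. 1 / (1 - y w s) * (1 - y w s)) = 1"
    using small[OF _ s] by (intro prod.neutral) fastforce
  finally show "infsum (power_product W y s) ?U * (\<Prod>w\<in>W. 1 - y w s) = power_product W y s \<beta>" by simp
qed

lemma continuable_Un:
  assumes "continuable W y \<Omega> A" "continuable W y \<Omega> B" "continuable W y \<Omega> (A \<inter> B)" "A \<subseteq> exponents W" "B \<subseteq> exponents W"
  shows "continuable W y \<Omega> (A \<union> B)"
proof -
  obtain a where a: "a holomorphic_on UNIV"
    "\<forall>s\<in>\<Omega>. infsum (power_product W y s) A * (\<Prod>w\<in>W. 1 - y w s) = a s"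
    using assms(1) unfolding continuable_def by (elim exE conjE)
  obtain b where b: "b holomorphic_on UNIV"
    "\<forall>s\<in>\<Omega>. infsum (power_product W y s) B * (\<Prod>w\<in>W. 1 - y w s) = b s"
    using assms(2) unfolding continuable_def by (elim exE conjE)
  obtain c where c: "c holomorphic_on UNIV"
    "\<forall>s\<in>\<Omega>. infsum (power_product W y s) (A \<inter> B) * (\<Prod>w\<in>W. 1 - y w s) = c s"
    using assms(3) unfolding continuable_def by (elim exE conjE)
  show ?thesis unfolding continuable_def
  proof (intro exI[of _ "\<lambda>s. a s + b s - c s"] conjI ballI)
    show "(\<lambda>s. a s + b s - c s) holomorphic_on UNIV" by (intro holomorphic_intros a b c)
    fix s assume s: "s \<in> \<Omega>"
    have "infsum (power_product W y s) (A \<union> B) = infsum (power_product W y s) A + infsum (power_product W y s) B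
        - infsum (power_product W y s) (A \<inter> B)"
      by (rule infsum_Un_Int; rule power_product_summable[OF s]) (use assms(4,5) in auto)
    then show "infsum (power_product W y s) (A \<union> B) * (\<Prod>w\<in>W. 1 - y w s) = a s + b s - c s"
      using a(2) b(2) c(2) s by (simp add: left_diff_distrib distrib_right)
  qed
qed

lemma continuable_Diff:
  assumes "continuable W y \<Omega> A" "continuable W y \<Omega> B" "A \<subseteq> exponents W" "B \<subseteq> A"
  shows "continuable W y \<Omega> (A - B)"
proof -
  obtain a where a: "a holomorphic_on UNIV"
    "\<forall>s\<in>\<Omega>. infsum (power_product W y s) A * (\<Prod>w\<in>W. 1 - y w s) = a s"
    using assms(1) unfolding continuable_def by (elim exE conjE)
  obtain b where b: "b holomorphic_on UNIV"
    "\<forall>s\<in>\<Omega>. infsum (power_product W y s) B * (\<Prod>w\<in>W. 1 - y w s) = b s"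
    using assms(2) unfolding continuable_def by (elim exE conjE)
  show ?thesis unfolding continuable_def
  proof (intro exI[of _ "\<lambda>s. a s - b s"] conjI ballI)
    show "(\<lambda>s. a s - b s) holomorphic_on UNIV" by (intro holomorphic_intros a b)
    fix s assume s: "s \<in> \<Omega>"
    have "infsum (power_product W y s) (A - B \<union> B) = infsum (power_product W y s) (A - B) + infsum (power_product W y s) B"
      using assms by (intro infsum_Un_disjoint power_product_summable s) auto
    moreover have "A - B \<union> B = A" using assms(4) by blast
    ultimately have "infsum (power_product W y s) (A - B) = infsum (power_product W y s) A - infsum (power_product W y s) B"
      by (simp only: add_diff_cancel_right')
    then show "infsum (power_product W y s) (A - B) * (\<Prod>w\<in>W. 1 - y w s) = a s - b s"
      using a(2) b(2) s by (simp add: left_diff_distrib)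
  qed
qed

text \<open>Two orthants meet in the orthant at the maximum of their vertices, so
  inclusion-exclusion reduces a union to unions of fewer orthants.\<close>

lemma continuable_finitely_generated:
  assumes "finite B"
  shows "continuable W y \<Omega> (\<Union>\<beta>\<in>B. {\<alpha>\<in>exponents W. \<forall>w\<in>W. \<beta> w \<le> \<alpha> w})"
  using assms
proof (induction "card B" arbitrary: B rule: less_induct)
  case less
  let ?O = "\<lambda>\<beta>. {\<alpha>\<in>exponents W. \<forall>w\<in>W. \<beta> w \<le> \<alpha> w}"
  show ?case
  proof (cases "B = {}")
    case True
    then show ?thesis by (auto simp: continuable_def intro: exI[of _ "\<lambda>_. 0"])
  next
    case False
    then obtain b C where b: "B = insert b C" "b \<notin> C" by (metis Set.set_insert ex_in_conv)
    have finC: "finite C" "card C < card B" using b less.prems by simp_all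
    \<comment> \<open>These vertices need not belong to \<open>B\<close>, so the induction runs over
      the number of vertices and not over subsets of \<open>B\<close>.\<close>
    let ?D = "(\<lambda>\<beta> w. max (b w) (\<beta> w)) ` C"
    have "?O b \<inter> (\<Union>\<beta>\<in>C. ?O \<beta>) = (\<Union>\<beta>\<in>?D. ?O \<beta>)" by auto
    moreover have "continuable W y \<Omega> (\<Union>\<beta>\<in>?D. ?O \<beta>)"
      using finC card_image_le[OF finC(1), of "\<lambda>\<beta> w. max (b w) (\<beta> w)"] by (intro less.hyps) auto
    ultimately have "continuable W y \<Omega> (?O b \<union> (\<Union>\<beta>\<in>C. ?O \<beta>))"
      using less.hyps[OF finC(2,1)] by (intro continuable_Un continuable_orthant) auto
    then show ?thesis by (simp add: b(1))
  qed
qed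

text \<open>The complement of a downset is closed upwards and hence, by Dickson's lemma, a finite
  union of orthants.\<close>

lemma continuable_downset:
  assumes "R \<subseteq> exponents W"
    and down: "\<And>\<alpha> \<beta>. \<alpha> \<in> R \<Longrightarrow> \<beta> \<in> (exponents W) \<Longrightarrow> (\<And>w. w \<in> W \<Longrightarrow> \<beta> w \<le> \<alpha> w) \<Longrightarrow> \<beta> \<in> R"
  shows "continuable W y \<Omega> R"
proof -
  let ?O = "\<lambda>\<beta>. {\<alpha>\<in>exponents W. \<forall>w\<in>W. \<beta> w \<le> \<alpha> w}"
  obtain B where B: "B \<subseteq> exponents W - R" "finite B" "\<forall>u\<in>exponents W - R. \<exists>b\<in>B. \<forall>w\<in>W. b w \<le> u w"
    using dickson_on[OF finW, of "(exponents W) - R"] by blast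
  have "(exponents W) - R = (\<Union>\<beta>\<in>B. ?O \<beta>)" using B down by blast
  then have "continuable W y \<Omega> ((exponents W) - R)" using continuable_finitely_generated[OF B(2)] by simp
  moreover have "(exponents W) = ?O (\<lambda>_. 0)" by simp
  then have "continuable W y \<Omega> (exponents W)" using continuable_orthant[of "\<lambda>_. 0"] by simp
  ultimately have "continuable W y \<Omega> ((exponents W) - ((exponents W) - R))" using continuable_Diff by blast
  moreover have "(exponents W) - ((exponents W) - R) = R" using assms(1) by blast
  ultimately show ?thesis by simp
qed

end

section \<open>Lexicographic choice of representations and the lattice sum\<close>

definition lex_less :: "'w list \<Rightarrow> ('w \<Rightarrow> nat) \<Rightarrow> ('w \<Rightarrow> nat) \<Rightarrow> bool" where
  "lex_less ws \<alpha> \<beta> \<longleftrightarrow> (map \<alpha> ws, map \<beta> ws) \<in> lex less_than"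

lemma wf_lex_less: "wf {(\<alpha>, \<beta>). lex_less ws \<alpha> \<beta>}"
proof (rule wf_subset)
  show "wf (inv_image (lex less_than) (\<lambda>\<alpha> :: 'w \<Rightarrow> nat. map \<alpha> ws))" for ws :: "'w list"
    by (intro wf_inv_image wf_lex) simp
qed (auto simp: lex_less_def inv_image_def)

lemma lex_less_total: "lex_less ws \<alpha> \<beta> \<or> lex_less ws \<beta> \<alpha> \<or> (\<forall>w\<in>set ws. \<alpha> w = \<beta> w)"
  by (induction ws) (auto simp: lex_less_def)

text \<open>Besides well-foundedness and totality, this translation invariance is all that the
  downset argument uses of the order.\<close>

lemma lex_less_add:
  "(\<And>w. w \<in> set ws \<Longrightarrow> \<alpha>' w = \<alpha> w + \<gamma> w \<and> \<beta>' w = \<beta> w + \<gamma> w) \<Longrightarrow>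
    lex_less ws \<alpha>' \<beta>' \<longleftrightarrow> lex_less ws \<alpha> \<beta>"
  by (induction ws) (auto simp: lex_less_def)

text \<open>With \<open>L\<close> = ln p this is p^(-|v| - s \<phi>(v)); the exponential form makes
  it visibly entire in \<open>s\<close>.\<close>

definition lattice_term :: "('n::finite \<Rightarrow> nat) set \<Rightarrow> real \<Rightarrow> complex \<Rightarrow> ('n \<Rightarrow> nat) \<Rightarrow> complex" where
  "lattice_term N L s v = exp (- of_real L * (of_nat (\<Sum>i\<in>UNIV. v i) + s * of_nat (newton N v)))"

lemma norm_lattice_term_le:
  assumes "0 < L" "0 < Re s"
  shows "norm (lattice_term N L s v) \<le> (\<Prod>i\<in>UNIV. exp (- L) ^ v i)"
proof -
  have "norm (lattice_term N L s v) = exp (- L * (real (\<Sum>i\<in>UNIV. v i) + Re s * real (newton N v)))"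
    by (simp add: lattice_term_def)
  also have "\<dots> \<le> exp (- L * real (\<Sum>i\<in>UNIV. v i))" using assms by simp
  also have "\<dots> = exp (- L) ^ (\<Sum>i\<in>UNIV. v i)" by (metis exp_of_nat2_mult)
  finally show ?thesis by (simp add: power_sum)
qed

lemma lattice_term_summable:
  assumes "0 < L" "0 < Re s"
  shows "(\<lambda>v. norm (lattice_term N L s v)) summable_on UNIV"
proof (rule summable_on_comparison_test)
  have "(\<lambda>v. norm (\<Prod>i\<in>UNIV. complex_of_real (exp (- L)) ^ v i)) summable_on (PiE UNIV (\<lambda>_::'a. UNIV :: nat set))"
    using assms by (intro abs_summable_on_power_products) auto
  then show "(\<lambda>v::'a \<Rightarrow> nat. \<Prod>i\<in>UNIV. exp (- L) ^ v i) summable_on UNIV"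
    by (simp add: PiE_UNIV_domain norm_power flip: prod_norm)
qed (use norm_lattice_term_le[OF assms] in auto)

lemma norm_lattice_term_less_1:
  assumes "0 < L" "0 < Re s" "v i \<noteq> 0"
  shows "norm (lattice_term N L s v) < 1"
proof -
  have "0 < real (\<Sum>i\<in>UNIV. v i)" using assms(3) by (metis finite gr0I iso_tuple_UNIV_I of_nat_0_less_iff sum_eq_0_iff)
  then have "0 < L * (real (\<Sum>i\<in>UNIV. v i) + Re s * real (newton N v))"
    using assms by (intro mult_pos_pos add_pos_nonneg) auto
  then show ?thesis by (simp add: lattice_term_def)
qed

text \<open>Every \<open>v\<close> is a bounded remainder \<open>f\<close> plus a combination of facet normals on which \<open>newton N\<close> is
  additive. Choosing the lexicographically least exponents makes this representation unique, and by
  translation invariance the chosen exponents form a downset for each \<open>f\<close>.\<close>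

theorem lattice_sum_continuation:
  fixes N :: "('n::finite \<Rightarrow> nat) set"
  assumes fin: "finite N" and ne: "N \<noteq> {}" and L: "0 < L"
  shows "\<exists>G. G holomorphic_on UNIV \<and> (\<forall>s. 0 < Re s \<longrightarrow>
    infsum (lattice_term N L s) UNIV * (\<Prod>w | facet_normal N w. 1 - lattice_term N L s w) = G s)"
proof -
  define W where "W = {w. facet_normal N w}"
  have finW: "finite W" using finite_facet_normals[OF fin ne] by (simp add: W_def)
  obtain ws where ws: "set ws = W" using finite_list[OF finW] by blast
  define y where "y w s = lattice_term N L s w" for w s
  define \<Omega> where "\<Omega> = {s. 0 < Re s}"
  have hol: "y w holomorphic_on UNIV" for w
    unfolding y_def lattice_term_def by (intro holomorphic_intros)
  have small: "norm (y w s) < 1" if "w \<in> W" "s \<in> \<Omega>" for w s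
    using norm_lattice_term_less_1[OF L, of s w] that by (auto simp: W_def y_def \<Omega>_def facet_normal_def)
  define X where "X = exponents W"
  define val where "val f \<alpha> = (\<lambda>i. f i + (\<Sum>w\<in>W. \<alpha> w * w i))" for f :: "'n \<Rightarrow> nat" and \<alpha>
  define compat where "compat f \<alpha> \<longleftrightarrow> newton N (val f \<alpha>) = newton N f + (\<Sum>w\<in>W. \<alpha> w * newton N w)" for f \<alpha>
  define F where "F = {f :: 'n \<Rightarrow> nat. \<forall>i. f i \<le> (\<Sum>w\<in>W. w i)}"
  have "F \<subseteq> PiE UNIV (\<lambda>i. {..\<Sum>w\<in>W. w i})" by (auto simp: F_def PiE_UNIV_domain)
  then have finF: "finite F" by (rule finite_subset) (auto intro: finite_PiE)
  define Rep where "Rep v = {\<alpha>\<in>X. \<exists>f\<in>F. compat f \<alpha> \<and> v = val f \<alpha>}" for v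
  have "Rep v \<noteq> {}" for v
  proof -
    obtain f \<alpha> where *: "\<And>i. f i \<le> (\<Sum>w\<in>W. w i)" "\<And>i. v i = f i + (\<Sum>w\<in>W. \<alpha> w * w i)"
      "newton N v = newton N f + (\<Sum>w\<in>W. \<alpha> w * newton N w)"
      by (rule facet_normal_remainder[OF fin ne, of v, folded W_def]) (rule that)
    have val: "val f (restrict \<alpha> W) = v" using * by (auto simp: val_def)
    have "restrict \<alpha> W \<in> Rep v"
      unfolding Rep_def compat_def using * val by (auto simp: X_def exponents_def F_def)
    then show ?thesis by blast
  qed
  have "\<exists>\<alpha>. \<alpha> \<in> Rep v \<and> (\<forall>\<beta>. lex_less ws \<beta> \<alpha> \<longrightarrow> \<beta> \<notin> Rep v)" for v
  proof -
    obtain \<alpha> where "\<alpha> \<in> Rep v" using \<open>Rep v \<noteq> {}\<close> by blast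
    from wfE_min[OF wf_lex_less[of ws] this] show ?thesis by auto
  qed
  then have "\<exists>canon. \<forall>v. canon v \<in> Rep v \<and> (\<forall>\<beta>. lex_less ws \<beta> (canon v) \<longrightarrow> \<beta> \<notin> Rep v)"
    by (intro choice allI)
  then obtain canon where
    canon0: "\<forall>v. canon v \<in> Rep v \<and> (\<forall>\<beta>. lex_less ws \<beta> (canon v) \<longrightarrow> \<beta> \<notin> Rep v)" ..
  have canon: "canon v \<in> Rep v" "lex_less ws \<beta> (canon v) \<Longrightarrow> \<beta> \<notin> Rep v" for v \<beta>
    using canon0 by blast+
  define R where "R f = {\<alpha>\<in>X. compat f \<alpha> \<and> canon (val f \<alpha>) = \<alpha>}" for f
  have val_add: "val f \<gamma> = (\<lambda>i. val f \<alpha> i + (\<Sum>w\<in>W. \<beta> w * w i))"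
    if "\<And>w. w \<in> W \<Longrightarrow> \<gamma> w = \<alpha> w + \<beta> w" for f \<alpha> \<beta> \<gamma>
    using that by (simp add: val_def sum.distrib distrib_right add.assoc)
  have sum_add: "(\<Sum>w\<in>W. \<gamma> w * c w) = (\<Sum>w\<in>W. \<alpha> w * c w) + (\<Sum>w\<in>W. \<beta> w * c w)"
    if "\<And>w. w \<in> W \<Longrightarrow> \<gamma> w = \<alpha> w + \<beta> w" for \<alpha> \<beta> \<gamma> :: "('n \<Rightarrow> nat) \<Rightarrow> nat" and c
    using that by (simp add: sum.distrib distrib_right)
  have newton_val: "newton N g + (\<Sum>w\<in>W. \<beta> w * newton N w) \<le> newton N (\<lambda>i. g i + (\<Sum>w\<in>W. \<beta> w * w i))" for g \<beta>
  proof -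
    have "(\<Sum>w\<in>W. newton N (\<lambda>i. \<beta> w * w i)) \<le> newton N (\<lambda>i. \<Sum>w\<in>W. \<beta> w * w i)"
      by (rule newton_superadd_sum[OF fin ne finW])
    moreover have "newton N (\<lambda>i. \<beta> w * w i) = \<beta> w * newton N w" for w
      by (rule newton_scale[OF fin ne]) simp
    ultimately show ?thesis
      using newton_superadd[OF fin ne, of g "\<lambda>i. \<Sum>w\<in>W. \<beta> w * w i"] by simp
  qed
  have down: "\<alpha> \<in> R f" if \<gamma>: "\<gamma> \<in> R f" and \<alpha>: "\<alpha> \<in> X" and le: "\<And>w. w \<in> W \<Longrightarrow> \<alpha> w \<le> \<gamma> w" and f: "f \<in> F" for f \<alpha> \<gamma>
  proof -
    define \<beta> where "\<beta> w = \<gamma> w - \<alpha> w" for w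
    have \<gamma>w: "\<And>w. w \<in> W \<Longrightarrow> \<gamma> w = \<alpha> w + \<beta> w" using le by (simp add: \<beta>_def)
    have val\<gamma>: "val f \<gamma> = (\<lambda>i. val f \<alpha> i + (\<Sum>w\<in>W. \<beta> w * w i))"
      by (rule val_add) (rule \<gamma>w)
    have c\<gamma>: "compat f \<gamma>" "canon (val f \<gamma>) = \<gamma>" using \<gamma> by (auto simp: R_def)
    \<comment> \<open>Superadditivity bounds both steps, from \<open>f\<close> to
      \<open>val f \<alpha>\<close> and on to \<open>val f \<gamma>\<close>, from the same side; the
      total is an equality, so the first step is one as well.\<close>
    have "newton N (val f \<alpha>) + (\<Sum>w\<in>W. \<beta> w * newton N w) \<le> newton N (val f \<gamma>)"
      unfolding val\<gamma> by (rule newton_val)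
    moreover have "newton N f + (\<Sum>w\<in>W. \<alpha> w * newton N w) \<le> newton N (val f \<alpha>)"
      unfolding val_def[of f \<alpha>] by (rule newton_val)
    moreover have n\<gamma>: "newton N (val f \<gamma>) = newton N f + (\<Sum>w\<in>W. \<alpha> w * newton N w) + (\<Sum>w\<in>W. \<beta> w * newton N w)"
      using c\<gamma>(1) unfolding compat_def by (simp add: sum_add[of \<gamma> \<alpha> \<beta>, OF \<gamma>w])
    ultimately have c\<alpha>: "compat f \<alpha>" unfolding compat_def by linarith
    define v where "v = val f \<alpha>"
    \<comment> \<open>A smaller representation of \<open>val f \<alpha>\<close>, possibly with
      another remainder \<open>f'\<close>, stays smaller after adding \<beta> and would beat the
      canonical choice for \<open>val f \<gamma>\<close>.\<close>
    have "\<not> lex_less ws (canon v) \<alpha>"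
    proof
      assume less: "lex_less ws (canon v) \<alpha>"
      obtain f' where f': "f' \<in> F" "compat f' (canon v)" "v = val f' (canon v)"
        using canon(1)[of v] by (auto simp: Rep_def)
      define \<delta> where "\<delta> = restrict (\<lambda>w. canon v w + \<beta> w) W"
      have \<delta>: "\<And>w. w \<in> W \<Longrightarrow> \<delta> w = canon v w + \<beta> w" by (simp add: \<delta>_def)
      have "val f' \<delta> = (\<lambda>i. val f' (canon v) i + (\<Sum>w\<in>W. \<beta> w * w i))"
        by (rule val_add) (rule \<delta>)
      then have "val f' \<delta> = val f \<gamma>" using f'(3) by (simp add: v_def val\<gamma>)
      moreover have "compat f' \<delta>"
        using f'(2,3) c\<alpha> n\<gamma> \<open>val f' \<delta> = val f \<gamma>\<close>
        by (simp add: compat_def v_def sum_add[of \<delta> "canon v" \<beta>, OF \<delta>])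
      moreover have "\<delta> \<in> X" by (simp add: \<delta>_def X_def exponents_def)
      ultimately have "\<delta> \<in> Rep (val f \<gamma>)" using f'(1) by (auto simp: Rep_def)
      moreover have "lex_less ws \<delta> \<gamma>"
        using less lex_less_add[of ws \<delta> "canon v" \<beta> \<gamma> \<alpha>] \<delta> \<gamma>w by (simp add: ws)
      ultimately show False using canon(2)[of \<delta> "val f \<gamma>"] c\<gamma>(2) by simp
    qed
    moreover have "\<alpha> \<in> Rep v" using c\<alpha> \<alpha> f by (auto simp: Rep_def v_def)
    then have "\<not> lex_less ws \<alpha> (canon v)" using canon(2) by blast
    ultimately have "\<forall>w\<in>W. canon v w = \<alpha> w" using lex_less_total[of ws "canon v" \<alpha>] by (simp add: ws)
    moreover have "canon v \<in> X" using canon(1)[of v] by (simp add: Rep_def)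
    ultimately have "canon v = \<alpha>" using \<alpha> by (auto simp: X_def exponents_def intro: PiE_ext)
    then show ?thesis using c\<alpha> \<alpha> by (simp add: R_def v_def)
  qed
  have cont: "continuable W y \<Omega> (R f)" if "f \<in> F" for f
  proof (rule continuable_downset[OF finW hol small])
    show "R f \<subseteq> exponents W" by (auto simp: R_def X_def)
    fix \<alpha> \<beta> assume "\<alpha> \<in> R f" "\<beta> \<in> exponents W" "\<And>w. w \<in> W \<Longrightarrow> \<beta> w \<le> \<alpha> w"
    then show "\<beta> \<in> R f" by (intro down[of \<alpha> f \<beta>] that) (simp_all add: X_def)
  qed
  have "\<forall>f\<in>F. \<exists>g. g holomorphic_on UNIV \<and>
      (\<forall>s\<in>\<Omega>. infsum (power_product W y s) (R f) * (\<Prod>w\<in>W. 1 - y w s) = g s)"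
    using cont unfolding continuable_def by blast
  from bchoice[OF this] obtain g where g0: "\<forall>f\<in>F. g f holomorphic_on UNIV \<and>
      (\<forall>s\<in>\<Omega>. infsum (power_product W y s) (R f) * (\<Prod>w\<in>W. 1 - y w s) = g f s)" ..
  have g: "f \<in> F \<Longrightarrow> g f holomorphic_on UNIV"
    "f \<in> F \<Longrightarrow> s \<in> \<Omega> \<Longrightarrow> infsum (power_product W y s) (R f) * (\<Prod>w\<in>W. 1 - y w s) = g f s" for f s
    using g0 by blast+
  \<comment> \<open>Each lattice point occurs exactly once: its canonical exponents fix \<alpha>,
    and subtracting the combination recovers \<open>f\<close>.\<close>
  have bij: "bij_betw (\<lambda>(f, \<alpha>). val f \<alpha>) (SIGMA f:F. R f) UNIV"
    unfolding bij_betw_def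
  proof (intro conjI inj_onI)
    fix a b assume "a \<in> (SIGMA f:F. R f)" "b \<in> (SIGMA f:F. R f)" "(case a of (f, \<alpha>) \<Rightarrow> val f \<alpha>) = (case b of (f, \<alpha>) \<Rightarrow> val f \<alpha>)"
    then obtain f \<alpha> f' \<alpha>' where ab: "a = (f, \<alpha>)" "b = (f', \<alpha>')" "\<alpha> \<in> R f" "\<alpha>' \<in> R f'" "val f \<alpha> = val f' \<alpha>'" by auto
    then have "\<alpha> = \<alpha>'" by (auto simp: R_def)
    moreover have "f = f'" using ab(5) \<open>\<alpha> = \<alpha>'\<close> by (auto simp: val_def fun_eq_iff)
    ultimately show "a = b" using ab by simp
  next
    show "(\<lambda>(f, \<alpha>). val f \<alpha>) ` (SIGMA f:F. R f) = UNIV"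
    proof (intro equalityI subsetI)
      fix v :: "'n \<Rightarrow> nat"
      obtain f where f: "f \<in> F" "compat f (canon v)" "v = val f (canon v)"
        using canon(1)[of v] by (auto simp: Rep_def)
      moreover have "canon v \<in> X" using canon(1)[of v] by (simp add: Rep_def)
      ultimately have "(f, canon v) \<in> (SIGMA f:F. R f)" by (simp add: R_def)
      then show "v \<in> (\<lambda>(f, \<alpha>). val f \<alpha>) ` (SIGMA f:F. R f)" using f(3) by (force intro: image_eqI)
    qed simp
  qed
  have lterm: "lattice_term N L s (val f \<alpha>) = lattice_term N L s f * power_product W y s \<alpha>"
    if "f \<in> F" "\<alpha> \<in> R f" for f \<alpha> s
  proof -
    have c: "newton N (val f \<alpha>) = newton N f + (\<Sum>w\<in>W. \<alpha> w * newton N w)"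
      using that by (auto simp: R_def compat_def)
    have d: "(\<Sum>i\<in>UNIV. val f \<alpha> i) = (\<Sum>i\<in>UNIV. f i) + (\<Sum>w\<in>W. \<alpha> w * (\<Sum>i\<in>UNIV. w i))"
      unfolding val_def sum.distrib sum_distrib_left by (subst sum.swap) simp
    let ?e = "\<lambda>w. - of_real L * (of_nat (\<Sum>i\<in>UNIV. w i) + s * of_nat (newton N w))"
    have "power_product W y s \<alpha> = (\<Prod>w\<in>W. exp (of_nat (\<alpha> w) * ?e w))"
      unfolding power_product_def y_def lattice_term_def by (simp only: exp_of_nat_mult)
    then have pp: "power_product W y s \<alpha> = exp (\<Sum>w\<in>W. of_nat (\<alpha> w) * ?e w)"
      by (simp only: exp_sum[OF finW])
    show ?thesis
      unfolding lattice_term_def c d pp exp_add[symmetric]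
      by (intro arg_cong[where f = exp])
         (simp add: algebra_simps sum.distrib sum_distrib_left sum_negf sum_subtractf)
  qed
  have total: "infsum (lattice_term N L s) UNIV = (\<Sum>f\<in>F. lattice_term N L s f * infsum (power_product W y s) (R f))"
    if "s \<in> \<Omega>" for s
  proof -
    have summ: "lattice_term N L s summable_on UNIV"
      using lattice_term_summable[OF L, of s N] that abs_summable_summable by (auto simp: \<Omega>_def)
    then have summ': "(\<lambda>z. lattice_term N L s (case z of (f, \<alpha>) \<Rightarrow> val f \<alpha>)) summable_on (SIGMA f:F. R f)"
      using summable_on_reindex_bij_betw[OF bij, of "lattice_term N L s"] by simp
    have "infsum (lattice_term N L s) UNIV
        = infsum (\<lambda>z. lattice_term N L s (case z of (f, \<alpha>) \<Rightarrow> val f \<alpha>)) (SIGMA f:F. R f)"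
      by (rule infsum_reindex_bij_betw[OF bij, symmetric])
    also have "\<dots> = (\<Sum>\<^sub>\<infinity>f\<in>F. \<Sum>\<^sub>\<infinity>\<alpha>\<in>R f. lattice_term N L s (val f \<alpha>))"
      using infsum_Sigma_banach[OF summ'] by simp
    also have "\<dots> = (\<Sum>f\<in>F. \<Sum>\<^sub>\<infinity>\<alpha>\<in>R f. lattice_term N L s f * power_product W y s \<alpha>)"
      using finF lterm by (auto intro!: sum.cong infsum_cong)
    finally show ?thesis by (simp add: infsum_cmult_right')
  qed
  show ?thesis
  proof (intro exI[of _ "\<lambda>s. \<Sum>f\<in>F. lattice_term N L s f * g f s"] conjI allI impI)
    show "(\<lambda>s. \<Sum>f\<in>F. lattice_term N L s f * g f s) holomorphic_on UNIV"
      unfolding lattice_term_def by (intro holomorphic_intros g)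
    fix s :: complex assume "0 < Re s"
    then have s: "s \<in> \<Omega>" by (simp add: \<Omega>_def)
    then show "infsum (lattice_term N L s) UNIV * (\<Prod>w | facet_normal N w. 1 - lattice_term N L s w)
        = (\<Sum>f\<in>F. lattice_term N L s f * g f s)"
      using g(2)[OF _ s] by (simp add: total sum_distrib_right mult.assoc y_def flip: W_def)
  qed
qed

section \<open>The zeta function as a lattice sum\<close>

abbreviation lookup :: "('a \<Rightarrow>\<^sub>0 'b::zero) \<Rightarrow> 'a \<Rightarrow> 'b" where
  "lookup \<equiv> Poly_Mapping.lookup"

abbreviation keys :: "('a \<Rightarrow>\<^sub>0 'b::zero) \<Rightarrow> 'a set" where
  "keys \<equiv> Poly_Mapping.keys"

abbreviation single :: "'a \<Rightarrow> 'b \<Rightarrow> 'a \<Rightarrow>\<^sub>0 'b::zero" where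
  "single \<equiv> Poly_Mapping.single"

definition monomials_ideal :: "('n \<Rightarrow>\<^sub>0 nat) set \<Rightarrow> ('n, 'a::comm_ring_1) mpolynomial set" where
  "monomials_ideal M = ideal_gen UNIV ((\<lambda>m. single m 1) ` M)"

text \<open>A key of a sum is a key of one of the summands, and multiplication by a monomial only
  raises exponents.\<close>

lemma monomials_ideal_keys:
  fixes f :: "('n::finite, 'a::comm_ring_1) mpolynomial"
  assumes "f \<in> monomials_ideal M" "k \<in> keys f"
  obtains m where "m \<in> M" "\<And>i. lookup m i \<le> lookup k i"
proof -
  obtain T r where f: "f = (\<Sum>a\<in>T. r a * a)" "T \<subseteq> (\<lambda>m. single m 1) ` M"
    using assms(1) unfolding monomials_ideal_def ideal_gen_def by blast
  have "(\<Sum>a\<in>T. lookup (r a * a) k) \<noteq> 0"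
    using assms(2) by (simp add: f(1) in_keys_iff lookup_sum)
  then obtain a where a: "a \<in> T" "k \<in> keys (r a * a)"
    by (auto simp: in_keys_iff elim: sum.not_neutral_contains_not_neutral)
  then obtain m where m: "m \<in> M" "a = single m 1" using f(2) by blast
  obtain l where "k = l + m"
    using a(2) keys_mult[of "r a" a] unfolding m(2) by (auto split: if_splits)
  then show thesis using that m(1) by (simp add: lookup_add)
qed

section \<open>The order of a monomial ideal at a p-adic point\<close>

lemma zp_ord_ge_iff:
  assumes "p > 0" "x \<in> zp p"
  shows "enat k \<le> zp_ord p x \<longleftrightarrow> x k = 0"
proof
  assume "x k = 0"
  then show "enat k \<le> zp_ord p x"
    using assms unfolding zp_ord_def by (intro Sup_upper) (auto simp: zp_power_ideal_eq)
next
  assume le: "enat k \<le> zp_ord p x"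
  show "x k = 0"
  proof (rule ccontr)
    assume nz: "x k \<noteq> 0"
    then obtain l where l: "k = Suc l" using zp_bounds[OF assms(2), of 0] by (cases k) auto
    have "zp_ord p x \<le> enat l"
      unfolding zp_ord_def
    proof (rule Sup_least)
      fix e assume "e \<in> {enat m |m. x \<in> zp_power_ideal p m}"
      then obtain m where m: "e = enat m" "x m = 0" using assms by (auto simp: zp_power_ideal_eq)
      have "m < k" using zp_mod[OF assms(2), of k m] m(2) nz by (cases "k \<le> m") auto
      then show "e \<le> enat l" using m(1) l by simp
    qed
    then show False using le l by (metis enat_ord_simps(1) not_less_eq_eq order_refl order_trans)
  qed
qed

lemma zp_eval_in:
  assumes "p > 0" "y \<in> zp_vec p"
  shows "zp_eval p f y \<in> zp p"
  unfolding zp_eval_def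
proof (rule zpI_mod[OF assms(1)])
  fix k
  let ?q = "int p ^ k" and ?P = "\<lambda>k m. \<Prod>i\<in>UNIV. y i k ^ lookup m i"
    and ?K = "keys f" and ?c = "lookup f"
  have "?P (Suc k) m mod ?q = ?P k m mod ?q" for m
  proof -
    have "(y i (Suc k) ^ l) mod ?q = (y i k ^ l) mod ?q" for i l
      using assms(2) power_mod[of "y i (Suc k)" ?q l] by (simp add: zp_vec_def zp_Suc_mod)
    then have "(\<Prod>i\<in>UNIV. y i (Suc k) ^ lookup m i mod ?q) mod ?q
        = (\<Prod>i\<in>UNIV. y i k ^ lookup m i mod ?q) mod ?q" by simp
    then show ?thesis by (simp only: mod_prod_eq)
  qed
  then have "(?c m * ?P (Suc k) m) mod ?q = (?c m * ?P k m) mod ?q" for m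
    by (rule mod_mult_cong[OF refl])
  then have "(\<Sum>m\<in>?K. ?c m * ?P (Suc k) m mod ?q) mod ?q = (\<Sum>m\<in>?K. ?c m * ?P k m mod ?q) mod ?q"
    by simp
  then show "(\<Sum>m\<in>?K. ?c m * ?P (Suc k) m) mod ?q = (\<Sum>m\<in>?K. ?c m * ?P k m) mod ?q"
    by (simp only: mod_sum_eq)
qed

lemma ord_ideal_ge_iff:
  assumes "p > 0" "y \<in> zp_vec p"
  shows "enat k \<le> ord_ideal p I y \<longleftrightarrow> (\<forall>f\<in>I. zp_eval p f y k = 0)"
  using zp_ord_ge_iff[OF assms(1) zp_eval_in[OF assms]] by (simp add: ord_ideal_def le_INF_iff)

text \<open>The two conditions say that the coordinate at \<open>i\<close> has order exactly
  \<open>v i\<close>, in terms of its residues modulo consecutive powers of p.\<close>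

definition zp_shell :: "nat \<Rightarrow> ('n::finite \<Rightarrow> nat) \<Rightarrow> ('n \<Rightarrow> nat \<Rightarrow> int) set" where
  "zp_shell p v = {y\<in>zp_vec p. \<forall>i. y i (v i) = 0 \<and> y i (Suc (v i)) \<noteq> 0}"

text \<open>Divisibility is tested on residues modulo p^k, where a coordinate shows at most min(v i,
  k) factors p; the truncation is harmless because the threshold is k itself.\<close>

lemma shell_power_dvd_iff:
  assumes p: "prime p" and y: "y \<in> zp_shell p v"
  shows "int p ^ k dvd (\<Prod>i\<in>UNIV. y i k ^ m i) \<longleftrightarrow> k \<le> dotp m v"
proof
  have p0: "p > 0" using p prime_gt_0_nat by blast
  have zp: "y i \<in> zp p" for i using y by (simp add: zp_shell_def zp_vec_def)
  have yv: "y i (v i) = 0" "y i (Suc (v i)) \<noteq> 0" for i using y by (simp_all add: zp_shell_def)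
  have div: "int p ^ min (v i) k dvd y i k" for i
  proof (cases "k \<le> v i")
    case True
    then show ?thesis using zp_mod[OF zp[of i] True] yv(1)[of i] by simp
  next
    case False
    then show ?thesis using zp_mod[OF zp[of i], of "v i" k] yv(1)[of i] by (simp add: mod_eq_0_iff_dvd)
  qed
  { assume k: "k \<le> dotp m v"
    have "(\<Prod>i\<in>UNIV. int p ^ (min (v i) k * m i)) dvd (\<Prod>i\<in>UNIV. y i k ^ m i)"
      using div by (intro prod_dvd_prod) (simp add: power_mult dvd_power_same)
    \<comment> \<open>A single truncated coordinate that occurs in the monomial contributes k
      already; if there is none, the sum is the untruncated one.\<close>
    moreover have "k \<le> (\<Sum>i\<in>UNIV. min (v i) k * m i)"
    proof (cases "\<exists>i. m i \<noteq> 0 \<and> k \<le> v i")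
      case True
      then obtain i where i: "m i \<noteq> 0" "k \<le> v i" by blast
      have "k \<le> min (v i) k * m i" using i by simp
      also have "\<dots> \<le> (\<Sum>i\<in>UNIV. min (v i) k * m i)" by (intro member_le_sum) auto
      finally show ?thesis .
    next
      case False
      have "min (v i) k * m i = m i * v i" for i
      proof (cases "m i = 0")
        case m: False
        then have "v i \<le> k" using False by (meson nat_le_linear)
        then show ?thesis by (simp add: min_absorb1)
      qed simp
      then show ?thesis using k unfolding dotp_def by (simp only: of_nat_id)
    qed
    then have "int p ^ k dvd (\<Prod>i\<in>UNIV. int p ^ (min (v i) k * m i))"
      unfolding power_sum[symmetric] by (rule le_imp_power_dvd)
    ultimately show "int p ^ k dvd (\<Prod>i\<in>UNIV. y i k ^ m i)" by (rule dvd_trans[rotated])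
  }
  { assume dvd: "int p ^ k dvd (\<Prod>i\<in>UNIV. y i k ^ m i)"
    show "k \<le> dotp m v"
    proof (rule ccontr)
      assume "\<not> k \<le> dotp m v"
      then have k: "dotp m v < k" by simp
      have vk: "v i < k" if "m i \<noteq> 0" for i
      proof -
        have "v i \<le> m i * v i" using that by simp
        also have "\<dots> \<le> dotp m v" unfolding dotp_def of_nat_id by (rule member_le_sum) auto
        finally show ?thesis using k by simp
      qed
      \<comment> \<open>Every coordinate that occurs has order below k, so dividing out p^(v i)
        leaves a number prime to p, and p cannot divide a product of such numbers.\<close>
      define u where "u i = y i k div int p ^ v i" for i
      have yu: "y i k = int p ^ v i * u i" "\<not> int p dvd u i" if "m i \<noteq> 0" for i
      proof -
        show *: "y i k = int p ^ v i * u i" using div[of i] vk[OF that] by (simp add: u_def min_def)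
        show "\<not> int p dvd u i"
        proof
          assume "int p dvd u i"
          then have "int p ^ Suc (v i) dvd y i k" unfolding * power_Suc2 by (rule mult_dvd_mono[OF dvd_refl])
          then have "y i (Suc (v i)) = 0" using zp_mod[OF zp[of i], of "Suc (v i)" k] vk[OF that] by simp
          then show False using yv(2) by blast
        qed
      qed
      have "(\<Prod>i\<in>UNIV. y i k ^ m i) = (\<Prod>i\<in>UNIV. int p ^ (m i * v i) * u i ^ m i)"
      proof (rule prod.cong[OF refl])
        fix i show "y i k ^ m i = int p ^ (m i * v i) * u i ^ m i"
          using yu(1)[of i] by (cases "m i = 0") (simp_all add: power_mult_distrib mult.commute flip: power_mult)
      qed
      also have "\<dots> = int p ^ dotp m v * (\<Prod>i\<in>UNIV. u i ^ m i)"
        by (simp add: prod.distrib power_sum dotp_def)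
      finally have "int p ^ Suc (dotp m v) dvd int p ^ dotp m v * (\<Prod>i\<in>UNIV. u i ^ m i)"
        using dvd_trans[OF le_imp_power_dvd[OF Suc_leI[OF k]] dvd] by simp
      then have "int p dvd (\<Prod>i\<in>UNIV. u i ^ m i)" using p0 by (simp add: mult.commute)
      then obtain i where i: "int p dvd u i ^ m i" using p by (auto simp: prime_dvd_prod_iff)
      then have "m i \<noteq> 0" using p by (metis not_prime_unit power_0 prime_nat_int_transfer)
      then show False using i yu(2)[of i] p prime_dvd_power by (metis prime_nat_int_transfer)
    qed
  }
qed

text \<open>Every monomial in an element of the ideal has order at least the minimum over
  \<open>N\<close>, and the minimum is attained by a monomial that itself lies in the ideal.\<close>

lemma ord_ideal_shell:
  fixes I :: "('n::finite, int) mpolynomial set"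
  assumes p: "prime p" and y: "y \<in> zp_shell p v"
    and I: "I = monomials_ideal M"
    and N: "finite N" "N \<noteq> {}" "N \<subseteq> lookup ` M"
      "\<And>m. m \<in> M \<Longrightarrow> \<exists>n\<in>N. \<forall>i. n i \<le> lookup m i"
  shows "ord_ideal p I y = enat (newton N v)"
proof -
  have p0: "p > 0" using p prime_gt_0_nat by blast
  have yz: "y \<in> zp_vec p" using y by (simp add: zp_shell_def)
  have "enat k \<le> ord_ideal p I y \<longleftrightarrow> k \<le> newton N v" for k
    unfolding ord_ideal_ge_iff[OF p0 yz]
  proof
    assume k: "k \<le> newton N v"
    show "\<forall>f\<in>I. zp_eval p f y k = 0"
    proof
      fix f assume f: "f \<in> I"
      have "int p ^ k dvd (\<Prod>i\<in>UNIV. y i k ^ lookup m i)" if m: "m \<in> keys f" for m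
      proof -
        obtain l where l: "l \<in> M" "\<And>i. lookup l i \<le> lookup m i"
          using monomials_ideal_keys[OF f[unfolded I] m] by blast
        obtain n where n: "n \<in> N" "\<And>i. n i \<le> lookup l i" using N(4)[OF l(1)] by blast
        have "k \<le> dotp n v" using k newton_le[OF N(1,2) n(1), of v] by simp
        also have "\<dots> \<le> dotp (lookup m) v"
          unfolding dotp_def using n(2) l(2) by (intro sum_mono mult_right_mono) (auto intro: order_trans)
        finally show ?thesis using shell_power_dvd_iff[OF p y] by blast
      qed
      then show "zp_eval p f y k = 0"
        unfolding zp_eval_def by (simp add: mod_eq_0_iff_dvd dvd_sum)
    qed
  next
    assume 0: "\<forall>f\<in>I. zp_eval p f y k = 0"
    obtain n where n: "n \<in> N" "dotp n v = newton N v" using tight_ex[OF N(1,2), of v] by (auto simp: tight_def)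
    obtain m where m: "m \<in> M" "n = lookup m" using n N(3) by blast
    have "single m 1 \<in> I"
      unfolding I monomials_ideal_def ideal_gen_def using m(1)
      by (auto intro!: exI[of _ "{single m 1}"] exI[of _ "\<lambda>_. 1"])
    then have "zp_eval p (single m 1) y k = 0" using 0 by blast
    then have "int p ^ k dvd (\<Prod>i\<in>UNIV. y i k ^ n i)" by (simp add: zp_eval_def m(2) mod_eq_0_iff_dvd)
    then show "k \<le> newton N v" using shell_power_dvd_iff[OF p y] n(2) by metis
  qed
  from this[of "newton N v"] this[of "Suc (newton N v)"] show ?thesis
    by (cases "ord_ideal p I y") auto
qed

section \<open>Measurability, the measure of the shells, and termwise integration\<close>

lemma zp_haar_eq: "p > 0 \<Longrightarrow> zp_haar p = zp_product_measure p"
  using zp_haar_unique is_haar_measure_zp_haar zp_product_measure_haar by blast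

lemma zp_haar_sets:
  assumes "p > 0"
  shows "sets (zp_haar p :: ('n::finite \<Rightarrow> nat \<Rightarrow> int) measure) = sets (restrict_space borel (zp_vec p))"
    "space (zp_haar p :: ('n \<Rightarrow> nat \<Rightarrow> int) measure) = zp_vec p"
proof -
  show "sets (zp_haar p :: ('n \<Rightarrow> nat \<Rightarrow> int) measure) = sets (restrict_space borel (zp_vec p))"
    using is_haar_measure_zp_haar[OF assms] unfolding is_haar_measure_def by blast
  from sets_eq_imp_space_eq[OF this] show "space (zp_haar p :: ('n \<Rightarrow> nat \<Rightarrow> int) measure) = zp_vec p"
    by (simp add: space_restrict_space)
qed

text \<open>A condition on the residues at level \<open>k\<close> alone describes a countable union
  of balls.\<close>

lemma zp_component_sets:
  assumes "p > 0"
  shows "{y\<in>zp_vec p. Q (\<lambda>i. y i k)} \<in> sets (zp_haar p :: ('n::finite \<Rightarrow> nat \<Rightarrow> int) measure)"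
proof -
  have "{y\<in>zp_vec p. Q (\<lambda>i. y i k)} = (\<Union>d\<in>{d::'n \<Rightarrow> int. Q d}. {y\<in>zp_vec p. \<forall>i. y i k = d i})"
  proof (intro equalityI subsetI)
    fix y :: "'n \<Rightarrow> nat \<Rightarrow> int" assume "y \<in> {y\<in>zp_vec p. Q (\<lambda>i. y i k)}"
    then show "y \<in> (\<Union>d\<in>{d::'n \<Rightarrow> int. Q d}. {y\<in>zp_vec p. \<forall>i. y i k = d i})"
      by (intro UN_I[of "\<lambda>i. y i k"]) auto
  next
    fix y assume "y \<in> (\<Union>d\<in>{d::'n \<Rightarrow> int. Q d}. {y\<in>zp_vec p. \<forall>i. y i k = d i})"
    then obtain d where "Q d" "y \<in> zp_vec p" "\<forall>i. y i k = d i" by blast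
    moreover from this have "(\<lambda>i. y i k) = d" by auto
    ultimately show "y \<in> {y\<in>zp_vec p. Q (\<lambda>i. y i k)}" by simp
  qed
  also have "\<dots> \<in> sigma_sets (zp_vec p) (zp_balls p)"
    by (intro sigma_sets_UNION) (auto intro!: zp_ball_in)
  finally show ?thesis using assms by (simp add: zp_haar_sets zp_borel_eq)
qed

lemma ord_ideal_measurable:
  assumes "p > 0"
  shows "ord_ideal p I \<in> measurable (zp_haar p :: ('n::finite \<Rightarrow> nat \<Rightarrow> int) measure) (count_space UNIV)"
proof (rule measurable_count_space_eq2_countable[THEN iffD2, rule_format], intro conjI ballI)
  let ?H = "zp_haar p :: ('n \<Rightarrow> nat \<Rightarrow> int) measure"
  have ge: "{y\<in>zp_vec p. enat k \<le> ord_ideal p I y} \<in> sets ?H" for k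
  proof -
    have "{y\<in>zp_vec p. enat k \<le> ord_ideal p I y} = {y\<in>zp_vec p. \<forall>f\<in>I. zp_eval p f y k = 0}"
      using ord_ideal_ge_iff[OF assms] by blast
    then show ?thesis
      unfolding zp_eval_def
      using zp_component_sets[OF assms, of "\<lambda>c. \<forall>f\<in>I. (\<Sum>m\<in>keys f. lookup f m * (\<Prod>i\<in>UNIV. c i ^ lookup m i)) mod int p ^ k = 0" k]
      by simp
  qed
  fix e :: enat
  show "ord_ideal p I -` {e} \<inter> space ?H \<in> sets ?H"
  proof (cases e)
    case (enat k)
    have "ord_ideal p I -` {e} \<inter> space ?H
        = {y\<in>zp_vec p. enat k \<le> ord_ideal p I y} - {y\<in>zp_vec p. enat (Suc k) \<le> ord_ideal p I y}"
      by (auto simp: zp_haar_sets[OF assms] enat Suc_ile_eq)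
    then show ?thesis using ge by simp
  next
    case infinity
    have "ord_ideal p I -` {e} \<inter> space ?H = (\<Inter>k. {y\<in>zp_vec p. enat k \<le> ord_ideal p I y})"
    proof -
      have "x = \<infinity> \<longleftrightarrow> (\<forall>k. enat k \<le> x)" for x
        by (cases x) (auto, metis Suc_n_not_le_n)
      then show ?thesis by (auto simp: zp_haar_sets[OF assms] infinity)
    qed
    then show ?thesis using ge by simp
  qed
qed auto


lemma zp_haar_box:
  assumes "p > 0"
  shows "emeasure (zp_haar p) (zp_cyl p m (\<lambda>_ _. 0)) = ennreal ((1 / real p) ^ (\<Sum>i\<in>(UNIV::'n::finite set). m i))"
proof -
  have "is_haar_measure p (zp_haar p :: ('n \<Rightarrow> nat \<Rightarrow> int) measure)" by (rule is_haar_measure_zp_haar[OF assms])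
  then have "emeasure (zp_haar p) {y. \<forall>i. y i \<in> zp_power_ideal p (m i)} = ennreal ((1 / real p) ^ (\<Sum>i\<in>UNIV. m i))"
    unfolding is_haar_measure_def by blast
  then show ?thesis unfolding zp_box_eq_cyl[OF assms] .
qed

lemma zp_shell_sets:
  assumes "p > 0"
  shows "zp_shell p v \<in> sets (zp_haar p)"
proof -
  let ?R = "zp_cyl p v (\<lambda>_ _. 0) - (\<Union>i\<in>UNIV. zp_cyl p (v(i := Suc (v i))) (\<lambda>_ _. 0))"
  have "zp_shell p v = ?R"
  proof (intro equalityI subsetI)
    fix y assume y: "y \<in> ?R"
    then have "y i (Suc (v i)) \<noteq> 0" for i
    proof -
      have "y \<notin> zp_cyl p (v(i := Suc (v i))) (\<lambda>_ _. 0)" using y by blast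
      then show ?thesis using y by (auto simp: zp_cyl_def split: if_splits)
    qed
    then show "y \<in> zp_shell p v" using y by (auto simp: zp_shell_def zp_cyl_def)
  next
    fix y assume y: "y \<in> zp_shell p v"
    then have "y \<notin> zp_cyl p (v(i := Suc (v i))) (\<lambda>_ _. 0)" for i
      by (auto simp: zp_shell_def zp_cyl_def intro!: exI[of _ i])
    then show "y \<in> ?R"
      using y by (auto simp: zp_shell_def zp_cyl_def)
  qed
  also have "\<dots> \<in> sets (zp_haar p)"
    unfolding zp_haar_sets(1)[OF assms] by (intro sets.Diff sets.finite_UN zp_cyl_sets) auto
  finally show ?thesis .
qed

text \<open>In the digit model a shell prescribes that the digits below \<open>v i\<close> vanish
  and that the digit at \<open>v i\<close> does not; by independence each coordinate contributes
  p^(-v i) (1 - 1/p). Hence the index set \<open>?J\<close> includes the position \<open>v i\<close>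
  itself.\<close>

lemma emeasure_zp_shell:
  fixes v :: "'n::finite \<Rightarrow> nat"
  assumes p: "p > 0"
  shows "emeasure (zp_haar p) (zp_shell p v) = ennreal ((1 - 1 / real p) ^ CARD('n) * (1 / real p) ^ (\<Sum>i\<in>UNIV. v i))"
proof -
  let ?U = "\<lambda>_::'n \<times> nat. uniform_count_measure {0..<int p}"
  let ?J = "SIGMA i:UNIV. {..v i}"
  let ?c = "\<lambda>(i, j). if j < v i then 1 / real p else 1 - 1 / real p"
  let ?A = "\<lambda>(i, j). if j < v i then {0} else {1..<int p}"
  have low: "zp_of_digits p d i (v i) = 0 \<longleftrightarrow> (\<forall>j<v i. d (i, j) = 0)"
    if "d \<in> space (zp_digit_measure p)" for d i
    unfolding zp_of_digits_def using that p
    by (subst base_expansion_eq_iff) (auto simp: zp_digit_space)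
  have "zp_of_digits p d i (v i) = 0 \<and> zp_of_digits p d i (Suc (v i)) \<noteq> 0
      \<longleftrightarrow> (\<forall>j\<le>v i. d (i, j) \<in> ?A (i, j))" if d: "d \<in> space (zp_digit_measure p)" for d i
  proof -
    have "zp_of_digits p d i (Suc (v i)) = zp_of_digits p d i (v i) + d (i, v i) * int p ^ v i"
      by (simp add: zp_of_digits_def)
    moreover have "d (i, v i) \<in> {1..<int p} \<longleftrightarrow> d (i, v i) \<noteq> 0"
    proof -
      have "0 \<le> d (i, v i)" "d (i, v i) < int p" using d by (auto simp: zp_digit_space)
      then show ?thesis by auto
    qed
    ultimately show ?thesis using low[OF d, of i] p by (force simp: le_less)
  qed
  then have "zp_of_digits p -` zp_shell p v \<inter> space (zp_digit_measure p)
      = {d\<in>space (zp_digit_measure p). \<forall>ij\<in>?J. d ij \<in> ?A ij}"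
    using p by (fastforce simp: zp_shell_def zp_of_digits_in)
  also have "\<dots> = prod_emb UNIV ?U ?J (Pi\<^sub>E ?J ?A)"
    unfolding prod_emb_def zp_digit_measure_def space_PiM
    by (intro set_eqI) (simp add: PiE_iff Int_def vimage_def restrict_def extensional_def conj_commute)
  finally have "emeasure (zp_product_measure p) (zp_shell p v)
      = emeasure (zp_digit_measure p) (prod_emb UNIV ?U ?J (Pi\<^sub>E ?J ?A))"
    using zp_shell_sets[OF p, of v] unfolding zp_haar_sets(1)[OF p]
    unfolding zp_product_measure_def by (simp add: emeasure_distr zp_of_digits_measurable p)
  also have "\<dots> = (\<Prod>ij\<in>?J. emeasure (?U ij) (?A ij))"
    unfolding zp_digit_measure_def
    using p by (intro emeasure_PiM_emb prob_space_uniform_count_measure)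
       (auto simp: sets_uniform_count_measure split: if_splits)
  also have "\<dots> = (\<Prod>ij\<in>?J. ennreal (?c ij))"
  proof (rule prod.cong[OF refl])
    fix ij assume "ij \<in> ?J"
    then obtain i j where "ij = (i, j)" "j \<le> v i" by blast
    then show "emeasure (?U ij) (?A ij) = ennreal (?c ij)"
      using p by (auto simp: emeasure_uniform_count_measure of_nat_diff field_simps)
  qed
  also have "\<dots> = ennreal (\<Prod>ij\<in>?J. ?c ij)"
    using p by (intro prod_ennreal) (auto simp: field_simps)
  also have "(\<Prod>ij\<in>?J. ?c ij)
      = (\<Prod>i\<in>UNIV. \<Prod>j\<in>{..v i}. if j < v i then 1 / real p else 1 - 1 / real p)"
    by (subst prod.Sigma) auto
  also have "\<dots> = (\<Prod>i\<in>UNIV. (1 / real p) ^ v i * (1 - 1 / real p))"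
  proof (rule prod.cong[OF refl])
    fix i
    have "{..v i} = insert (v i) {..<v i}" by auto
    then show "(\<Prod>j\<in>{..v i}. if j < v i then 1 / real p else 1 - 1 / real p) = (1 / real p) ^ v i * (1 - 1 / real p)"
      by (simp add: mult.commute)
  qed
  also have "\<dots> = (1 - 1 / real p) ^ CARD('n) * (1 / real p) ^ (\<Sum>i\<in>UNIV. v i)"
    by (simp add: prod.distrib power_sum mult.commute)
  finally show ?thesis using p by (simp add: zp_haar_eq)
qed

lemma AE_zp_shell:
  assumes p: "p > 1"
  shows "AE y in (zp_haar p :: ('n::finite \<Rightarrow> nat \<Rightarrow> int) measure). \<exists>v. y \<in> zp_shell p v"
proof -
  let ?H = "zp_haar p :: ('n \<Rightarrow> nat \<Rightarrow> int) measure"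
  have p0: "p > 0" using p by simp
  \<comment> \<open>An exceptional point has a coordinate equal to 0 and therefore lies in boxes
    \<open>?C i k\<close> of measure p^(-k) for every k.\<close>
  let ?C = "\<lambda>i k. zp_cyl p ((\<lambda>_. 0)(i := k)) (\<lambda>_ _. 0) :: ('n \<Rightarrow> nat \<Rightarrow> int) set"
  have sets: "?C i k \<in> sets ?H" for i k unfolding zp_haar_sets(1)[OF p0] by (rule zp_cyl_sets)
  have null: "(\<Inter>k. ?C i k) \<in> null_sets ?H" for i
  proof (rule null_setsI)
    show "(\<Inter>k. ?C i k) \<in> sets ?H" using sets by (intro sets.countable_INT) auto
    have em: "emeasure ?H (\<Inter>k. ?C i k) \<le> ennreal ((1 / real p) ^ k)" for k
    proof -
      have "emeasure ?H (\<Inter>k. ?C i k) \<le> emeasure ?H (?C i k)" using sets by (intro emeasure_mono) auto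
      also have "\<dots> = ennreal ((1 / real p) ^ k)" by (simp add: zp_haar_box[OF p0] sum.delta)
      finally show ?thesis .
    qed
    have "(\<lambda>k. ennreal ((1 / real p) ^ k)) \<longlonglongrightarrow> ennreal 0"
      using p by (intro tendsto_ennrealI LIMSEQ_power_zero) auto
    then have "emeasure ?H (\<Inter>k. ?C i k) \<le> ennreal 0"
      using em by (intro LIMSEQ_le_const) auto
    then show "emeasure ?H (\<Inter>k. ?C i k) = 0" by simp
  qed
  have "AE y in ?H. \<forall>i. y \<notin> (\<Inter>k. ?C i k)"
    unfolding AE_all_countable using AE_not_in[OF null] by blast
  then show ?thesis
  proof (rule AE_mp, intro AE_I2 impI)
    fix y assume yH: "y \<in> space ?H" and y: "\<forall>i. y \<notin> (\<Inter>k. ?C i k)"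
    then have yz: "y \<in> zp_vec p" by (simp add: zp_haar_sets[OF p0])
    then have y00: "y i 0 = 0" for i using zp_bounds[of "y i" p 0] by (auto simp: zp_vec_def)
    have "\<exists>l. y i l = 0 \<and> y i (Suc l) \<noteq> 0" for i
    proof -
      obtain k where "y \<notin> ?C i k" using y by blast
      then have nz: "y i k \<noteq> 0" using yz y00 by (auto simp: zp_cyl_def split: if_splits)
      define k0 where "k0 = (LEAST k. y i k \<noteq> 0)"
      have "y i k0 \<noteq> 0" unfolding k0_def using nz by (rule LeastI)
      moreover from this obtain l where "k0 = Suc l" using y00 by (cases k0) auto
      moreover have "y i l = 0" using not_less_Least[of l "\<lambda>k. y i k \<noteq> 0"] \<open>k0 = Suc l\<close> by (simp add: k0_def)
      ultimately show ?thesis by blast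
    qed
    then have "\<exists>v. \<forall>i. y i (v i) = 0 \<and> y i (Suc (v i)) \<noteq> 0" by (intro choice) simp
    then show "\<exists>v. y \<in> zp_shell p v" using yz by (auto simp: zp_shell_def)
  qed
qed

lemma zp_shell_disjoint:
  assumes "y \<in> zp_shell p v" "y \<in> zp_shell p v'"
  shows "v = v'"
proof
  fix i
  have *: "y i k = 0" if "y i l = 0" "k \<le> l" for k l
    using zp_mod[of "y i" p k l] assms(1) that by (simp add: zp_shell_def zp_vec_def)
  have "y i (v i) = 0" "y i (Suc (v i)) \<noteq> 0" "y i (v' i) = 0" "y i (Suc (v' i)) \<noteq> 0"
    using assms by (auto simp: zp_shell_def)
  then show "v i = v' i" using *[of "v i" "Suc (v' i)"] *[of "v' i" "Suc (v i)"] by (meson le_antisym not_less_eq_eq)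
qed

text \<open>The integrand is constant on each shell, and the shells cover almost every point. The
  factor in front comes from the nonvanishing leading digits, one for each coordinate.\<close>

theorem igusa_zeta_eq_infsum:
  fixes I :: "('n::finite, int) mpolynomial set"
  assumes p: "prime p" and s: "Re s > 0"
    and I: "I = monomials_ideal M"
    and N: "finite N" "N \<noteq> {}" "N \<subseteq> lookup ` M"
      "\<And>m. m \<in> M \<Longrightarrow> \<exists>n\<in>N. \<forall>i. n i \<le> lookup m i"
  shows "igusa_zeta p I s = of_real ((1 - 1 / real p) ^ CARD('n)) * infsum (lattice_term N (ln (real p)) s) UNIV"
proof -
  let ?H = "zp_haar p :: ('n \<Rightarrow> nat \<Rightarrow> int) measure"
  let ?c = "(1 - 1 / real p) ^ CARD('n)"
  have p1: "p > 1" using p prime_gt_1_nat by blast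
  then have p0: "p > 0" by simp
  define L where "L = ln (real p)"
  have L: "L > 0" using p1 by (simp add: L_def)
  define F where "F y = (case ord_ideal p I y of enat m \<Rightarrow> (1 / of_nat p) powr (s * of_nat m) | \<infinity> \<Rightarrow> 0)" for y
  define t where "t v = exp (- of_real L * (s * of_nat (newton N v)))" for v :: "'n \<Rightarrow> nat"
  have F: "F y = t v" if "y \<in> zp_shell p v" for y v
  proof -
    have "ln (1 / of_nat p :: complex) = - of_real L"
      using p0 Ln_of_real[of "1 / real p"] by (simp add: L_def ln_div)
    then show ?thesis
      using p0 by (simp add: F_def ord_ideal_shell[OF p that I N] t_def powr_def mult.commute)
  qed
  have Fm: "F \<in> borel_measurable ?H"
    unfolding F_def using ord_ideal_measurable[OF p0] by (rule measurable_compose) simp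
  \<comment> \<open>An enumeration of the orders turns the decomposition into shells into a series,
    to which termwise integration applies.\<close>
  define e where "e = from_nat_into (UNIV :: ('n \<Rightarrow> nat) set)"
  have "infinite (UNIV :: ('n \<Rightarrow> nat) set)"
    using infinite_UNIV_nat by (metis finite_fun_UNIVD2)
  then have e: "bij_betw e UNIV UNIV" unfolding e_def by (intro bij_betw_from_nat_into) auto
  define f where "f k y = indicator (zp_shell p (e k)) y *\<^sub>R t (e k)" for k y
  have meas: "measure ?H (zp_shell p v) = ?c * (1 / real p) ^ (\<Sum>i\<in>UNIV. v i)" for v
    using emeasure_zp_shell[OF p0, of v] p1 by (simp add: measure_def)
  have fin: "emeasure ?H (zp_shell p v) < \<infinity>" for v by (simp add: emeasure_zp_shell[OF p0])
  have t: "measure ?H (zp_shell p v) *\<^sub>R t v = of_real ?c * lattice_term N L s v" for v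
  proof -
    have "(1 / real p) ^ (\<Sum>i\<in>UNIV. v i) = exp (of_nat (\<Sum>i\<in>UNIV. v i) * - L)"
      unfolding exp_of_nat_mult using p0 by (simp add: L_def exp_minus inverse_eq_divide)
    then have "complex_of_real ((1 / real p) ^ (\<Sum>i\<in>UNIV. v i)) = exp (of_nat (\<Sum>i\<in>UNIV. v i) * - of_real L)"
      by (simp flip: exp_of_real)
    then show ?thesis
      unfolding meas lattice_term_def t_def scaleR_conv_of_real of_real_mult
      by (simp add: exp_add[symmetric] algebra_simps)
  qed
  have int: "integrable ?H (f k)" for k
    unfolding f_def[abs_def] using fin zp_shell_sets[OF p0] by (intro integrable_scaleR_left integrable_real_indicator) auto
  have intf: "(\<integral>y. f k y \<partial>?H) = of_real ?c * lattice_term N L s (e k)" for k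
  proof -
    have "has_bochner_integral ?H (\<lambda>y. indicator (zp_shell p (e k)) y :: real) (measure ?H (zp_shell p (e k)))"
      using fin zp_shell_sets[OF p0] by (intro has_bochner_integral_real_indicator) auto
    from has_bochner_integral_scaleR_left[OF this, of "t (e k)"]
    show ?thesis unfolding f_def t by (rule has_bochner_integral_integral_eq)
  qed
  have single: "f k y = 0" if "y \<in> zp_shell p v" "e k \<noteq> v" for k y v
    using zp_shell_disjoint[OF that(1), of "e k"] that(2) by (auto simp: f_def indicator_def)
  have zero: "f k y = 0" if "\<nexists>v. y \<in> zp_shell p v" for k y
    using that by (auto simp: f_def indicator_def)
  have sumf: "(\<lambda>k. f k y) sums F y" if "y \<in> zp_shell p v" for y v
  proof -
    obtain k where k: "e k = v" using e by (auto simp: bij_betw_def image_iff) (metis UNIV_I surj_def)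
    have "f l y = 0" if "l \<noteq> k" for l
      using single[OF \<open>y \<in> _\<close>, of l] that k e by (auto simp: bij_betw_def inj_def)
    then have "(\<lambda>k. f k y) sums (\<Sum>l\<in>{k}. f l y)" by (intro sums_finite) auto
    also have "(\<Sum>l\<in>{k}. f l y) = F y" using that k by (simp add: F f_def)
    finally show ?thesis .
  qed
  have summ: "summable (\<lambda>k. norm (f k y))" for y
  proof (cases "\<exists>v. y \<in> zp_shell p v")
    case True
    then obtain v where v: "y \<in> zp_shell p v" by blast
    obtain k where k: "e k = v" using e by (auto simp: bij_betw_def image_iff) (metis UNIV_I surj_def)
    have "norm (f l y) = 0" if "l \<notin> {k}" for l
      using single[OF v, of l] that k e by (auto simp: bij_betw_def inj_def)
    then show ?thesis by (intro summable_finite[of "{k}"]) auto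
  qed (simp add: zero)
  have ls: "(\<lambda>v. norm (lattice_term N L s v)) summable_on UNIV" by (rule lattice_term_summable[OF L s])
  have lsn: "summable (\<lambda>k. norm (lattice_term N L s (e k)))"
  proof -
    have "(\<lambda>k. norm (lattice_term N L s (e k))) summable_on UNIV"
      using ls summable_on_reindex_bij_betw[OF e, of "\<lambda>v. norm (lattice_term N L s v)"] by simp
    then show ?thesis by (rule summable_on_imp_summable)
  qed
  have nint: "(\<integral>y. norm (f k y) \<partial>?H) = norm (of_real ?c * lattice_term N L s (e k))" for k
  proof -
    have "(\<integral>y. norm (f k y) \<partial>?H) = (\<integral>y. indicator (zp_shell p (e k)) y * norm (t (e k)) \<partial>?H)"
      by (simp add: f_def abs_mult indicator_def)
    also have "\<dots> = measure ?H (zp_shell p (e k)) * norm (t (e k))"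
      using zp_shell_sets[OF p0] sets.sets_into_space[OF zp_shell_sets[OF p0], of "e k"]
      by (simp add: Int_absorb2 del: sets.sets_into_space)
    also have "\<dots> = norm (measure ?H (zp_shell p (e k)) *\<^sub>R t (e k))" by simp
    finally show ?thesis by (simp only: t)
  qed
  \<comment> \<open>Absolute convergence of the lattice sum justifies integrating term by
    term.\<close>
  have "(\<lambda>k. \<integral>y. f k y \<partial>?H) sums (\<integral>y. suminf (\<lambda>k. f k y) \<partial>?H)"
  proof (rule sums_integral[OF int])
    show "AE y in ?H. summable (\<lambda>k. norm (f k y))" using summ by simp
    show "summable (\<lambda>k. \<integral>y. norm (f k y) \<partial>?H)"
      unfolding nint norm_mult by (intro summable_mult lsn)
  qed
  also have "(\<integral>y. suminf (\<lambda>k. f k y) \<partial>?H) = (\<integral>y. F y \<partial>?H)"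
  proof (rule integral_cong_AE)
    show "(\<lambda>y. suminf (\<lambda>k. f k y)) \<in> borel_measurable ?H"
      using int by (intro borel_measurable_suminf) auto
    show "AE y in ?H. suminf (\<lambda>k. f k y) = F y"
      using AE_zp_shell[OF p1] by eventually_elim (use sumf sums_unique in fastforce)
  qed (rule Fm)
  also have "\<dots> = igusa_zeta p I s" by (simp add: igusa_zeta_def F_def)
  finally have "(\<lambda>k. of_real ?c * lattice_term N L s (e k)) sums igusa_zeta p I s" by (simp add: intf)
  moreover have "(\<lambda>k. of_real ?c * lattice_term N L s (e k)) sums (of_real ?c * infsum (lattice_term N L s) UNIV)"
  proof (rule sums_mult)
    have "((\<lambda>k. lattice_term N L s (e k)) has_sum infsum (lattice_term N L s) UNIV) UNIV"
      using has_sum_infsum[OF abs_summable_summable[OF ls]] by (simp add: has_sum_reindex_bij_betw[OF e])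
    then show "(\<lambda>k. lattice_term N L s (e k)) sums infsum (lattice_term N L s) UNIV"
      by (rule has_sum_imp_sums)
  qed
  ultimately show ?thesis unfolding L_def by (rule sums_unique2)
qed

text \<open>The equation is given only on a half plane; the identity principle for meromorphic
  functions carries it to a punctured neighbourhood of \<open>s\<close>, where
  \<open>P s \<noteq> 0\<close> would give \<open>Z\<close> a finite limit.\<close>

lemma pole_of_meromorphic_continuation:
  assumes Z: "Z meromorphic_on UNIV" and P: "P holomorphic_on UNIV" and G: "G holomorphic_on UNIV"
    and eq: "\<And>z. 0 < Re z \<Longrightarrow> Z z * P z = G z" and pole: "is_pole Z s"
  shows "P s = 0"
proof (rule ccontr)
  assume Ps: "P s \<noteq> 0"
  let ?f = "\<lambda>z. Z z * P z - G z"
  have P': "P meromorphic_on UNIV" and G': "G meromorphic_on UNIV"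
    using P G by (auto intro: analytic_on_imp_meromorphic_on simp: analytic_on_open)
  have mero: "?f meromorphic_on UNIV" by (intro meromorphic_intros Z P' G')
  have "eventually (\<lambda>z. ?f z = 0) (cosparse UNIV) \<or> eventually (\<lambda>z. ?f z \<noteq> 0) (cosparse UNIV)"
    by (rule meromorphic_imp_constant_or_avoid[OF mero]) auto
  moreover have "\<not> eventually (\<lambda>z. ?f z \<noteq> 0) (cosparse UNIV)"
  proof
    assume "eventually (\<lambda>z. ?f z \<noteq> 0) (cosparse UNIV)"
    then have "eventually (\<lambda>z. ?f z \<noteq> 0) (at 1)" by (simp add: eventually_cosparse_open_eq)
    moreover have "eventually (\<lambda>z. z \<in> {z. 0 < Re z}) (at 1)"
      by (intro eventually_at_in_open') (auto simp: open_halfspace_Re_gt)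
    ultimately have "eventually (\<lambda>z::complex. False) (at 1)"
      by eventually_elim (use eq in auto)
    then show False by simp
  qed
  ultimately have "eventually (\<lambda>z. ?f z = 0) (cosparse UNIV)" by blast
  then have "eventually (\<lambda>z. ?f z = 0) (at s)" by (simp add: eventually_cosparse_open_eq)
  moreover have cont: "isCont P s" "isCont G s"
    using holomorphic_on_imp_continuous_on[OF P] holomorphic_on_imp_continuous_on[OF G]
    by (simp_all add: continuous_on_eq_continuous_at)
  then have "eventually (\<lambda>z. P z \<noteq> 0) (at s)"
    using Ps by (simp add: isCont_def tendsto_imp_eventually_ne)
  ultimately have "eventually (\<lambda>z. Z z = G z / P z) (at s)"
    by eventually_elim (simp add: field_simps)
  moreover have "((\<lambda>z. G z / P z) \<longlongrightarrow> G s / P s) (at s)"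
    using cont Ps by (intro tendsto_divide) (auto simp: isCont_def)
  ultimately have "(Z \<longlongrightarrow> G s / P s) (at s)" by (simp add: tendsto_cong)
  then show False using pole not_tendsto_and_filterlim_at_infinity[of "at s" Z] by (auto simp: is_pole_def)
qed

section \<open>Integral closure and discrete valuations\<close>

lemma subring_closed:
  assumes "is_subring A"
  shows "1 \<in> A" "0 \<in> A" "a \<in> A \<Longrightarrow> b \<in> A \<Longrightarrow> a - b \<in> A" "a \<in> A \<Longrightarrow> b \<in> A \<Longrightarrow> a * b \<in> A"
    "a \<in> A \<Longrightarrow> - a \<in> A" "a \<in> A \<Longrightarrow> b \<in> A \<Longrightarrow> a + b \<in> A"
proof -
  show 1: "1 \<in> A" and diff: "\<And>a b. a \<in> A \<Longrightarrow> b \<in> A \<Longrightarrow> a - b \<in> A" and "a \<in> A \<Longrightarrow> b \<in> A \<Longrightarrow> a * b \<in> A"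
    using assms unfolding is_subring_def by blast+
  show 0: "0 \<in> A" using diff[OF 1 1] by simp
  show minus: "- a \<in> A" if "a \<in> A" for a using diff[OF 0 that] by simp
  show "a \<in> A \<Longrightarrow> b \<in> A \<Longrightarrow> a + b \<in> A" using diff[of a "- b"] minus by simp
qed

lemma subring_sum:
  assumes "is_subring A" "\<And>x. x \<in> S \<Longrightarrow> f x \<in> A"
  shows "sum f S \<in> A"
  using assms(2) by (induction S rule: infinite_finite_induct) (auto intro: subring_closed[OF assms(1)])

lemma subring_prod:
  assumes "is_subring A" "\<And>x. x \<in> S \<Longrightarrow> f x \<in> A"
  shows "prod f S \<in> A"
  using assms(2) by (induction S rule: infinite_finite_induct) (auto intro: subring_closed[OF assms(1)])

lemma subring_power: "is_subring A \<Longrightarrow> a \<in> A \<Longrightarrow> a ^ n \<in> A"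
  by (induction n) (auto intro: subring_closed)

lemma coeff_mult_top:
  fixes p q :: "'a::comm_semiring_0 poly"
  assumes "degree p \<le> d" "degree q \<le> e"
  shows "coeff (p * q) (d + e) = coeff p d * coeff q e"
proof -
  have "coeff p i * coeff q (d + e - i) = 0" if "i \<noteq> d" "i \<le> d + e" for i
    using that assms by (cases "i < d") (auto simp: coeff_eq_0)
  then have "(\<Sum>i\<le>d + e. coeff p i * coeff q (d + e - i)) = (\<Sum>i\<in>{d}. coeff p i * coeff q (d + e - i))"
    by (intro sum.mono_neutral_right) auto
  then show ?thesis by (simp add: coeff_mult)
qed

text \<open>Gaussian elimination without division: cross multiplication keeps the diagonal monic of a
  common degree that exceeds all degrees off the diagonal.\<close>

lemma integral_of_monic_diagonal:
  fixes z :: "'a::field" and m :: "'i \<Rightarrow> 'a"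
  assumes A: "is_subring A" and "finite F" "i0 \<in> F" "m i0 \<noteq> 0"
    and "\<And>i j k. i \<in> F \<Longrightarrow> j \<in> F \<Longrightarrow> coeff (P i j) k \<in> A"
    and "\<And>i j. i \<in> F \<Longrightarrow> j \<in> F \<Longrightarrow> degree (P i j) \<le> d \<and> coeff (P i j) d = (if i = j then 1 else 0)"
    and "\<And>i. i \<in> F \<Longrightarrow> (\<Sum>j\<in>F. poly (P i j) z * m j) = 0"
  shows "z \<in> integral_closure A"
  using assms(2-)
proof (induction "card F" arbitrary: F P d rule: less_induct)
  case less
  show ?case
  proof (cases "F = {i0}")
    case True
    have "degree (P i0 i0) = d" using less.prems(5)[of i0 i0] less.prems(2) le_degree[of "P i0 i0" d] by auto
    moreover have "poly (P i0 i0) z = 0" using less.prems(3) less.prems(6)[of i0] True by simp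
    ultimately show ?thesis
      using less.prems(2,4,5) by (auto simp: integral_closure_def intro!: exI[of _ "P i0 i0"])
  next
    case False
    \<comment> \<open>The index \<open>i0\<close> is never eliminated: the last equation is a monic
      polynomial at \<open>z\<close> times \<open>m i0\<close>, and the nonzero \<open>m i0\<close>
      cancels.\<close>
    then obtain r where r: "r \<in> F" "r \<noteq> i0" using less.prems(2) by blast
    define Q where "Q i j = P r r * P i j - P i r * P r j" for i j
    show ?thesis
    proof (rule less.hyps[of "F - {r}" Q "d + d"])
      show "card (F - {r}) < card F" using r less.prems(1) by (intro psubset_card_mono) auto
      fix i j k assume ij: "i \<in> F - {r}" "j \<in> F - {r}"
      have "coeff (p * q) k \<in> A" if "\<And>k. coeff p k \<in> A" "\<And>k. coeff q k \<in> A" for p q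
        unfolding coeff_mult by (intro subring_sum[OF A] subring_closed[OF A] that)
      then show "coeff (Q i j) k \<in> A"
        using ij r less.prems(4) unfolding Q_def coeff_diff by (intro subring_closed[OF A]) auto
    next
      fix i j assume ij: "i \<in> F - {r}" "j \<in> F - {r}"
      have deg: "degree (P a b) \<le> d" "coeff (P a b) d = (if a = b then 1 else 0)" if "a \<in> F" "b \<in> F" for a b
        using less.prems(5) that by blast+
      have "degree (p * q) \<le> d + d" if "degree p \<le> d" "degree q \<le> d" for p q :: "'a poly"
        using degree_mult_le[of p q] that by linarith
      then have "degree (Q i j) \<le> d + d"
        unfolding Q_def using ij r deg by (intro degree_diff_le) auto
      moreover have "coeff (Q i j) (d + d) = (if i = j then 1 else 0)"
        unfolding Q_def coeff_diff using ij r deg by (simp add: coeff_mult_top)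
      ultimately show "degree (Q i j) \<le> d + d \<and> coeff (Q i j) (d + d) = (if i = j then 1 else 0)" ..
    next
      fix i assume i: "i \<in> F - {r}"
      let ?S = "\<lambda>i. \<Sum>j\<in>F - {r}. poly (P i j) z * m j"
      have *: "?S i = - poly (P i r) z * m r" if "i \<in> F" for i
        using less.prems(6)[OF that] sum.remove[OF less.prems(1) r(1), of "\<lambda>j. poly (P i j) z * m j"]
        by (simp add: eq_neg_iff_add_eq_0 add.commute)
      have "(\<Sum>j\<in>F - {r}. poly (Q i j) z * m j) = poly (P r r) z * ?S i - poly (P i r) z * ?S r"
        by (simp add: Q_def sum_distrib_left left_diff_distrib sum_subtractf mult.assoc)
      also have "\<dots> = 0" using *[of i] *[of r] i r by (simp add: algebra_simps)
      finally show "(\<Sum>j\<in>F - {r}. poly (Q i j) z * m j) = 0" .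
    qed (use less.prems r in auto)
  qed
qed

section \<open>Integrality through finitely generated modules\<close>

definition module_span :: "'a::comm_ring_1 set \<Rightarrow> 'i set \<Rightarrow> ('i \<Rightarrow> 'a) \<Rightarrow> 'a set" where
  "module_span A F m = {\<Sum>j\<in>F. b j * m j | b. \<forall>j. b j \<in> A}"

lemma module_span_closed:
  assumes A: "is_subring A" and F: "finite F"
  shows "a \<in> module_span A F m \<Longrightarrow> b \<in> module_span A F m \<Longrightarrow> a - b \<in> module_span A F m"
    and "a \<in> module_span A F m \<Longrightarrow> b \<in> module_span A F m \<Longrightarrow> a + b \<in> module_span A F m"
    and "r \<in> A \<Longrightarrow> a \<in> module_span A F m \<Longrightarrow> r * a \<in> module_span A F m"
    and "i \<in> F \<Longrightarrow> m i \<in> module_span A F m"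
    and "0 \<in> module_span A F m"
proof -
  { assume "a \<in> module_span A F m" "b \<in> module_span A F m"
    then obtain c d where "a = (\<Sum>j\<in>F. c j * m j)" "b = (\<Sum>j\<in>F. d j * m j)" "\<forall>j. c j \<in> A" "\<forall>j. d j \<in> A"
      unfolding module_span_def by blast
    then have "a - b = (\<Sum>j\<in>F. (c j - d j) * m j)" "a + b = (\<Sum>j\<in>F. (c j + d j) * m j)"
      and "\<forall>j. c j - d j \<in> A" "\<forall>j. c j + d j \<in> A"
      by (auto simp: left_diff_distrib distrib_right sum_subtractf sum.distrib intro: subring_closed[OF A])
    then show "a - b \<in> module_span A F m" "a + b \<in> module_span A F m"
      unfolding module_span_def mem_Collect_eq by (metis (no_types))+ }
  { assume "r \<in> A" "a \<in> module_span A F m"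
    then obtain c where "a = (\<Sum>j\<in>F. c j * m j)" "\<forall>j. c j \<in> A" unfolding module_span_def by blast
    then show "r * a \<in> module_span A F m"
      unfolding module_span_def using \<open>r \<in> A\<close>
      by (auto simp: sum_distrib_left mult.assoc intro!: exI[of _ "\<lambda>j. r * c j"] subring_closed[OF A]) }
  { assume "i \<in> F"
    then have "(\<Sum>j\<in>F. (if j = i then 1 else 0) * m j) = (\<Sum>j\<in>F. if j = i then m j else 0)"
      by (intro sum.cong) auto
    also have "\<dots> = m i" using \<open>i \<in> F\<close> F by simp
    finally show "m i \<in> module_span A F m"
      unfolding module_span_def
      by (auto intro!: exI[of _ "\<lambda>j. if j = i then 1 else 0"] subring_closed[OF A]) }
  show "0 \<in> module_span A F m"
    unfolding module_span_def by (auto intro!: exI[of _ "\<lambda>_. 0"] subring_closed[OF A])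
qed

lemma module_span_sum:
  assumes "is_subring A" "finite F" "\<And>k. k \<in> S \<Longrightarrow> f k \<in> module_span A F m"
  shows "sum f S \<in> module_span A F m"
  using assms(3) by (induction S rule: infinite_finite_induct) (auto intro: module_span_closed[OF assms(1,2)])

text \<open>The determinant trick: \<open>z\<close> acts on the generators by a matrix over
  \<open>A\<close>, and \<open>z\<close> times the identity minus this matrix has monic linear
  polynomials on the diagonal and constants off it.\<close>

lemma integral_of_finite_module:
  fixes z :: "'a::field"
  assumes A: "is_subring A" and F: "finite F" "i0 \<in> F" "m i0 \<noteq> 0"
    and stable: "\<And>i. i \<in> F \<Longrightarrow> z * m i \<in> module_span A F m"
  shows "z \<in> integral_closure A"
proof -
  have "\<forall>i\<in>F. \<exists>b. (\<forall>j. b j \<in> A) \<and> z * m i = (\<Sum>j\<in>F. b j * m j)"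
    using stable unfolding module_span_def by blast
  from bchoice[OF this] obtain b where b: "\<forall>i\<in>F. (\<forall>j. b i j \<in> A) \<and> z * m i = (\<Sum>j\<in>F. b i j * m j)" ..
  let ?P = "\<lambda>i j. if i = j then [:- b i j, 1:] else [:- b i j:]"
  show ?thesis
  proof (rule integral_of_monic_diagonal[where P = ?P and d = 1 and m = m and F = F, OF A F])
    fix i j k assume "i \<in> F" "j \<in> F"
    then show "coeff (?P i j) k \<in> A"
      using b by (auto simp: coeff_pCons intro: subring_closed[OF A] split: nat.split)
  next
    fix i assume i: "i \<in> F"
    have "(\<Sum>j\<in>F. poly (?P i j) z * m j) = (\<Sum>j\<in>F. (if i = j then z * m j else 0) - b i j * m j)"
      by (intro sum.cong) (auto simp: algebra_simps)
    also have "\<dots> = z * m i - (\<Sum>j\<in>F. b i j * m j)" using i F by (simp add: sum_subtractf)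
    finally show "(\<Sum>j\<in>F. poly (?P i j) z * m j) = 0" using b i by simp
  qed auto
qed

lemma module_span_stable:
  assumes A: "is_subring A" "finite F" and "\<And>i. i \<in> F \<Longrightarrow> x * m i \<in> module_span A F m"
    and "a \<in> module_span A F m"
  shows "x * a \<in> module_span A F m"
proof -
  obtain b where b: "a = (\<Sum>j\<in>F. b j * m j)" "\<forall>j. b j \<in> A" using assms(4) unfolding module_span_def by blast
  have "x * a = (\<Sum>j\<in>F. b j * (x * m j))" by (simp add: b(1) sum_distrib_left mult_ac)
  also have "\<dots> \<in> module_span A F m"
    by (rule module_span_sum[OF A], rule module_span_closed(3)[OF A]) (use b(2) assms(3) in auto)
  finally show ?thesis .
qed

lemma integral_equation:
  assumes "x \<in> integral_closure A" "is_subring A"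
  obtains d c where "0 < d" "\<And>k. c k \<in> A" "x ^ d = (\<Sum>k<d. c k * x ^ k)"
proof -
  obtain q where q: "lead_coeff q = 1" "\<And>i. coeff q i \<in> A" "poly q x = 0"
    using assms(1) unfolding integral_closure_def by blast
  have "degree q \<noteq> 0"
  proof
    assume "degree q = 0"
    then have "q = [:1:]" using q(1) by (metis degree_eq_zeroE lead_coeff_pCons(2))
    then show False using q(3) by simp
  qed
  moreover have "poly q x = (\<Sum>k<degree q. coeff q k * x ^ k) + x ^ degree q"
    using q(1) by (simp add: poly_altdef lessThan_Suc_atMost[symmetric])
  then have "x ^ degree q = (\<Sum>k<degree q. - coeff q k * x ^ k)"
    using q(3) by (simp add: sum_negf eq_neg_iff_add_eq_0 add.commute)
  ultimately show thesis using that[of "degree q" "\<lambda>k. - coeff q k"] q(2) subring_closed(5)[OF assms(2)] by blast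
qed

lemma subset_integral_closure:
  assumes "is_subring A"
  shows "A \<subseteq> integral_closure A"
proof
  fix a assume "a \<in> A"
  then show "a \<in> integral_closure A"
    unfolding integral_closure_def using subring_closed[OF assms]
    by (auto intro!: exI[of _ "[:- a, 1:]"] simp: coeff_pCons split: nat.split)
qed

text \<open>If x and y satisfy monic equations of degrees d and e, the products x^i y^j with i < d
  and j < e span a module that is stable under x and y, hence under x - y and x y.\<close>

theorem integral_closure_subring:
  fixes A :: "'a::field set"
  assumes A: "is_subring A"
  shows "is_subring (integral_closure A)"
  unfolding is_subring_def
proof (intro conjI ballI)
  show "1 \<in> integral_closure A" using subset_integral_closure[OF A] subring_closed(1)[OF A] by blast
  fix x y assume "x \<in> integral_closure A" "y \<in> integral_closure A"
  obtain d a where x: "0 < d" "\<And>k. a k \<in> A" "x ^ d = (\<Sum>k<d. a k * x ^ k)"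
    using integral_equation[OF \<open>x \<in> _\<close> A] by blast
  obtain e b where y: "0 < e" "\<And>k. b k \<in> A" "y ^ e = (\<Sum>k<e. b k * y ^ k)"
    using integral_equation[OF \<open>y \<in> _\<close> A] by blast
  define F where "F = {..<d} \<times> {..<e}"
  define m where "m = (\<lambda>(i, j). x ^ i * y ^ j)"
  let ?V = "module_span A F m"
  have F: "finite F" "(0, 0) \<in> F" "m (0, 0) \<noteq> 0" using x(1) y(1) by (auto simp: F_def m_def)
  have mV: "x ^ i * y ^ j \<in> ?V" if "i < d" "j < e" for i j
    using module_span_closed(4)[OF A F(1), of "(i, j)" m] that by (simp add: F_def m_def)
  have xV: "x * m i \<in> ?V" if i: "i \<in> F" for i
  proof -
    obtain k l where kl: "i = (k, l)" "k < d" "l < e" using i by (auto simp: F_def)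
    show ?thesis
    proof (cases "Suc k = d")
      case True
      have "x * m i = x ^ d * y ^ l" by (simp add: kl m_def flip: True)
      also have "\<dots> = (\<Sum>k<d. a k * (x ^ k * y ^ l))" by (simp add: x(3) sum_distrib_right mult.assoc)
      also have "\<dots> \<in> ?V" 
        by (rule module_span_sum[OF A F(1)], rule module_span_closed(3)[OF A F(1)]) (use kl x(2) mV in auto)
      finally show ?thesis .
    next
      case False
      then have "x ^ Suc k * y ^ l \<in> ?V" using kl by (intro mV) auto
      then show ?thesis by (simp add: kl m_def mult.assoc)
    qed
  qed
  have yV: "y * m i \<in> ?V" if i: "i \<in> F" for i
  proof -
    obtain k l where kl: "i = (k, l)" "k < d" "l < e" using i by (auto simp: F_def)
    show ?thesis
    proof (cases "Suc l = e")
      case True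
      have "y * m i = x ^ k * y ^ e" by (simp add: kl m_def mult_ac flip: True)
      also have "\<dots> = (\<Sum>l<e. b l * (x ^ k * y ^ l))" by (simp add: y(3) sum_distrib_left mult_ac)
      also have "\<dots> \<in> ?V" 
        by (rule module_span_sum[OF A F(1)], rule module_span_closed(3)[OF A F(1)]) (use kl y(2) mV in auto)
      finally show ?thesis .
    next
      case False
      then have "x ^ k * y ^ Suc l \<in> ?V" using kl by (intro mV) auto
      then show ?thesis by (simp add: kl m_def mult_ac)
    qed
  qed
  show "x - y \<in> integral_closure A"
    by (rule integral_of_finite_module[where m = m, OF A F])
       (auto simp: left_diff_distrib intro: module_span_closed[OF A F(1)] xV yV)
  show "x * y \<in> integral_closure A"
    by (rule integral_of_finite_module[where m = m, OF A F])
       (auto simp: mult.assoc intro: module_span_stable[OF A F(1) xV] yV)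
qed

section \<open>Valuations, their rings, and their centers on a subring\<close>

locale field_valuation =
  fixes v :: "'a::field \<Rightarrow> int"
  assumes v_mult: "x \<noteq> 0 \<Longrightarrow> y \<noteq> 0 \<Longrightarrow> v (x * y) = v x + v y"
    and v_add: "x \<noteq> 0 \<Longrightarrow> y \<noteq> 0 \<Longrightarrow> x + y \<noteq> 0 \<Longrightarrow> min (v x) (v y) \<le> v (x + y)"
begin

definition vge :: "int \<Rightarrow> 'a set" where
  "vge k = {z. z = 0 \<or> k \<le> v z}"

lemma v_one [simp]: "v 1 = 0"
  using v_mult[of 1 1] by simp

lemma v_minus [simp]: "v (- x) = v x"
proof (cases "x = 0")
  case False
  have "v (- 1) = 0" using v_mult[of "- 1" "- 1"] by simp
  then show ?thesis using v_mult[of "- 1" x] False by simp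
qed simp

lemma v_inverse: "x \<noteq> 0 \<Longrightarrow> v (inverse x) = - v x"
  using v_mult[of x "inverse x"] by simp

lemma v_divide: "x \<noteq> 0 \<Longrightarrow> y \<noteq> 0 \<Longrightarrow> v (x / y) = v x - v y"
  by (simp add: divide_inverse v_mult v_inverse)

lemma v_power: "x \<noteq> 0 \<Longrightarrow> v (x ^ n) = int n * v x"
  by (induction n) (auto simp: v_mult algebra_simps)

lemma v_powi: "x \<noteq> 0 \<Longrightarrow> v (x powi n) = n * v x"
  by (auto simp: power_int_def v_power v_inverse)

lemma v_prod: "(\<And>i. i \<in> S \<Longrightarrow> f i \<noteq> 0) \<Longrightarrow> v (prod f S) = (\<Sum>i\<in>S. v (f i))"
  by (induction S rule: infinite_finite_induct) (auto simp: v_mult)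

lemma vge_zero [simp]: "0 \<in> vge k"
  by (simp add: vge_def)

lemma vge_iff: "x \<noteq> 0 \<Longrightarrow> x \<in> vge k \<longleftrightarrow> k \<le> v x"
  by (simp add: vge_def)

lemma vge_add:
  assumes "x \<in> vge k" "y \<in> vge k"
  shows "x + y \<in> vge k"
proof -
  consider "x = 0" | "y = 0" | "x + y = 0" | "x \<noteq> 0" "y \<noteq> 0" "x + y \<noteq> 0" by blast
  then show ?thesis
  proof cases
    case 4
    then show ?thesis using v_add[of x y] assms by (simp add: vge_iff)
  qed (use assms in simp_all)
qed

lemma vge_uminus: "x \<in> vge k \<Longrightarrow> - x \<in> vge k"
  by (auto simp: vge_def)

lemma vge_diff: "x \<in> vge k \<Longrightarrow> y \<in> vge k \<Longrightarrow> x - y \<in> vge k"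
  using vge_add[of x k "- y"] vge_uminus by simp

lemma vge_mult: "x \<in> vge k \<Longrightarrow> y \<in> vge l \<Longrightarrow> x * y \<in> vge (k + l)"
  by (cases "x = 0 \<or> y = 0") (auto simp: vge_iff v_mult)

lemma vge_sum: "(\<And>i. i \<in> S \<Longrightarrow> f i \<in> vge k) \<Longrightarrow> sum f S \<in> vge k"
  by (induction S rule: infinite_finite_induct) (auto intro: vge_add)

lemma vge_mono: "k \<le> l \<Longrightarrow> vge l \<subseteq> vge k"
  by (auto simp: vge_def)

lemma vge_subring: "is_subring (vge 0)"
  unfolding is_subring_def using vge_mult[of _ 0 _ 0] by (auto simp: vge_iff intro: vge_diff)

lemma principal_eq_vge:
  assumes "g \<noteq> 0"
  shows "(\<lambda>x. g * x) ` vge 0 = vge (v g)"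
proof (intro equalityI subsetI)
  fix z assume "z \<in> vge (v g)"
  then have "z / g \<in> vge 0" using assms by (cases "z = 0") (auto simp: vge_iff v_divide)
  then show "z \<in> (\<lambda>x. g * x) ` vge 0" using assms by (intro image_eqI[of _ _ "z / g"]) auto
qed (use vge_mult[of g "v g" _ 0] assms in \<open>auto simp: vge_iff\<close>)

end

locale discrete_valuation = field_valuation +
  assumes v_surj: "\<exists>t. t \<noteq> 0 \<and> v t = 1"
begin

lemma ex_v_eq: "\<exists>z. z \<noteq> 0 \<and> v z = k"
proof -
  obtain t where "t \<noteq> 0" "v t = 1" using v_surj by blast
  then show ?thesis by (intro exI[of _ "t powi k"]) (simp add: v_powi)
qed

lemma vge_inject:
  assumes "vge k = vge l"
  shows "k = l"
proof -
  obtain x y where x: "x \<noteq> 0" "v x = k" and y: "y \<noteq> 0" "v y = l" using ex_v_eq by meson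
  have "x \<in> vge k" "y \<in> vge l" using x y by (simp_all add: vge_iff)
  then have "x \<in> vge l" "y \<in> vge k" using assms by simp_all
  then show ?thesis using x y by (simp add: vge_iff)
qed

lemma unit_along_iff: "unit_along (vge 0) u \<longleftrightarrow> u \<noteq> 0 \<and> v u = 0"
  unfolding unit_along_def by (auto simp: vge_iff v_inverse)

lemma uniformizer_iff: "uniformizer (vge 0) t \<longleftrightarrow> t \<noteq> 0 \<and> v t = 1"
proof -
  have "{x\<in>vge 0. \<not> unit_along (vge 0) x} = vge 1"
    unfolding unit_along_iff by (auto simp: vge_def)
  then have "uniformizer (vge 0) t \<longleftrightarrow> t \<noteq> 0 \<and> vge 1 = (\<lambda>x. t * x) ` vge 0"
    by (simp only: uniformizer_def)
  then show ?thesis using principal_eq_vge[of t] vge_inject[of 1 "v t"] by metis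
qed

text \<open>All uniformizers have value 1 and all units value 0, which forces the exponent in the
  definite description.\<close>

lemma order_along_eq:
  assumes "z \<noteq> 0"
  shows "order_along (vge 0) z = v z"
  unfolding order_along_def
proof (rule the_equality)
  obtain t where t: "t \<noteq> 0" "v t = 1" using v_surj by blast
  have "z = z / t powi v z * t powi v z" using t by simp
  moreover have "v (z / t powi v z) = 0" using assms t by (simp add: v_divide v_powi)
  ultimately show "\<exists>t u. uniformizer (vge 0) t \<and> unit_along (vge 0) u \<and> z = u * t powi v z"
    using t assms unfolding uniformizer_iff unit_along_iff
    by (intro exI[of _ t] exI[of _ "z / t powi v z"]) simp
qed (auto simp: uniformizer_iff unit_along_iff v_mult v_powi)

text \<open>Valuation rings are integrally closed: an element of negative value would make the top
  power in a monic equation strictly smaller in value than every other term.\<close>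

lemma integral_closure_subset:
  assumes "is_subring A" "A \<subseteq> vge 0"
  shows "integral_closure A \<subseteq> vge 0"
proof
  fix z assume z: "z \<in> integral_closure A"
  obtain d c where dc: "0 < d" "\<And>k. c k \<in> A" "z ^ d = (\<Sum>k<d. c k * z ^ k)"
    using integral_equation[OF z assms(1)] by blast
  show "z \<in> vge 0"
  proof (rule ccontr)
    assume "z \<notin> vge 0"
    then have nz: "z \<noteq> 0" "v z < 0" by (auto simp: vge_def)
    have "c k * z ^ k \<in> vge (int d * v z + 1)" if "k < d" for k
    proof -
      have "z ^ k \<in> vge (int k * v z)" using nz by (simp add: vge_iff v_power)
      then have "c k * z ^ k \<in> vge (0 + int k * v z)" using dc(2) assms(2) by (intro vge_mult) auto
      moreover have "int d * v z + 1 \<le> int k * v z"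
      proof -
        have "(int d - int k) * v z \<le> 1 * v z"
          using that nz by (intro mult_right_mono_neg) auto
        then show ?thesis using nz by (simp add: algebra_simps)
      qed
      ultimately show ?thesis using vge_mono by (metis add_0 subsetD)
    qed
    then have "z ^ d \<in> vge (int d * v z + 1)" unfolding dc(3) by (intro vge_sum) auto
    then show False using nz by (simp add: vge_iff v_power)
  qed
qed

lemma ideal_gen_eq_vge:
  assumes "S \<subseteq> vge k" "g \<in> S" "g \<noteq> 0" "v g = k"
  shows "ideal_gen (vge 0) S = vge k"
proof (intro equalityI subsetI)
  fix z assume "z \<in> ideal_gen (vge 0) S"
  then obtain T r where "z = (\<Sum>a\<in>T. r a * a)" "T \<subseteq> S" "r ` T \<subseteq> vge 0"
    unfolding ideal_gen_def by blast
  moreover have "r a * a \<in> vge k" if "r a \<in> vge 0" "a \<in> vge k" for a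
    using vge_mult[OF that] by simp
  ultimately show "z \<in> vge k" using assms(1) by (auto intro!: vge_sum)
next
  fix z assume "z \<in> vge k"
  then obtain x where x: "x \<in> vge 0" "z = g * x" using principal_eq_vge[OF assms(3)] assms(4) by auto
  then show "z \<in> ideal_gen (vge 0) S"
    unfolding ideal_gen_def using assms(2)
    by (auto intro!: exI[of _ "{g}"] exI[of _ "\<lambda>_. x"] simp: mult.commute)
qed

context
  fixes A :: "'a set"
  assumes A: "is_subring A" "A \<subseteq> vge 0"
    and fractions: "\<And>z. z \<in> vge 0 \<Longrightarrow> \<exists>a\<in>A. \<exists>b\<in>A. b \<noteq> 0 \<and> v b = 0 \<and> z = a / b"
begin

lemma center_prime: "prime_ideal_of A (A \<inter> vge 1)"
  unfolding prime_ideal_of_def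
proof (intro conjI ballI impI)
  show "ideal_gen A (A \<inter> vge 1) = A \<inter> vge 1"
  proof (intro equalityI subsetI)
    fix z assume "z \<in> ideal_gen A (A \<inter> vge 1)"
    then obtain T r where z: "z = (\<Sum>a\<in>T. r a * a)" "T \<subseteq> A \<inter> vge 1" "r ` T \<subseteq> A"
      unfolding ideal_gen_def by blast
    have "r a * a \<in> vge 1" if "a \<in> T" for a
      using vge_mult[of "r a" 0 a 1] z A(2) that by auto
    then have "z \<in> vge 1" unfolding z by (rule vge_sum)
    moreover have "z \<in> A" unfolding z using z(2,3) by (intro subring_sum[OF A(1)] subring_closed[OF A(1)]) auto
    ultimately show "z \<in> A \<inter> vge 1" by simp
  next
    fix z assume "z \<in> A \<inter> vge 1"
    then show "z \<in> ideal_gen A (A \<inter> vge 1)"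
      unfolding ideal_gen_def using subring_closed(1)[OF A(1)]
      by (auto intro!: exI[of _ "{z}"] exI[of _ "\<lambda>_. 1"])
  qed
  show "1 \<notin> A \<inter> vge 1" by (simp add: vge_iff)
  fix a b assume ab: "a \<in> A" "b \<in> A" "a * b \<in> A \<inter> vge 1"
  show "a \<in> A \<inter> vge 1 \<or> b \<in> A \<inter> vge 1"
  proof (cases "a = 0 \<or> b = 0")
    case False
    moreover have "a \<in> vge 0" "b \<in> vge 0" using ab A(2) by auto
    ultimately show ?thesis using ab by (simp add: vge_iff v_mult) linarith
  qed (use ab in auto)
qed auto

lemma localization_at_center: "localization_at A (A \<inter> vge 1) = vge 0"
proof (intro equalityI subsetI)
  fix z assume "z \<in> localization_at A (A \<inter> vge 1)"
  then obtain a b where ab: "z = a / b" "a \<in> A" "b \<in> A" "b \<notin> vge 1"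
    unfolding localization_at_def by blast
  have "a \<in> vge 0" "b \<in> vge 0" "b \<noteq> 0" using ab A(2) by auto
  then show "z \<in> vge 0" using ab by (cases "a = 0") (auto simp: vge_iff v_divide)
next
  fix z assume "z \<in> vge 0"
  from fractions[OF this] obtain a b where "a \<in> A" "b \<in> A" "b \<noteq> 0" "v b = 0" "z = a / b" by blast
  then show "z \<in> localization_at A (A \<inter> vge 1)"
    unfolding localization_at_def by (fastforce simp: vge_iff)
qed

text \<open>Since values are integers, a nonzero element \<open>q\<close> of a smaller prime divides
  a power of every element of the center, up to a factor of value 0, and such a factor lies outside
  the prime.\<close>

lemma height_one_center:
  assumes "A \<inter> vge 1 \<noteq> {0}"
  shows "height_one_prime A (A \<inter> vge 1)"
  unfolding height_one_prime_def
proof (intro conjI allI impI)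
  fix Q assume Q: "prime_ideal_of A Q \<and> Q \<subseteq> A \<inter> vge 1"
  then have gen: "ideal_gen A Q = Q" and 1: "1 \<notin> Q"
    and prime: "\<And>a b. a \<in> A \<Longrightarrow> b \<in> A \<Longrightarrow> a * b \<in> Q \<Longrightarrow> a \<in> Q \<or> b \<in> Q"
    unfolding prime_ideal_of_def by blast+
  have "0 \<in> ideal_gen A Q"
    unfolding ideal_gen_def by (auto intro!: exI[of _ "{}"])
  then have 0: "0 \<in> Q" by (simp only: gen)
  have ideal: "r * q \<in> Q" if "r \<in> A" "q \<in> Q" for r q
  proof -
    have "r * q \<in> ideal_gen A Q"
      unfolding ideal_gen_def using that by (auto intro!: exI[of _ "{q}"] exI[of _ "\<lambda>_. r"])
    then show ?thesis by (simp only: gen)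
  qed
  show "Q = {0} \<or> Q = A \<inter> vge 1"
  proof (cases "Q = {0}")
    case False
    then obtain q where q: "q \<in> Q" "q \<noteq> 0" using 0 by blast
    have "a \<in> Q" if a: "a \<in> A \<inter> vge 1" for a
    proof (cases "a = 0")
      case False
      \<comment> \<open>\<open>v a\<close> is at least 1, so the exponent \<open>v q\<close> makes
        \<open>a ^ n\<close> divisible by \<open>q\<close> in the valuation ring.\<close>
      define n where "n = nat (v q)"
      have "v q \<ge> 1" using q Q by (auto simp: vge_iff)
      then have "v q \<le> int n * v a" using a False by (simp add: n_def vge_iff mult_le_cancel_left1)
      then have "a ^ n / q \<in> vge 0" using False q by (simp add: vge_iff v_divide v_power)
      from fractions[OF this] obtain b c where bc: "b \<in> A" "c \<in> A" "c \<noteq> 0" "v c = 0" "a ^ n / q = b / c" by blast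
      have "c * a ^ n = b * q" using bc q by (simp add: field_simps)
      then have "c * a ^ n \<in> Q" using ideal[OF bc(1) q(1)] by simp
      moreover have "c \<notin> Q" using bc Q by (auto simp: vge_iff)
      ultimately have "a ^ n \<in> Q" using prime[of c "a ^ n"] bc(2) a subring_power[OF A(1)] by blast
      then show "a \<in> Q"
      proof (induction n)
        case (Suc n)
        then show ?case using prime[of a "a ^ n"] a subring_power[OF A(1)] by auto
      qed (use 1 in simp)
    qed (use 0 in simp)
    then show ?thesis using Q by blast
  qed simp
qed (use center_prime assms in auto)

end

end

text \<open>Duality for finite-dimensional spaces, used to express exponents through the monomials
  of a facet. In the induction, a vector \<open>e\<close> that annihilates \<open>T\<close> but not
  \<open>t\<close> determines the coefficient of \<open>t\<close>.\<close>

lemma span_of_annihilator: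
  fixes q :: "'n::finite \<Rightarrow> 'a::field"
  assumes "finite T"
    and "\<And>d. (\<And>t. t \<in> T \<Longrightarrow> (\<Sum>i\<in>UNIV. t i * d i) = 0) \<Longrightarrow> (\<Sum>i\<in>UNIV. q i * d i) = 0"
  shows "\<exists>c. \<forall>i. q i = (\<Sum>t\<in>T. c t * t i)"
  using assms
proof (induction T arbitrary: q rule: finite_induct)
  case empty
  have "q i = 0" for i
  proof -
    have "(\<Sum>j\<in>UNIV. q j * (if j = i then 1 else 0)) = 0" using empty[of "\<lambda>j. if j = i then 1 else 0"] by simp
    then show ?thesis by (simp add: if_distrib[of "\<lambda>x. _ * x"] cong: if_cong)
  qed
  then show ?case by simp
next
  case (insert t T)
  let ?d = "\<lambda>x d. \<Sum>i\<in>UNIV. x i * d i"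
  have "\<exists>b c. \<forall>i. q i - b * t i = (\<Sum>t\<in>T. c t * t i)"
  proof (cases "\<exists>d. (\<forall>t\<in>T. ?d t d = 0) \<and> ?d t d \<noteq> 0")
    case False
    then have "\<And>d. (\<And>t. t \<in> T \<Longrightarrow> ?d t d = 0) \<Longrightarrow> ?d q d = 0" using insert.prems by blast
    from insert.IH[OF this] show ?thesis by (intro exI[of _ 0]) simp
  next
    case True
    then obtain e where e: "\<And>t. t \<in> T \<Longrightarrow> ?d t e = 0" "?d t e \<noteq> 0" by blast
    define b where "b = ?d q e / ?d t e"
    have lin: "?d x (\<lambda>i. d i - r * e i) = ?d x d - r * ?d x e" for x d r
      by (simp add: sum_subtractf right_diff_distrib sum_distrib_left mult_ac)
    have "?d (\<lambda>i. q i - b * t i) d = 0" if d: "\<And>t. t \<in> T \<Longrightarrow> ?d t d = 0" for d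
    proof -
      \<comment> \<open>Subtracting a multiple of \<open>e\<close> from \<open>d\<close> makes it
        annihilate \<open>t\<close> as well.\<close>
      have "?d q (\<lambda>i. d i - (?d t d / ?d t e) * e i) = 0"
      proof (rule insert.prems)
        fix s assume "s \<in> insert t T"
        then show "?d s (\<lambda>i. d i - (?d t d / ?d t e) * e i) = 0"
          unfolding lin using d e by auto
      qed
      then have "?d q d - ?d t d / ?d t e * ?d q e = 0" by (simp only: lin)
      moreover have "?d (\<lambda>i. q i - b * t i) d = ?d q d - b * ?d t d"
        by (simp add: sum_subtractf left_diff_distrib sum_distrib_left mult.assoc)
      ultimately show ?thesis by (simp add: b_def)
    qed
    from insert.IH[OF this] show ?thesis by blast
  qed
  then obtain b c where bc: "\<And>i. q i - b * t i = (\<Sum>t\<in>T. c t * t i)" by blast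
  have "q i = (\<Sum>s\<in>insert t T. (c(t := b)) s * s i)" for i
  proof -
    have "(\<Sum>s\<in>T. (c(t := b)) s * s i) = (\<Sum>s\<in>T. c s * s i)" using insert.hyps by (intro sum.cong) auto
    then show ?thesis using insert.hyps bc[of i] by (simp add: algebra_simps)
  qed
  then show ?case by blast
qed

lemma bezout_Gcd:
  fixes w :: "'n \<Rightarrow> nat"
  assumes "finite S"
  shows "\<exists>u. (\<Sum>i\<in>S. u i * int (w i)) = int (Gcd (w ` S))"
  using assms
proof (induction S rule: finite_induct)
  case (insert x S)
  then obtain u where u: "(\<Sum>i\<in>S. u i * int (w i)) = int (Gcd (w ` S))" by blast
  obtain a b where ab: "a * int (w x) + b * int (Gcd (w ` S)) = gcd (int (w x)) (int (Gcd (w ` S)))"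
    using bezout_int by blast
  have "(\<Sum>i\<in>S. (if i = x then a else b * u i) * int (w i)) = b * (\<Sum>i\<in>S. u i * int (w i))"
    unfolding sum_distrib_left using insert.hyps by (intro sum.cong) auto
  then have "(\<Sum>i\<in>insert x S. (if i = x then a else b * u i) * int (w i)) = int (Gcd (w ` insert x S))"
    using insert.hyps ab u by simp
  then show ?case by (intro exI[of _ "\<lambda>i. if i = x then a else b * u i"])
qed simp


section \<open>Monomial valuations\<close>

definition min_weight :: "('n::finite \<Rightarrow> nat) \<Rightarrow> ('n, 'a::zero) mpolynomial \<Rightarrow> nat" where
  "min_weight w f = Min ((\<lambda>m. dotp (lookup m) w) ` keys f)"

text \<open>A form of the lower bound that covers the zero polynomial, for which
  \<open>min_weight\<close> is a minimum over the empty set.\<close>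

definition weight_ge :: "('n::finite \<Rightarrow> nat) \<Rightarrow> nat \<Rightarrow> ('n, 'a::zero) mpolynomial \<Rightarrow> bool" where
  "weight_ge w k f \<longleftrightarrow> (\<forall>m\<in>keys f. k \<le> dotp (lookup m) w)"

lemma dotp_lookup_add:
  "dotp (lookup (a + b)) w = dotp (lookup a) w + dotp (lookup b) (w :: _ \<Rightarrow> nat)"
  by (simp add: dotp_def lookup_add distrib_right sum.distrib)

lemma weight_ge_iff: "f \<noteq> 0 \<Longrightarrow> weight_ge w k f \<longleftrightarrow> k \<le> min_weight w f"
  by (auto simp: weight_ge_def min_weight_def Min_ge_iff)

lemma weight_ge_0 [simp]: "weight_ge w k 0"
  by (simp add: weight_ge_def)

lemma weight_ge_add: "weight_ge w k f \<Longrightarrow> weight_ge w k g \<Longrightarrow> weight_ge w k (f + g)"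
  using keys_add[of f g] by (auto simp: weight_ge_def)

lemma weight_ge_diff:
  fixes f g :: "('n::finite, 'a::ab_group_add) mpolynomial"
  shows "weight_ge w k f \<Longrightarrow> weight_ge w k g \<Longrightarrow> weight_ge w k (f - g)"
  by (auto simp: weight_ge_def in_keys_iff lookup_minus)

lemma weight_ge_mult: "weight_ge w k f \<Longrightarrow> weight_ge w l g \<Longrightarrow> weight_ge w (k + l) (f * g)"
  using keys_mult[of f g] by (fastforce simp: weight_ge_def dotp_lookup_add intro: add_mono)

lemma weight_ge_sum:
  "(\<And>x. x \<in> S \<Longrightarrow> weight_ge w k (f x)) \<Longrightarrow> weight_ge w k (sum f S)"
  by (induction S rule: infinite_finite_induct) (auto intro: weight_ge_add)

lemma min_weight_attained:
  assumes "f \<noteq> 0"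
  obtains m where "m \<in> keys f" "dotp (lookup m) w = min_weight w f"
proof -
  have "min_weight w f \<in> (\<lambda>m. dotp (lookup m) w) ` keys f"
    unfolding min_weight_def using assms by (intro Min_in) auto
  then show thesis using that by auto
qed

lemma min_weight_le: "m \<in> keys f \<Longrightarrow> min_weight w f \<le> dotp (lookup m) w"
  by (simp add: min_weight_def)

text \<open>The parts of least weight have a nonzero product, because polynomials form a domain, so
  nothing cancels completely in the least possible weight.\<close>

lemma min_weight_mult:
  fixes f g :: "('n::{finite,linorder}, 'a::idom) mpolynomial"
  assumes "f \<noteq> 0" "g \<noteq> 0"
  shows "min_weight w (f * g) = min_weight w f + min_weight w g"
proof -
  define ini :: "('n, 'a) mpolynomial \<Rightarrow> ('n, 'a) mpolynomial" where
    "ini h = Poly_Mapping.mapp (\<lambda>m c. if dotp (lookup m) w = min_weight w h then c else 0) h" for h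
  have lookup_ini: "lookup (ini h) m
      = (if dotp (lookup m) w = min_weight w h then lookup h m else 0)" for h m
    by (auto simp: ini_def lookup_mapp when_def in_keys_iff)
  have ini: "ini h \<noteq> 0" if h: "h \<noteq> 0" for h
  proof -
    obtain m where m: "m \<in> keys h" "dotp (lookup m) w = min_weight w h"
      using min_weight_attained[OF h, of w] by blast
    then have "lookup (ini h) m \<noteq> 0" by (simp add: lookup_ini in_keys_iff)
    then show ?thesis by auto
  qed
  have keys_ini: "dotp (lookup m) w = min_weight w h" if "m \<in> keys (ini h)" for h m
    using that by (auto simp: in_keys_iff lookup_ini split: if_splits)
  have rest: "weight_ge w (Suc (min_weight w h)) (h - ini h)" for h
    unfolding weight_ge_def
  proof
    fix m assume "m \<in> keys (h - ini h)"
    then have "m \<in> keys h" "dotp (lookup m) w \<noteq> min_weight w h"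
      by (auto simp: in_keys_iff lookup_minus lookup_ini split: if_splits)
    then show "Suc (min_weight w h) \<le> dotp (lookup m) w"
      using min_weight_le[of m h w] by simp
  qed
  have ini_ge: "weight_ge w (min_weight w h) (ini h)" for h
    using keys_ini by (auto simp: weight_ge_def)
  let ?a = "min_weight w f" and ?b = "min_weight w g"
  have rest': "weight_ge w (Suc (?a + ?b)) (ini f * (g - ini g) + (f - ini f) * g)"
  proof (rule weight_ge_add)
    show "weight_ge w (Suc (?a + ?b)) (ini f * (g - ini g))"
      using weight_ge_mult[OF ini_ge rest] by simp
    have "weight_ge w ?b g" using assms by (simp add: weight_ge_iff)
    from weight_ge_mult[OF rest this] show "weight_ge w (Suc (?a + ?b)) ((f - ini f) * g)" by simp
  qed
  have split: "f * g = ini f * ini g + (ini f * (g - ini g) + (f - ini f) * g)" by (simp add: algebra_simps)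
  have "ini f * ini g \<noteq> 0" using ini assms by simp
  then obtain k where k: "k \<in> keys (ini f * ini g)"
    by (metis all_not_in_conv keys_eq_empty)
  then obtain a b where "k = a + b" "a \<in> keys (ini f)" "b \<in> keys (ini g)"
    using keys_mult[of "ini f" "ini g"] by blast
  then have wk: "dotp (lookup k) w = ?a + ?b" by (simp add: dotp_lookup_add keys_ini)
  then have "k \<notin> keys (ini f * (g - ini g) + (f - ini f) * g)"
    using rest' unfolding weight_ge_def by (metis not_less_eq_eq order_refl)
  then have "lookup (f * g) k = lookup (ini f * ini g) k"
    unfolding split lookup_add[of "ini f * ini g"] by (simp only: in_keys_iff not_not add_0_right)
  then have "k \<in> keys (f * g)" using k by (simp add: in_keys_iff)
  then have "min_weight w (f * g) \<le> ?a + ?b" using min_weight_le[of k "f * g" w] wk by simp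
  moreover have "weight_ge w (?a + ?b) (f * g)"
    using assms by (intro weight_ge_mult) (simp_all add: weight_ge_iff)
  ultimately show ?thesis using assms by (simp add: weight_ge_iff)
qed

section \<open>Constants and Laurent monomials in the function field, and the valuation on
  them\<close>

lemma embed_simps [simp]:
  "embed 0 = 0" "embed 1 = 1" "embed (f + g) = embed f + embed g" "embed (f - g) = embed f - embed g"
  "embed (f * g) = embed f * embed g" "embed f = 0 \<longleftrightarrow> f = 0"
  by (simp_all add: embed_def Zero_fract_def One_fract_def eq_fract)

lemma embed_sum: "embed (sum f S) = (\<Sum>x\<in>S. embed (f x))"
  by (induction S rule: infinite_finite_induct) simp_all

lemma embed_prod: "embed (prod f S) = (\<Prod>x\<in>S. embed (f x))"
  by (induction S rule: infinite_finite_induct) simp_all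

lemma embed_power: "embed (f ^ n) = embed f ^ n"
  by (induction n) simp_all

lemma Fract_eq_embed: "b \<noteq> 0 \<Longrightarrow> Fract a b = embed a / embed b"
  by (simp add: embed_def)

lemma funfield_cases:
  obtains a b where "z = embed a / embed b" "b \<noteq> 0"
  by (cases z) (auto simp: Fract_eq_embed)

lemma coord_nonzero [simp]: "coord i \<noteq> 0"
  by (simp add: coord_def) (metis lookup_single_eq lookup_zero zero_neq_one)

definition mon :: "('n::{finite,linorder} \<Rightarrow> int) \<Rightarrow> 'n funfield" where
  "mon q = (\<Prod>i\<in>UNIV. coord i powi q i)"

definition const :: "rat \<Rightarrow> 'n::{finite,linorder} funfield" where
  "const c = embed (single 0 c)"

lemma const_simps [simp]: "const 0 = 0" "const 1 = 1" "const (a + b) = const a + const b"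
  "const (a * b) = const a * const b" "const c = 0 \<longleftrightarrow> c = 0"
  by (auto simp: const_def single_add mult_single simp flip: embed_simps(3,5) dest: arg_cong[where f = "\<lambda>f. lookup f 0"])

lemma mon_nonzero [simp]: "mon q \<noteq> 0"
  by (simp add: mon_def)

lemma mon_add: "mon (\<lambda>i. q i + r i) = mon q * mon r"
  by (simp add: mon_def power_int_add prod.distrib)

lemma mon_diff: "mon (\<lambda>i. q i - r i) = mon q / mon r"
  by (simp add: mon_def power_int_diff prod_dividef)

lemma mon_scale: "mon (\<lambda>i. k * q i) = mon q powi k"
proof -
  have "(\<Prod>i\<in>S. f i powi k) = prod f S powi k" for S and f :: "'a \<Rightarrow> 'a funfield"
    by (induction S rule: infinite_finite_induct) (simp_all add: power_int_mult_distrib)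
  then show ?thesis by (simp add: mon_def mult.commute[of k] power_int_mult)
qed

lemma mon_scale_nat: "mon (\<lambda>i. int k * q i) = mon q ^ k"
  by (simp add: mon_scale)

lemma mon_sum: "mon (\<lambda>i. \<Sum>t\<in>T. f t i) = (\<Prod>t\<in>T. mon (f t))"
  by (induction T rule: infinite_finite_induct) (simp_all add: mon_add, simp_all add: mon_def)

lemma mon_unit: "mon (\<lambda>j. if j = i then n else 0) = coord i powi n"
proof -
  have "mon (\<lambda>j. if j = i then n else 0) = (\<Prod>j\<in>UNIV. if j = i then coord i powi n else 1)"
    unfolding mon_def by (intro prod.cong) auto
  then show ?thesis by simp
qed

lemma embed_single: "embed (single m c) = const c * mon (\<lambda>i. int (lookup m i))"
proof -
  have pow: "single (single i 1) (1::rat) ^ n = single (single i n) 1" for i :: 'a and n :: nat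
    by (induction n) (simp_all add: mult_single flip: single_add)
  have sum: "(\<Prod>i\<in>S. single (f i) (1::rat)) = single (sum f S) 1" for S and f :: "'a \<Rightarrow> 'a \<Rightarrow>\<^sub>0 nat"
    by (induction S rule: infinite_finite_induct) (simp_all add: mult_single)
  have "(\<Sum>i\<in>UNIV. single i (lookup m i)) = m"
    by (rule poly_mapping_eqI) (simp add: lookup_sum lookup_single when_def)
  then have "single m c = single 0 c * (\<Prod>i\<in>UNIV. single (single i 1) 1 ^ lookup m i)"
    by (simp add: pow sum mult_single del: One_nat_def)
  then show ?thesis
    by (simp add: const_def mon_def coord_def embed_prod embed_power)
qed

lemma embed_expand:
  "embed f = (\<Sum>m\<in>keys f. const (lookup f m) * mon (\<lambda>i. int (lookup m i)))"
proof -
  have "(\<Sum>m\<in>keys f. single m (lookup f m)) = f"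
    by (rule poly_mapping_eqI) (auto simp: lookup_sum lookup_single when_def in_keys_iff)
  then have "embed f = embed (\<Sum>m\<in>keys f. single m (lookup f m))" by simp
  then show ?thesis by (simp only: embed_sum embed_single)
qed

text \<open>The quotient of minimal weights is independent of the representation; the value at \<open>0\<close> is junk.\<close>

definition mval :: "('n \<Rightarrow> nat) \<Rightarrow> 'n::{finite,linorder} funfield \<Rightarrow> int" where
  "mval w z = (SOME k. \<exists>a b. a \<noteq> 0 \<and> b \<noteq> 0 \<and> z = embed a / embed b \<and>
     k = int (min_weight w a) - int (min_weight w b))"

lemma mval_quotient:
  assumes "a \<noteq> 0" "b \<noteq> 0"
  shows "mval w (embed a / embed b) = int (min_weight w a) - int (min_weight w b)"
  unfolding mval_def
proof (rule some_equality)
  fix k assume "\<exists>a' b'. a' \<noteq> 0 \<and> b' \<noteq> 0 \<and> embed a / embed b = embed a' / embed b' \<and>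
     k = int (min_weight w a') - int (min_weight w b')"
  then obtain a' b' where *: "a' \<noteq> 0" "b' \<noteq> 0" "embed a / embed b = embed a' / embed b'"
    "k = int (min_weight w a') - int (min_weight w b')" by blast
  have "embed (a * b') = embed (a' * b)" using * assms by (simp add: field_simps)
  then have "a * b' = a' * b" using embed_simps(4,6) by (metis eq_iff_diff_eq_0)
  then have "min_weight w (a * b') = min_weight w (a' * b)" by simp
  then show "k = int (min_weight w a) - int (min_weight w b)"
    using * assms by (simp add: min_weight_mult)
qed (use assms in blast)

lemma mval_embed: "a \<noteq> 0 \<Longrightarrow> mval w (embed a) = int (min_weight w a)"
  using mval_quotient[of a 1 w] by (simp add: min_weight_def dotp_def)

interpretation mval: field_valuation "mval w" for w :: "'n::{finite,linorder} \<Rightarrow> nat"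
proof
  fix x y :: "'n funfield" assume xy: "x \<noteq> 0" "y \<noteq> 0"
  obtain a b where x: "x = embed a / embed b" "b \<noteq> 0" by (rule funfield_cases)
  obtain c d where y: "y = embed c / embed d" "d \<noteq> 0" by (rule funfield_cases)
  have nz: "a \<noteq> 0" "c \<noteq> 0" using xy x y by auto
  have "x * y = embed (a * c) / embed (b * d)" by (simp add: x y)
  then show "mval w (x * y) = mval w x + mval w y"
    using nz x(2) y(2) by (simp only: x(1) y(1) mval_quotient mult_eq_0_iff simp_thms) (simp add: min_weight_mult)
  assume "x + y \<noteq> 0"
  have "x + y = embed (a * d + c * b) / embed (b * d)" using x y by (simp add: field_simps)
  moreover have s: "a * d + c * b \<noteq> 0" using \<open>x + y \<noteq> 0\<close> calculation by (metis div_0 embed_simps(1))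
  ultimately have xy': "mval w (x + y) = int (min_weight w (a * d + c * b)) - int (min_weight w (b * d))"
    using x y by (simp only: mval_quotient mult_eq_0_iff simp_thms)
  define k where "k = min (min_weight w (a * d)) (min_weight w (c * b))"
  have "weight_ge w k (a * d + c * b)"
    using nz x y by (intro weight_ge_add) (simp_all add: weight_ge_iff k_def)
  then have "k \<le> min_weight w (a * d + c * b)" using s by (simp add: weight_ge_iff)
  moreover have "mval w x = int (min_weight w (a * d)) - int (min_weight w (b * d))"
    "mval w y = int (min_weight w (c * b)) - int (min_weight w (b * d))"
    using nz x y by (simp_all add: mval_quotient min_weight_mult)
  ultimately show "min (mval w x) (mval w y) \<le> mval w (x + y)"
    unfolding xy' k_def by linarith
qed

lemma mval_coord: "mval w (coord i) = int (w i)"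
proof -
  have nz: "single (single i (1::nat)) (1::rat) \<noteq> 0"
    by (metis coord_def coord_nonzero embed_simps(1))
  have "(\<Sum>j\<in>UNIV. (1 when i = j) * w j) = (\<Sum>j\<in>UNIV. if i = j then w j else 0)"
    by (intro sum.cong) (auto simp: when_def)
  then show ?thesis
    unfolding coord_def mval_embed[OF nz] by (simp add: min_weight_def dotp_def lookup_single)
qed

lemma mval_mon: "mval w (mon q) = (\<Sum>i\<in>UNIV. q i * int (w i))"
  unfolding mon_def by (subst mval.v_prod) (simp_all add: mval.v_powi mval_coord)

lemma mval_const: "c \<noteq> 0 \<Longrightarrow> mval w (const c) = 0"
  unfolding const_def by (subst mval_embed) (auto simp: min_weight_def dotp_def dest: arg_cong[where f = "\<lambda>f. lookup f 0"])

lemma embed_vge_iff: "embed f \<in> mval.vge w (int k) \<longleftrightarrow> weight_ge w k f"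
  by (cases "f = 0") (simp_all add: mval.vge_iff mval_embed weight_ge_iff)

text \<open>Bezout coefficients of the primitive vector are the exponents of a Laurent monomial of
  value 1.\<close>

lemma discrete_valuation_mval:
  assumes "Gcd (range w) = 1"
  shows "discrete_valuation (mval w)"
proof
  obtain u where "(\<Sum>i\<in>UNIV. u i * int (w i)) = 1"
    using bezout_Gcd[of UNIV w] assms by auto
  then show "\<exists>t. t \<noteq> 0 \<and> mval w t = 1" by (intro exI[of _ "mon u"]) (simp add: mval_mon)
qed


section \<open>The divisor of a facet normal\<close>

lemma subring_gen_subring: "is_subring (subring_gen S)"
  unfolding subring_gen_def is_subring_def by blast

lemma subring_gen_subset: "S \<subseteq> subring_gen S"
  unfolding subring_gen_def by blast

lemma subring_gen_least: "is_subring A \<Longrightarrow> S \<subseteq> A \<Longrightarrow> subring_gen S \<subseteq> A"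
  unfolding subring_gen_def by blast

lemma integral_closure_root:
  fixes x :: "'a::field"
  assumes "is_subring A" "x ^ k \<in> A" "0 < k"
  shows "x \<in> integral_closure A"
proof -
  let ?q = "monom 1 k + [:- (x ^ k):]"
  have deg: "degree ?q = k" using assms(3) by (subst degree_add_eq_left) (auto simp: degree_monom_eq)
  then have "lead_coeff ?q = 1" using assms(3) by (simp add: coeff_pCons split: nat.split)
  moreover have "coeff ?q i \<in> A" for i
    using assms subring_closed[OF assms(1)] by (auto simp: coeff_pCons split: nat.split)
  moreover have "poly ?q x = 0" by (simp add: poly_monom)
  ultimately show ?thesis unfolding integral_closure_def by blast
qed

lemma monomial_in_rational_ideal:
  assumes "m \<in> M"
  shows "single m 1 \<in> rational_ideal (monomials_ideal M)"
proof -
  have "single m (1::int) \<in> monomials_ideal M"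
    unfolding monomials_ideal_def ideal_gen_def using assms
    by (auto intro!: exI[of _ "{single m 1}"] exI[of _ "\<lambda>_. 1"])
  then have "Poly_Mapping.map rat_of_int (single m 1)
      \<in> Poly_Mapping.map rat_of_int ` monomials_ideal M" by (rule imageI)
  then show ?thesis
    unfolding rational_ideal_def ideal_gen_def[of UNIV "Poly_Mapping.map rat_of_int ` _"]
    by (auto intro!: exI[of _ "{single m 1}"] exI[of _ "\<lambda>_. 1"])
qed

lemma rational_ideal_weight_ge:
  assumes "f \<in> rational_ideal I" "\<And>g. g \<in> I \<Longrightarrow> weight_ge w k g"
  shows "weight_ge w k f"
proof -
  obtain T r where f: "f = (\<Sum>a\<in>T. r a * a)" "T \<subseteq> Poly_Mapping.map rat_of_int ` I"
    using assms(1) unfolding rational_ideal_def ideal_gen_def by blast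
  have "weight_ge w k a" if a: "a \<in> T" for a
  proof -
    obtain g where g: "g \<in> I" "a = Poly_Mapping.map rat_of_int g" using f(2) a by blast
    have "keys a \<subseteq> keys g" unfolding g(2) by (auto simp: in_keys_iff map.rep_eq when_def)
    then show ?thesis using assms(2)[OF g(1)] by (auto simp: weight_ge_def)
  qed
  then have "weight_ge w (0 + k) (r a * a)" if "a \<in> T" for a
    using that by (intro weight_ge_mult) (auto simp: weight_ge_def)
  then show ?thesis unfolding f(1) by (intro weight_ge_sum) simp
qed

lemma common_denominator:
  fixes f :: "'t \<Rightarrow> rat"
  assumes "finite T"
  shows "\<exists>k>0. \<forall>t\<in>T. \<exists>b::int. of_nat k * f t = of_int b"
  using assms
proof (induction T rule: finite_induct)
  case (insert t T)
  then obtain k where k: "0 < k" "\<And>t. t \<in> T \<Longrightarrow> \<exists>b::int. of_nat k * f t = of_int b" by blast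
  obtain a l where al: "f t = of_int a / of_int l" "l > 0"
    by (metis quotient_of_denom_pos quotient_of_div surj_pair)
  define l' where "l' = nat l"
  have l': "l' > 0" "f t = of_int a / of_nat l'" using al by (auto simp: l'_def)
  have "\<exists>b::int. of_nat (k * l') * f s = of_int b" if s: "s \<in> insert t T" for s
  proof (cases "s = t")
    case True
    then show ?thesis using l' by (intro exI[of _ "int k * a"]) (simp add: field_simps)
  next
    case False
    then obtain b :: int where b: "of_nat k * f s = of_int b" using k(2)[of s] s by blast
    have "of_nat (k * l') * f s = of_nat l' * (of_nat k * f s)" by simp
    also have "\<dots> = of_int (int l' * b)" by (simp only: b of_int_mult of_int_of_nat_eq)
    finally show ?thesis by blast
  qed
  then show ?case using k(1) l'(1) by (intro exI[of _ "k * l'"]) simp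
qed (auto intro: exI[of _ 1])

locale facet_divisor =
  fixes M :: "('n::{finite,linorder} \<Rightarrow>\<^sub>0 nat) set" and N :: "('n \<Rightarrow> nat) set" and w :: "'n \<Rightarrow> nat"
  assumes finN: "finite N" and neN: "N \<noteq> {}" and NM: "N \<subseteq> lookup ` M"
    and dom: "\<And>m. m \<in> M \<Longrightarrow> \<exists>n\<in>N. \<forall>i. n i \<le> lookup m i"
    and facet: "facet_normal N w"
begin

sublocale V: discrete_valuation "mval w"
  using facet by (intro discrete_valuation_mval) (simp add: facet_normal_def)

lemma ex_positive: obtains i where "w i \<noteq> 0"
  using facet by (auto simp: facet_normal_def)

lemma J_weight_ge: "f \<in> rational_ideal (monomials_ideal M) \<Longrightarrow> weight_ge w (newton N w) f"
proof (erule rational_ideal_weight_ge)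
  fix g assume "g \<in> monomials_ideal M"
  show "weight_ge w (newton N w) g"
    unfolding weight_ge_def
  proof
    fix k assume k: "k \<in> keys g"
    obtain m where m: "m \<in> M" "\<And>i. lookup m i \<le> lookup k i"
      using monomials_ideal_keys[OF \<open>g \<in> _\<close> k] by blast
    obtain n where n: "n \<in> N" "\<And>i. n i \<le> lookup m i" using dom[OF m(1)] by blast
    have "newton N w \<le> dotp n w" by (rule newton_le[OF finN neN n(1)])
    also have "\<dots> \<le> dotp (lookup k) w"
      unfolding dotp_def using n(2) m(2) by (intro sum_mono mult_right_mono) (auto intro: order_trans)
    finally show "newton N w \<le> dotp (lookup k) w" .
  qed
qed

lemma embed_monomial: "embed (single m 1) = mon (\<lambda>i. int (lookup m i))"
  by (simp add: embed_single)

lemma mval_monomial: "mval w (mon (\<lambda>i. int (n i))) = int (dotp n w)"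
  by (simp add: mval_mon dotp_def)

text \<open>A generator on the facet has the least value in the ideal and is therefore a local
  equation; the ideals \<open>vge k\<close> differ for different \<open>k\<close>, so every local
  equation has the same order.\<close>

lemma ideal_order_facet: "ideal_order (mval.vge w 0) (rational_ideal (monomials_ideal M)) = int (newton N w)"
proof -
  let ?J = "rational_ideal (monomials_ideal M)"
  obtain n where "n \<in> tight N w" using tight_ex[OF finN neN] by blast
  then obtain m where m: "m \<in> M" "dotp (lookup m) w = newton N w"
    using NM by (auto simp: tight_def)
  define g where "g = embed (single m (1::rat))"
  have g: "g \<noteq> 0" "mval w g = int (newton N w)" by (simp_all add: g_def embed_monomial mval_monomial m(2))
  have "embed ` ?J \<subseteq> mval.vge w (int (newton N w))" using J_weight_ge by (auto simp: embed_vge_iff)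
  moreover have "g \<in> embed ` ?J" using monomial_in_rational_ideal[OF m(1)] by (simp add: g_def)
  ultimately have gen: "ideal_gen (mval.vge w 0) (embed ` ?J) = mval.vge w (int (newton N w))"
    using g by (intro V.ideal_gen_eq_vge[of _ _ g]) auto
  show ?thesis
    unfolding ideal_order_def gen
  proof (rule the_equality)
    show "\<exists>g'. mval.vge w (int (newton N w)) = (\<lambda>x. g' * x) ` mval.vge w 0 \<and> g' \<noteq> 0
        \<and> int (newton N w) = order_along (mval.vge w 0) g'"
      using g mval.principal_eq_vge[OF g(1)] V.order_along_eq[OF g(1)] by (intro exI[of _ g]) simp
    fix k assume "\<exists>g'. mval.vge w (int (newton N w)) = (\<lambda>x. g' * x) ` mval.vge w 0 \<and> g' \<noteq> 0 \<and> k = order_along (mval.vge w 0) g'"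
    then obtain g' where g': "mval.vge w (int (newton N w)) = (\<lambda>x. g' * x) ` mval.vge w 0" "g' \<noteq> 0" "k = order_along (mval.vge w 0) g'"
      by blast
    then show "k = int (newton N w)"
      using mval.principal_eq_vge[OF g'(2)] V.order_along_eq[OF g'(2)] V.vge_inject by metis
  qed
qed

text \<open>The torus multiplies coefficients by nonzero numbers, so the monomials that occur, and
  with them all weights, stay the same.\<close>

lemma torus_invariant_facet: "torus_invariant (mval.vge w 0)"
  unfolding torus_invariant_def
proof (intro allI impI)
  fix t :: "'n \<Rightarrow> rat" assume t: "\<forall>i. t i \<noteq> 0"
  have keys: "keys (torus_act_poly t f) = keys f" if "\<forall>i. t i \<noteq> 0" for t f
    using that by (auto simp: torus_act_poly_def in_keys_iff lookup_mapp when_def)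
  have mw: "min_weight w (torus_act_poly t f) = min_weight w f" if "\<forall>i. t i \<noteq> 0" for t f
    using keys[OF that] by (simp add: min_weight_def)
  have nz: "torus_act_poly t f = 0 \<longleftrightarrow> f = 0" if "\<forall>i. t i \<noteq> 0" for t f
    using keys[OF that, of f] by (metis keys_eq_empty)
  have inv: "torus_act_poly t (torus_act_poly (\<lambda>i. inverse (t i)) f) = f" for f
  proof (rule poly_mapping_eqI)
    fix k
    have "(\<Prod>i\<in>UNIV. inverse (t i) ^ lookup k i) * (\<Prod>i\<in>UNIV. t i ^ lookup k i) = 1"
      unfolding prod.distrib[symmetric] using t by (intro prod.neutral) (simp add: power_inverse)
    then show "lookup (torus_act_poly t (torus_act_poly (\<lambda>i. inverse (t i)) f)) k = lookup f k"
      using t by (auto simp: torus_act_poly_def lookup_mapp when_def in_keys_iff mult.assoc)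
  qed
  have mem: "Fract (torus_act_poly t a) (torus_act_poly t b) \<in> mval.vge w 0 \<longleftrightarrow> Fract a b \<in> mval.vge w 0"
    if "\<forall>i. t i \<noteq> 0" "b \<noteq> 0" for t a b
    using that nz[of t a] nz[of t b] mw[of t a] mw[of t b]
    by (cases "a = 0") (simp_all add: Fract_eq_embed mval.vge_iff mval_quotient)
  show "torus_image t (mval.vge w 0) = mval.vge w 0"
  proof (intro equalityI subsetI)
    fix z assume "z \<in> torus_image t (mval.vge w 0)"
    then show "z \<in> mval.vge w 0" using mem t unfolding torus_image_def by blast
  next
    fix z assume z: "z \<in> mval.vge w 0"
    obtain a b where ab: "z = Fract a b" "b \<noteq> 0" by (cases z)
    let ?t' = "\<lambda>i. inverse (t i)"
    have t': "\<forall>i. ?t' i \<noteq> 0" using t by simp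
    have "z = Fract (torus_act_poly t (torus_act_poly ?t' a)) (torus_act_poly t (torus_act_poly ?t' b))"
      by (simp add: ab inv)
    moreover have "Fract (torus_act_poly ?t' a) (torus_act_poly ?t' b) \<in> mval.vge w 0"
      using mem[OF t' ab(2)] z ab by simp
    ultimately show "z \<in> torus_image t (mval.vge w 0)"
      unfolding torus_image_def using nz[OF t'] ab(2) by blast
  qed
qed

text \<open>Modulo multiples of an interior lattice point of the facet cone, the half space of
  nonnegative \<open>w\<close>-weight is contained in the saturation of the monoid of the chart.\<close>

lemma mon_in_chart:
  fixes q :: "'n \<Rightarrow> int" and B :: "'n funfield set" and n0 :: "'n \<Rightarrow> nat"
  defines "T \<equiv> (\<lambda>i j. if j = i then 1 else 0) ` {i. w i = 0} \<union>
    (\<lambda>n j. int (n j) - int (n0 j)) ` tight N w"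
  assumes n0: "n0 \<in> tight N w" and B: "is_subring B" "range embed \<subseteq> B" and T: "\<And>t. t \<in> T \<Longrightarrow> mon t \<in> B"
    and q: "0 \<le> (\<Sum>i\<in>UNIV. q i * int (w i))"
  shows "\<exists>K. \<forall>n\<ge>K. mon (\<lambda>i. q i + int n * (\<Sum>t\<in>T. t i)) \<in> integral_closure B"
proof -
  have finT: "finite T" using finN by (auto simp: T_def tight_def)
  obtain i0 where i0: "w i0 \<noteq> 0" by (rule ex_positive)
  \<comment> \<open>Subtracting \<alpha> at \<open>i0\<close> brings the weight of \<open>q\<close>
    to 0. As \<alpha> is nonnegative, a multiple of it can be restored later by an honest power of a
    coordinate.\<close>
  define \<alpha> :: rat where "\<alpha> = of_int (\<Sum>i\<in>UNIV. q i * int (w i)) / of_nat (w i0)"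
  have \<alpha>0: "0 \<le> \<alpha>" unfolding \<alpha>_def using q
    by (intro divide_nonneg_nonneg) (simp_all only: of_int_0_le_iff of_nat_0_le_iff)
  define q' :: "'n \<Rightarrow> rat" where "q' i = of_int (q i) - (if i = i0 then \<alpha> else 0)" for i
  have inj: "inj_on (\<lambda>t i. of_int (t i) :: rat) T" by (auto simp: inj_on_def fun_eq_iff)
  \<comment> \<open>An annihilator of \<open>T\<close> is a face direction, hence a multiple of
    \<open>w\<close> by the facet condition, and so it annihilates the vector \<open>q'\<close> of
    weight 0.\<close>
  have "\<exists>c. \<forall>i. q' i = (\<Sum>t\<in>(\<lambda>t i. of_int (t i)) ` T. c t * t i)"
  proof (rule span_of_annihilator)
    fix d :: "'n \<Rightarrow> rat"
    assume "\<And>t. t \<in> (\<lambda>t i. of_int (t i)) ` T \<Longrightarrow> (\<Sum>i\<in>UNIV. t i * d i) = 0"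
    then have d: "(\<Sum>i\<in>UNIV. of_int (t i) * d i) = 0" if "t \<in> T" for t using that by blast
    have "d i = 0" if "w i = 0" for i
    proof -
      have "(\<Sum>j\<in>UNIV. of_int (if j = i then 1 else 0) * d j) = 0" using that by (intro d) (auto simp: T_def)
      moreover have "(\<Sum>j\<in>UNIV. of_int (if j = i then 1 else 0) * d j) = (\<Sum>j\<in>UNIV. if j = i then d j else 0)"
        by (intro sum.cong) auto
      ultimately show ?thesis by simp
    qed
    moreover have "dotp n d = dotp n0 d" if "n \<in> tight N w" for n
    proof -
      have "(\<Sum>i\<in>UNIV. of_int (int (n i) - int (n0 i)) * d i) = 0"
        using that by (intro d[of "\<lambda>j. int (n j) - int (n0 j)"]) (auto simp: T_def)
      then show ?thesis by (simp add: dotp_def left_diff_distrib sum_subtractf)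
    qed
    ultimately have "d \<in> face_dirs N w" by (simp add: face_dirs_def)
    then obtain c where c: "\<And>i. d i = c * of_nat (w i)" using facet unfolding facet_normal_def by meson
    have "(\<Sum>i\<in>UNIV. q' i * d i) = c * (\<Sum>i\<in>UNIV. of_int (q i) * of_nat (w i) - (if i = i0 then \<alpha> * of_nat (w i0) else 0))"
      unfolding sum_distrib_left by (intro sum.cong) (auto simp: q'_def c algebra_simps)
    also have "\<dots> = 0" using i0 by (simp add: sum_subtractf \<alpha>_def)
    finally show "(\<Sum>i\<in>UNIV. q' i * d i) = 0" .
  qed (use finT in simp)
  then obtain c0 where c0: "\<And>i. q' i = (\<Sum>t\<in>(\<lambda>t i. of_int (t i)) ` T. c0 t * t i)" by blast
  define c where "c t = c0 (\<lambda>i. of_int (t i))" for t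
  have c: "of_int (q i) = (if i = i0 then \<alpha> else 0) + (\<Sum>t\<in>T. c t * of_int (t i))" for i
    using c0[of i] unfolding sum.reindex[OF inj] by (simp add: q'_def c_def algebra_simps)
  have "\<exists>k>0. \<forall>x\<in>insert \<alpha> (c ` T). \<exists>b::int. of_nat k * x = of_int b"
    by (rule common_denominator) (use finT in simp)
  then obtain k where k: "0 < k" "\<forall>x\<in>insert \<alpha> (c ` T). \<exists>b::int. of_nat k * x = of_int b" by blast
  obtain a :: int where a: "of_nat k * \<alpha> = of_int a" using k(2) by blast
  have a0: "0 \<le> a" using \<alpha>0 a by (metis mult_nonneg_nonneg of_int_0_le_iff of_nat_0_le_iff)
  have "\<forall>t\<in>T. \<exists>b::int. of_nat k * c t = of_int b" using k(2) by blast
  from bchoice[OF this] obtain b :: "('n \<Rightarrow> int) \<Rightarrow> int" where b: "\<forall>t\<in>T. of_nat k * c t = of_int (b t)" ..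
  have kq: "int k * q i = (if i = i0 then a else 0) + (\<Sum>t\<in>T. b t * t i)" for i
  proof -
    have "(of_int (int k * q i) :: rat) = of_nat k * of_int (q i)" by simp
    also have "\<dots> = (if i = i0 then of_int a else 0) + (\<Sum>t\<in>T. of_nat k * c t * of_int (t i))"
      by (simp add: c distrib_left sum_distrib_left mult.assoc a)
    also have "\<dots> = of_int ((if i = i0 then a else 0) + (\<Sum>t\<in>T. b t * t i))" using b by simp
    finally show ?thesis by (simp only: of_int_eq_iff)
  qed
  \<comment> \<open>The bound on \<open>n\<close> makes all exponents of the k-th power nonnegative;
    this power then lies in \<open>B\<close>, and the monomial is integral over
    \<open>B\<close>.\<close>
  have "mon (\<lambda>i. q i + int n * (\<Sum>t\<in>T. t i)) \<in> integral_closure B" if n: "nat (\<Sum>t\<in>T. \<bar>b t\<bar>) \<le> n" for n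
  proof (rule integral_closure_root[OF B(1) _ k(1)])
    have nb: "0 \<le> b t + int k * int n" if "t \<in> T" for t
    proof -
      have "\<bar>b t\<bar> \<le> (\<Sum>t\<in>T. \<bar>b t\<bar>)" using finT that by (intro member_le_sum) auto
      also have "\<dots> \<le> int n" using n by simp
      also have "\<dots> \<le> int k * int n" using k(1) by (simp add: mult_le_cancel_right1)
      finally show ?thesis by linarith
    qed
    have "mon (\<lambda>i. q i + int n * (\<Sum>t\<in>T. t i)) ^ k = mon (\<lambda>i. int k * (q i + int n * (\<Sum>t\<in>T. t i)))"
      by (rule mon_scale_nat[symmetric])
    also have "(\<lambda>i. int k * (q i + int n * (\<Sum>t\<in>T. t i))) = (\<lambda>i. (if i = i0 then a else 0) + (\<Sum>t\<in>T. (b t + int k * int n) * t i))"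
      by (simp add: distrib_left kq distrib_right sum.distrib sum_distrib_left mult.assoc add.assoc)
    also have "mon \<dots> = coord i0 powi a * (\<Prod>t\<in>T. mon (\<lambda>i. (b t + int k * int n) * t i))"
      by (simp only: mon_add mon_unit mon_sum)
    also have "\<dots> = coord i0 ^ nat a * (\<Prod>t\<in>T. mon t ^ nat (b t + int k * int n))"
      using a0 nb by (simp add: mon_scale power_int_def)
    also have "\<dots> \<in> B"
      using B(2) T by (intro subring_closed(4) subring_prod subring_power B(1)) (auto simp: coord_def)
    finally show "mon (\<lambda>i. q i + int n * (\<Sum>t\<in>T. t i)) ^ k \<in> B" .
  qed
  then show ?thesis by blast
qed

lemma facet_prime_divisor: "mval.vge w 0 \<in> prime_divisors (rational_ideal (monomials_ideal M))"
proof -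
  let ?J = "rational_ideal (monomials_ideal M)"
  obtain n0 where n0: "n0 \<in> tight N w" using tight_ex[OF finN neN] by blast
  then obtain m0 where m0: "m0 \<in> M" "n0 = lookup m0"
    using NM by (auto simp: tight_def)
  define f where "f = single m0 (1::rat)"
  have fJ: "f \<in> ?J" using monomial_in_rational_ideal[OF m0(1)] by (simp add: f_def)
  have ef: "embed f = mon (\<lambda>i. int (n0 i))" by (simp add: f_def embed_monomial m0(2))
  then have f0: "f \<noteq> 0" using mon_nonzero embed_simps(1) by metis
  have vf: "mval w (embed f) = int (newton N w)" using n0 by (simp add: ef mval_monomial tight_def)
  define B where "B = blowup_chart ?J f"
  have B: "is_subring B" "range embed \<subseteq> B" "\<And>g. g \<in> ?J \<Longrightarrow> embed g / embed f \<in> B"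
    using subring_gen_subring subring_gen_subset[of "range embed \<union> {embed g / embed f | g. g \<in> ?J}"]
    by (auto simp: B_def blowup_chart_def)
  have BE: "B \<subseteq> mval.vge w 0"
    unfolding B_def blowup_chart_def
  proof (intro subring_gen_least mval.vge_subring subsetI)
    fix z assume "z \<in> range embed \<union> {embed g / embed f | g. g \<in> ?J}"
    then consider g where "z = embed g" | g where "g \<in> ?J" "z = embed g / embed f" by blast
    then show "z \<in> mval.vge w 0"
    proof cases
      case 1
      then show ?thesis using embed_vge_iff[of g w 0] by (simp add: weight_ge_def)
    next
      case 2
      then have "embed g \<in> mval.vge w (int (newton N w))" using J_weight_ge by (simp add: embed_vge_iff)
      then show ?thesis
        using 2 f0 vf by (cases "g = 0") (simp_all add: mval.vge_iff mval.v_divide)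
    qed
  qed
  define A where "A = integral_closure B"
  have A: "is_subring A" "A \<subseteq> mval.vge w 0" "B \<subseteq> A"
    using integral_closure_subring[OF B(1)] V.integral_closure_subset[OF B(1) BE] subset_integral_closure[OF B(1)]
    by (simp_all add: A_def)
  define T where "T = (\<lambda>i j. if j = i then 1 else (0::int)) ` {i. w i = 0} \<union>
    (\<lambda>n j. int (n j) - int (n0 j)) ` tight N w"
  have monT: "mon t \<in> B" if t: "t \<in> T" for t
  proof -
    consider i where "t = (\<lambda>j. if j = i then 1 else 0)" | n where "n \<in> tight N w" "t = (\<lambda>j. int (n j) - int (n0 j))"
      using t by (auto simp: T_def)
    then show ?thesis
    proof cases
      case 1
      then show ?thesis using B(2) by (auto simp: mon_unit coord_def)
    next
      case 2
      then obtain m where m: "m \<in> M" "n = lookup m" using NM by (auto simp: tight_def)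
      have "mon t = embed (single m 1) / embed f"
        unfolding ef embed_monomial 2(2) m(2) by (rule mon_diff)
      then show ?thesis using B(3)[OF monomial_in_rational_ideal[OF m(1)]] by simp
    qed
  qed
  have wT: "(\<Sum>i\<in>UNIV. t i * int (w i)) = 0" if t: "t \<in> T" for t
  proof -
    consider i where "w i = 0" "t = (\<lambda>j. if j = i then 1 else 0)" | n where "n \<in> tight N w" "t = (\<lambda>j. int (n j) - int (n0 j))"
      using t by (auto simp: T_def)
    then show ?thesis
    proof cases
      case 1
      then show ?thesis by (intro sum.neutral) auto
    next
      case 2
      then have "int (dotp n w) = int (dotp n0 w)" using n0 by (simp add: tight_def)
      then show ?thesis by (simp add: 2(2) dotp_def left_diff_distrib sum_subtractf)
    qed
  qed
  have fractions: "\<exists>a\<in>A. \<exists>b\<in>A. b \<noteq> 0 \<and> mval w b = 0 \<and> z = a / b" if z: "z \<in> mval.vge w 0" for z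
  proof (cases "z = 0")
    case True
    then show ?thesis using subring_closed(1,2)[OF A(1)] by (intro bexI[of _ 0] bexI[of _ 1]) auto
  next
    case False
    obtain g h where gh: "z = embed g / embed h" "h \<noteq> 0" by (rule funfield_cases)
    then have g: "g \<noteq> 0" using False by auto
    obtain m1 where m1: "m1 \<in> keys h" "dotp (lookup m1) w = min_weight w h"
      using min_weight_attained[OF gh(2)] by blast
    have hg: "min_weight w h \<le> min_weight w g"
      using z False unfolding gh(1) by (simp add: mval.vge_iff mval_quotient g gh(2))
    define S where "S = keys g \<union> keys h"
    \<comment> \<open>Numerator and denominator are multiplied by the same Laurent monomial:
      \<open>m1\<close> shifts the least weight of the denominator to 0, and a large multiple of the
      sum of \<open>T\<close>, which has weight 0, moves every monomial into the normalized
      chart.\<close>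
    define u where "u n i = - int (lookup m1 i) + int n * (\<Sum>t\<in>T. t i)" for n :: nat and i
    have "\<exists>K. \<forall>n\<ge>K. mon (\<lambda>i. int (lookup m i) + u n i) \<in> A" if m: "m \<in> S" for m
    proof -
      have "min_weight w h \<le> dotp (lookup m) w"
        using m hg min_weight_le[of m g w] min_weight_le[of m h w] by (auto simp: S_def)
      then have "int (dotp (lookup m1) w) \<le> int (dotp (lookup m) w)" using m1(2) by simp
      then have "0 \<le> (\<Sum>i\<in>UNIV. (int (lookup m i) + - int (lookup m1 i)) * int (w i))"
        by (simp add: dotp_def left_diff_distrib sum_subtractf)
      from mon_in_chart[OF n0 B(1,2) monT[unfolded T_def] this, folded T_def A_def]
      show ?thesis by (simp only: u_def add.assoc)
    qed
    then have "\<forall>m\<in>S. \<exists>K. \<forall>n\<ge>K. mon (\<lambda>i. int (lookup m i) + u n i) \<in> A" by blast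
    from bchoice[OF this] obtain K where
      K: "\<forall>m\<in>S. \<forall>n\<ge>K m. mon (\<lambda>i. int (lookup m i) + u n i) \<in> A" ..
    define n where "n = (\<Sum>m\<in>S. K m)"
    have "K m \<le> n" if "m \<in> S" for m unfolding n_def using that by (intro member_le_sum) (auto simp: S_def)
    then have monA: "mon (\<lambda>i. int (lookup m i)) * mon (u n) \<in> A" if "m \<in> S" for m
      using K that unfolding mon_add[symmetric] by blast
    have shift: "embed e * mon (u n) \<in> A" if e: "keys e \<subseteq> S" for e
    proof -
      have "embed e * mon (u n) = (\<Sum>m\<in>keys e. const (lookup e m) *
          (mon (\<lambda>i. int (lookup m i)) * mon (u n)))"
        unfolding embed_expand[of e] sum_distrib_right mult.assoc ..
      also have "\<dots> \<in> A"
      proof (rule subring_sum[OF A(1)], rule subring_closed(4)[OF A(1)])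
        fix m assume "m \<in> keys e"
        then show "mon (\<lambda>i. int (lookup m i)) * mon (u n) \<in> A" using monA e by blast
        show "const (lookup e m) \<in> A" using A(3) B(2) by (auto simp: const_def)
      qed
      finally show ?thesis .
    qed
    have "(\<Sum>i\<in>UNIV. (\<Sum>t\<in>T. t i) * int (w i)) = 0"
      unfolding sum_distrib_right by (subst sum.swap) (simp add: wT)
    moreover have "u n i * int (w i) = int n * ((\<Sum>t\<in>T. t i) * int (w i)) - int (lookup m1 i * w i)" for i
      by (simp add: u_def algebra_simps)
    then have "(\<Sum>i\<in>UNIV. u n i * int (w i)) = int n * (\<Sum>i\<in>UNIV. (\<Sum>t\<in>T. t i) * int (w i)) - int (min_weight w h)"
      unfolding m1(2)[symmetric] dotp_def by (simp only: sum_subtractf sum_distrib_left of_nat_sum of_nat_id)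
    ultimately have "mval w (embed h * mon (u n)) = 0"
      using gh(2) by (simp add: mval.v_mult mval_embed mval_mon)
    moreover have "z = embed g * mon (u n) / (embed h * mon (u n))" by (simp add: gh(1))
    ultimately show ?thesis
      using shift[of g] shift[of h] gh(2)
      by (intro bexI[of _ "embed g * mon (u n)"] bexI[of _ "embed h * mon (u n)"]) (auto simp: S_def)
  qed
  obtain i where "w i \<noteq> 0" by (rule ex_positive)
  moreover have "coord i \<in> A" using A(3) B(2) by (auto simp: coord_def)
  ultimately have "coord i \<in> A \<inter> mval.vge w 1" by (simp add: mval.vge_iff mval_coord)
  then have "A \<inter> mval.vge w 1 \<noteq> {0}" using coord_nonzero[of i] by blast
  then have "height_one_prime A (A \<inter> mval.vge w 1)"
    by (intro V.height_one_center A(1,2) fractions)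
  moreover have "localization_at A (A \<inter> mval.vge w 1) = mval.vge w 0"
    by (intro V.localization_at_center A(1,2) fractions)
  ultimately have "\<exists>f P. mval.vge w 0 = localization_at (integral_closure (blowup_chart ?J f)) P \<and>
      f \<in> ?J \<and> f \<noteq> 0 \<and> height_one_prime (integral_closure (blowup_chart ?J f)) P"
    using fJ f0 unfolding A_def B_def by metis
  then show ?thesis unfolding prime_divisors_def by simp
qed

end

section \<open>Derivations\<close>

lemma derivation_simps:
  fixes D :: "'a::field \<Rightarrow> 'a"
  assumes "derivation D"
  shows "D (a + b) = D a + D b" "D (a * b) = a * D b + b * D a" "D 0 = 0" "D 1 = 0" "D (- a) = - D a"
    "D (a - b) = D a - D b"
proof -
  show add: "D (a + b) = D a + D b" for a b using assms by (simp add: derivation_def)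
  show mult: "D (a * b) = a * D b + b * D a" for a b using assms by (simp add: derivation_def)
  show 0: "D 0 = 0" using mult[of 0 0] by simp
  have "D 1 + D 1 = D 1 + 0" using mult[of 1 1] by (simp only: mult_1 add_0_right)
  then show "D 1 = 0" by (rule add_left_imp_eq)
  show minus: "D (- a) = - D a" for a using add[of a "- a"] 0 by (simp add: eq_neg_iff_add_eq_0 add.commute)
  show "D (a - b) = D a - D b" using add[of a "- b"] minus by simp
qed

lemma derivation_sum: "derivation D \<Longrightarrow> D (sum f S) = (\<Sum>x\<in>S. D (f x))"
  by (induction S rule: infinite_finite_induct) (simp_all add: derivation_simps)

lemma derivation_of_int: "derivation D \<Longrightarrow> D (of_int n) = 0"
proof -
  assume D: "derivation D"
  have "D (of_nat k) = 0" for k by (induction k) (simp_all add: derivation_simps[OF D])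
  then show ?thesis by (cases n) (simp_all add: derivation_simps[OF D] del: of_nat_Suc)
qed

lemma derivation_divide:
  assumes D: "derivation D" and "b \<noteq> 0"
  shows "D (a / b) = (b * D a - a * D b) / b ^ 2"
proof -
  have "D a = D (a / b * b)" using assms by simp
  also have "\<dots> = a / b * D b + b * D (a / b)" by (rule derivation_simps(2)[OF D])
  finally show ?thesis using assms(2) by (simp add: field_simps power2_eq_square)
qed

lemma derivation_powi:
  assumes D: "derivation D" and "a \<noteq> 0"
  shows "D (a powi n) = a powi n * (of_int n * (D a / a))"
proof -
  have nat: "D (a ^ k) = a ^ k * (of_nat k * (D a / a))" for k
    using assms(2) by (induction k) (simp_all add: derivation_simps[OF D] field_simps)
  show ?thesis
  proof (cases "n \<ge> 0")
    case True
    then show ?thesis using nat[of "nat n"] by (simp add: power_int_def)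
  next
    case False
    define k where "k = nat (- n)"
    have n: "n = - int k" using False by (simp add: k_def)
    have "D (1 / a ^ k) = - D (a ^ k) / (a ^ k) ^ 2"
      using assms(2) derivation_divide[OF D, of "a ^ k" 1] by (simp add: derivation_simps[OF D])
    then show ?thesis
      using assms(2) unfolding n nat by (simp add: power_int_minus field_simps power2_eq_square)
  qed
qed

lemma derivation_prod_log:
  assumes D: "derivation D" and "finite S" "\<And>i. i \<in> S \<Longrightarrow> f i \<noteq> 0"
  shows "D (prod f S) = prod f S * (\<Sum>i\<in>S. D (f i) / f i)"
  using assms(2,3)
  by (induction S rule: finite_induct) (simp_all add: derivation_simps[OF D] field_simps)

lemma derivation_mon:
  assumes D: "derivation D"
  shows "D (mon q) = mon q * (\<Sum>i\<in>UNIV. of_int (q i) * (D (coord i) / coord i))"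
  unfolding mon_def by (subst derivation_prod_log[OF D]) (simp_all add: derivation_powi[OF D])

lemma const_of_int: "const (of_int n) = of_int n"
proof (cases n)
  have nat: "const (of_nat k) = of_nat k" for k by (induction k) simp_all
  { case (nonneg k)
    then show ?thesis using nat[of k] by simp
  next
    case (neg k)
    have "const (of_int n) + const (of_nat (Suc k)) = const (of_int n + of_nat (Suc k))" by (rule const_simps(3)[symmetric])
    also have "of_int n + of_nat (Suc k) = (0 :: rat)" by (simp add: neg)
    finally have "const (of_int n) = - const (of_nat (Suc k))" by (simp only: const_simps(1) eq_neg_iff_add_eq_0)
    then show ?thesis unfolding neg by (simp only: nat of_int_minus of_int_of_nat_eq) }
qed

lemma const_sum: "const (sum f S) = (\<Sum>x\<in>S. const (f x))"
  by (induction S rule: infinite_finite_induct) simp_all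

lemma derivation_const:
  fixes D :: "'n::{finite,linorder} funfield \<Rightarrow> 'n funfield"
  assumes D: "derivation D"
  shows "D (const c) = 0"
proof -
  obtain a b where "c = of_int a / of_int b" "b > 0"
    by (metis quotient_of_denom_pos quotient_of_div surj_pair)
  then have "c * of_int b = of_int a" by simp
  then have "const c * of_int b = (of_int a :: 'n funfield)" by (metis const_of_int const_simps(4))
  then have "D (const c * of_int b) = 0" using derivation_of_int[OF D] by simp
  then have "of_int b * D (const c) = 0" by (simp add: derivation_simps(2)[OF D] derivation_of_int[OF D])
  moreover have "of_int b \<noteq> (0 :: 'n funfield)"
    using \<open>b > 0\<close> const_of_int[of b] const_simps(5)[of "of_int b"] by (metis of_int_eq_0_iff order_less_irrefl)
  ultimately show ?thesis by simp
qed

text \<open>Constants are rational and killed by every derivation; the coordinates then decide on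
  polynomials, and the quotient rule on fractions.\<close>

lemma derivation_eq_0I:
  assumes D: "derivation D" and coord: "\<And>i. D (coord i) = 0"
  shows "D z = 0"
proof -
  have e: "D (embed f) = 0" for f
    unfolding embed_expand[of f] by (simp add: derivation_sum[OF D] derivation_simps[OF D] derivation_const[OF D] derivation_mon[OF D] coord)
  obtain a b where "z = embed a / embed b" "b \<noteq> 0" by (rule funfield_cases)
  then show ?thesis by (simp add: derivation_divide[OF D] e)
qed

lemma derivation_combination:
  assumes "\<And>k. derivation (D k)" "derivation D'"
  shows "derivation (\<lambda>z. D' z - (\<Sum>k\<in>S. c k * D k z))"
  unfolding derivation_def
proof (intro allI conjI)
  fix a b
  show "D' (a + b) - (\<Sum>k\<in>S. c k * D k (a + b)) = D' a - (\<Sum>k\<in>S. c k * D k a) + (D' b - (\<Sum>k\<in>S. c k * D k b))"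
    by (simp add: derivation_simps[OF assms(1)] derivation_simps[OF assms(2)] distrib_left sum.distrib)
  show "D' (a * b) - (\<Sum>k\<in>S. c k * D k (a * b))
      = a * (D' b - (\<Sum>k\<in>S. c k * D k b)) + b * (D' a - (\<Sum>k\<in>S. c k * D k a))"
    by (simp add: derivation_simps(2)[OF assms(1)] derivation_simps(2)[OF assms(2)] distrib_left right_diff_distrib
        sum.distrib sum_distrib_left mult_ac)
qed

text \<open>The logarithmic derivation \<open>x\<^sup>m \<mapsto> l(m) x\<^sup>m\<close> of a linear functional \<open>l\<close>, first on polynomials and then, by the quotient rule, on the function field.\<close>

definition log_deriv_poly :: "('n \<Rightarrow> rat) \<Rightarrow> ('n::finite, rat) mpolynomial \<Rightarrow> ('n, rat) mpolynomial" where
  "log_deriv_poly l = Poly_Mapping.mapp (\<lambda>m c. (\<Sum>i\<in>UNIV. l i * of_nat (lookup m i)) * c)"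

lemma lookup_log_deriv_poly:
  "lookup (log_deriv_poly l f) m = (\<Sum>i\<in>UNIV. l i * of_nat (lookup m i)) * lookup f m"
  by (simp add: log_deriv_poly_def lookup_mapp when_def in_keys_iff)

lemma log_deriv_poly_add: "log_deriv_poly l (f + g) = log_deriv_poly l f + log_deriv_poly l g"
  by (rule poly_mapping_eqI) (simp add: lookup_log_deriv_poly lookup_add distrib_left)

lemma log_deriv_poly_0 [simp]: "log_deriv_poly l 0 = 0"
  by (rule poly_mapping_eqI) (simp add: lookup_log_deriv_poly)

lemma log_deriv_poly_single:
  "log_deriv_poly l (single m c) = single m ((\<Sum>i\<in>UNIV. l i * of_nat (lookup m i)) * c)"
  by (rule poly_mapping_eqI) (simp add: lookup_log_deriv_poly lookup_single when_def)

lemma poly_mapping_additive_induct: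
  assumes "P 0" "\<And>m c. P (single m c)" "\<And>f g. P f \<Longrightarrow> P g \<Longrightarrow> P (f + g)"
  shows "P (f :: ('n, 'a::comm_monoid_add) mpolynomial)"
proof -
  have "P (\<Sum>m\<in>S. single m (lookup f m))" for S
    by (induction S rule: infinite_finite_induct) (auto intro: assms)
  moreover have "(\<Sum>m\<in>keys f. single m (lookup f m)) = f"
    by (rule poly_mapping_eqI) (auto simp: lookup_sum lookup_single when_def in_keys_iff)
  ultimately show ?thesis by metis
qed

lemma log_deriv_poly_mult: "log_deriv_poly l (f * g) = f * log_deriv_poly l g + g * log_deriv_poly l f"
proof (induction f rule: poly_mapping_additive_induct)
  case (2 a x)
  show ?case
  proof (induction g rule: poly_mapping_additive_induct)
    case (2 b y)
    show ?case
      by (simp add: mult_single log_deriv_poly_single lookup_add distrib_left distrib_right sum.distrib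
          add.commute[of b a] algebra_simps flip: single_add)
  qed (simp_all add: log_deriv_poly_add distrib_left distrib_right)
qed (simp_all add: log_deriv_poly_add distrib_left distrib_right)

definition log_deriv :: "('n \<Rightarrow> rat) \<Rightarrow> 'n::{finite,linorder} funfield \<Rightarrow> 'n funfield" where
  "log_deriv l z = (SOME d. \<exists>a b. b \<noteq> 0 \<and> z = embed a / embed b \<and>
     d = embed (b * log_deriv_poly l a - a * log_deriv_poly l b) / embed b ^ 2)"

lemma log_deriv_quotient:
  assumes "b \<noteq> 0"
  shows "log_deriv l (embed a / embed b) = embed (b * log_deriv_poly l a - a * log_deriv_poly l b) / embed b ^ 2"
  unfolding log_deriv_def
proof (rule some_equality)
  fix d assume "\<exists>a' b'. b' \<noteq> 0 \<and> embed a / embed b = embed a' / embed b' \<and>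
     d = embed (b' * log_deriv_poly l a' - a' * log_deriv_poly l b') / embed b' ^ 2"
  then obtain a' b' where *: "b' \<noteq> 0" "embed a / embed b = embed a' / embed b'"
    "d = embed (b' * log_deriv_poly l a' - a' * log_deriv_poly l b') / embed b' ^ 2" by blast
  let ?\<delta> = "log_deriv_poly l"
  have "embed (a * b') = embed (a' * b)" using * assms by (simp add: field_simps)
  then have eq: "a * b' = a' * b" by (metis eq_iff_diff_eq_0 embed_simps(4,6))
  \<comment> \<open>Differentiating the cross-multiplied equality shows that the quotient rule does
    not depend on the representation.\<close>
  then have "a * ?\<delta> b' + b' * ?\<delta> a = a' * ?\<delta> b + b * ?\<delta> a'" by (metis log_deriv_poly_mult)
  then have "(b' * ?\<delta> a' - a' * ?\<delta> b') * b\<^sup>2 = (b * ?\<delta> a - a * ?\<delta> b) * b'\<^sup>2"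
    using eq by algebra
  then have "embed (b' * ?\<delta> a' - a' * ?\<delta> b') * embed b ^ 2 = embed (b * ?\<delta> a - a * ?\<delta> b) * embed b' ^ 2"
    by (metis embed_power embed_simps(5))
  then show "d = embed (b * ?\<delta> a - a * ?\<delta> b) / embed b ^ 2"
    using *(1) assms unfolding *(3) by (simp add: frac_eq_eq del: embed_simps(3-5))
qed (use assms in blast)

lemma derivation_log_deriv: "derivation (log_deriv l)"
  unfolding derivation_def
proof (intro allI conjI)
  fix x y :: "'a funfield"
  obtain a b where x: "x = embed a / embed b" "b \<noteq> 0" by (rule funfield_cases)
  obtain c d where y: "y = embed c / embed d" "d \<noteq> 0" by (rule funfield_cases)
  have s: "x + y = embed (a * d + c * b) / embed (b * d)" and p: "x * y = embed (a * c) / embed (b * d)"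
    using x y by (simp_all add: field_simps)
  have bd: "b * d \<noteq> 0" using x y by simp
  show "log_deriv l (x + y) = log_deriv l x + log_deriv l y"
    unfolding s unfolding x(1) y(1) log_deriv_quotient[OF bd] log_deriv_quotient[OF x(2)] log_deriv_quotient[OF y(2)]
    using x(2) y(2) by (simp add: log_deriv_poly_mult log_deriv_poly_add field_simps power2_eq_square)
  show "log_deriv l (x * y) = x * log_deriv l y + y * log_deriv l x"
    unfolding p unfolding x(1) y(1) log_deriv_quotient[OF bd] log_deriv_quotient[OF x(2)] log_deriv_quotient[OF y(2)]
    using x(2) y(2) by (simp add: log_deriv_poly_mult field_simps power2_eq_square)
qed

lemma log_deriv_coord: "log_deriv l (coord i) = const (l i) * coord i"
proof -
  have "log_deriv l (embed a / embed 1) = embed (log_deriv_poly l a)" for a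
    using log_deriv_poly_single[of l 0 1] by (subst log_deriv_quotient) simp_all
  moreover have "(\<Sum>j\<in>UNIV. l j * of_nat (1 when i = j)) = (\<Sum>j\<in>UNIV. if i = j then l j else 0)"
    by (intro sum.cong) (auto simp: when_def)
  ultimately show ?thesis
    by (simp add: coord_def log_deriv_poly_single lookup_single const_def mult_single flip: embed_simps(5))
qed

lemma log_deriv_mon: "log_deriv l (mon q) = mon q * const (\<Sum>i\<in>UNIV. l i * of_int (q i))"
  by (simp add: derivation_mon[OF derivation_log_deriv] log_deriv_coord const_sum const_of_int mult.commute)

lemma weight_ge_log_deriv_poly: "weight_ge w k f \<Longrightarrow> weight_ge w k (log_deriv_poly l f)"
  by (auto simp: weight_ge_def in_keys_iff lookup_log_deriv_poly)

text \<open>On polynomials the derivation rescales coefficients and creates no monomials, so no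
  weight drops in the quotient rule.\<close>

lemma log_deriv_vge:
  assumes "z \<in> mval.vge w k"
  shows "log_deriv l z \<in> mval.vge w k"
proof (cases "z = 0")
  case True
  then show ?thesis by (simp add: derivation_simps(3)[OF derivation_log_deriv])
next
  case False
  obtain a b where z: "z = embed a / embed b" "b \<noteq> 0" by (rule funfield_cases)
  then have a: "a \<noteq> 0" using False by auto
  let ?n = "b * log_deriv_poly l a - a * log_deriv_poly l b"
  have wa: "weight_ge w (min_weight w a) a" and wb: "weight_ge w (min_weight w b) b"
    using a z(2) by (simp_all add: weight_ge_iff)
  have "weight_ge w (min_weight w b + min_weight w a) ?n"
    using weight_ge_diff[OF weight_ge_mult[OF wb weight_ge_log_deriv_poly[OF wa]]
        weight_ge_mult[OF wa weight_ge_log_deriv_poly[OF wb], unfolded add.commute[of "min_weight w a"]]] .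
  then have "embed ?n \<in> mval.vge w (int (min_weight w b + min_weight w a))" by (simp only: embed_vge_iff)
  moreover have "1 / embed b ^ 2 \<in> mval.vge w (- 2 * int (min_weight w b))"
    using z(2) by (simp add: mval.vge_iff mval.v_divide mval.v_power mval_embed)
  ultimately have "embed ?n * (1 / embed b ^ 2) \<in> mval.vge w (int (min_weight w b + min_weight w a) + - 2 * int (min_weight w b))"
    by (rule mval.vge_mult)
  moreover have "k \<le> int (min_weight w b + min_weight w a) + - 2 * int (min_weight w b)"
    using assms False a z by (simp add: mval.vge_iff mval_quotient)
  ultimately show ?thesis
    using mval.vge_mono unfolding z(1) log_deriv_quotient[OF z(2)] by (auto simp del: embed_simps)
qed

text \<open>In the direction of \<open>w\<close> itself, \<open>log_deriv\<close> multiplies the leading forms of numerator and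
  denominator by their common weight, so these cancel.\<close>

lemma log_deriv_weight_vge:
  assumes "z \<in> mval.vge w 0"
  shows "log_deriv (\<lambda>i. of_nat (w i)) z \<in> mval.vge w 1"
proof (cases "z \<in> mval.vge w 1")
  case True
  then show ?thesis by (rule log_deriv_vge)
next
  case False
  obtain a b where z: "z = embed a / embed b" "b \<noteq> 0" by (rule funfield_cases)
  then have a: "a \<noteq> 0" using False by auto
  let ?\<delta> = "log_deriv_poly (\<lambda>i. of_nat (w i))" and ?n = "b * log_deriv_poly (\<lambda>i. of_nat (w i)) a - a * log_deriv_poly (\<lambda>i. of_nat (w i)) b"
  define c where "c = min_weight w b"
  have ca: "min_weight w a = c"
    using assms False a z by (simp add: mval.vge_iff mval_quotient c_def)
  define s :: "('a, rat) mpolynomial" where "s = single 0 (of_nat c)"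
  \<comment> \<open>Subtracting c times \<open>f\<close> removes the terms of weight
    \<open>c\<close> from the derivative; the two corrections, for numerator and denominator, cancel
    in the quotient rule.\<close>
  have key: "weight_ge w (c + 1) (?\<delta> f - s * f)" if f: "weight_ge w c f" for f
    unfolding weight_ge_def
  proof
    fix m assume m: "m \<in> keys (?\<delta> f - s * f)"
    have sf: "lookup (s * f) m = of_nat c * lookup f m"
      unfolding s_def mult_map_scale_conv_mult[symmetric] by (simp add: map.rep_eq when_def)
    have "(\<Sum>i\<in>UNIV. of_nat (w i) * of_nat (lookup m i)) = (of_nat (dotp (lookup m) w) :: rat)"
      by (simp add: dotp_def mult.commute)
    then have "lookup (?\<delta> f - s * f) m = (of_nat (dotp (lookup m) w) - of_nat c) * lookup f m"
      by (simp add: lookup_minus sf lookup_log_deriv_poly left_diff_distrib)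
    then have "m \<in> keys f" "dotp (lookup m) w \<noteq> c" using m by (auto simp: in_keys_iff)
    then show "c + 1 \<le> dotp (lookup m) w" using f by (force simp: weight_ge_def)
  qed
  have wa: "weight_ge w c a" and wb: "weight_ge w c b"
    using a z(2) ca by (simp_all add: weight_ge_iff c_def)
  have "weight_ge w (c + (c + 1)) (b * (?\<delta> a - s * a) - a * (?\<delta> b - s * b))"
    by (rule weight_ge_diff[OF weight_ge_mult[OF wb key[OF wa]] weight_ge_mult[OF wa key[OF wb]]])
  moreover have "b * (?\<delta> a - s * a) - a * (?\<delta> b - s * b) = ?n" by (simp add: algebra_simps)
  ultimately have "embed ?n \<in> mval.vge w (int (c + (c + 1)))" by (simp only: embed_vge_iff)
  moreover have "1 / embed b ^ 2 \<in> mval.vge w (- 2 * int c)"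
    using z(2) by (simp add: mval.vge_iff mval.v_divide mval.v_power mval_embed c_def)
  ultimately have "embed ?n * (1 / embed b ^ 2) \<in> mval.vge w (int (c + (c + 1)) + - 2 * int c)"
    by (rule mval.vge_mult)
  then show ?thesis unfolding z(1) log_deriv_quotient[OF z(2)] by (simp del: embed_simps)
qed


section \<open>The canonical order of a facet divisor\<close>

lemma det_in_subring:
  fixes A :: "'a::comm_ring_1 ^ 'n ^ 'n"
  assumes S: "is_subring S" and "\<And>i j. A $ i $ j \<in> S"
  shows "det A \<in> S"
proof -
  have "of_nat k \<in> S" for k by (induction k) (auto intro: subring_closed[OF S])
  then have "of_int n \<in> S" for n by (cases n) (auto intro: subring_closed[OF S] simp del: of_nat_Suc)
  then show ?thesis
    unfolding det_def using assms(2) by (intro subring_sum[OF S] subring_closed(4)[OF S] subring_prod[OF S])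
qed

lemma (in field_valuation) det_unit:
  fixes A B :: "'a ^ 'n ^ 'n"
  assumes "A ** B = mat 1" "\<And>i j. A $ i $ j \<in> vge 0" "\<And>i j. B $ i $ j \<in> vge 0"
  shows "det A \<noteq> 0" "v (det A) = 0"
proof -
  have *: "det A * det B = 1" using assms(1) by (metis det_I det_mul)
  then show nz: "det A \<noteq> 0" by auto
  have "det B \<noteq> 0" using * by auto
  then have "v (det A) + v (det B) = 0" using v_mult[OF nz, of "det B"] * by simp
  moreover have "det A \<in> vge 0" "det B \<in> vge 0" using assms(2,3) by (auto intro: det_in_subring[OF vge_subring])
  ultimately show "v (det A) = 0" using nz \<open>det B \<noteq> 0\<close> by (simp add: vge_iff)
qed

text \<open>Jacobians of logarithmic derivations have this shape: a matrix of constants between two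
  diagonal ones.\<close>

lemma det_scale_rows_columns:
  fixes L :: "'n::finite \<Rightarrow> 'n \<Rightarrow> 'a::comm_ring_1"
  shows "det (\<chi> i j. x i * L i j * z j) = prod x UNIV * prod z UNIV * det (\<chi> i j. L i j)"
proof -
  have "det (\<chi> i j. x i * L i j * z j) = det (\<chi> i. x i *s (\<chi> j. L i j * z j))"
    by (intro arg_cong[where f = det]) (simp add: vec_eq_iff mult.assoc)
  also have "\<dots> = prod x UNIV * det (\<chi> i. (\<chi> j. L i j * z j))" by (rule det_rows_mul)
  also have "det (\<chi> i. (\<chi> j. L i j * z j)) = det (transpose (\<chi> i. (\<chi> j. L i j * z j)))" by (rule det_transpose[symmetric])
  also have "transpose (\<chi> i. (\<chi> j. L i j * z j)) = (\<chi> j. z j *s (\<chi> i. L i j))"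
    by (simp add: vec_eq_iff transpose_def mult.commute)
  also have "det \<dots> = prod z UNIV * det (\<chi> j. (\<chi> i. L i j))" by (rule det_rows_mul)
  also have "det (\<chi> j. (\<chi> i. L i j)) = det (transpose (\<chi> i j. L i j))"
    by (intro arg_cong[where f = det]) (simp add: vec_eq_iff transpose_def)
  finally show ?thesis by (simp add: det_transpose mult.assoc)
qed

context facet_divisor
begin

lemma canonical_order_facet: "canonical_order (mval.vge w 0) = int (\<Sum>i\<in>UNIV. w i) - 1"
proof -
  obtain i0 where i0: "w i0 \<noteq> 0" by (rule ex_positive)
  have "Gcd (range w) = 1" using facet by (simp add: facet_normal_def)
  then obtain u where u: "(\<Sum>i\<in>UNIV. u i * int (w i)) = 1" using bezout_Gcd[of UNIV w] by auto
  text \<open>The monomials with exponents \<open>U k\<close> are local coordinates although \<open>U\<close> need not be unimodular: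
    its determinant is a unit because the residue field has characteristic \<open>0\<close>. The rows of \<open>L\<close> form
    the dual basis.\<close>
  define U where "U k i = (if k = i0 then u i else (if i = k then int (w i0) else 0) - (if i = i0 then int (w k) else 0))" for k i
  define L :: "'n \<Rightarrow> 'n \<Rightarrow> rat" where
    "L j i = (if j = i0 then of_nat (w i) else ((if i = j then 1 else 0) - of_int (u j) * of_nat (w i)) / of_nat (w i0))" for j i
  have wU: "(\<Sum>i\<in>UNIV. U k i * int (w i)) = (if k = i0 then 1 else 0)" for k
  proof (cases "k = i0")
    case False
    have "(\<Sum>i\<in>UNIV. U k i * int (w i)) = (\<Sum>i\<in>UNIV. (if i = k then int (w i0) * int (w i) else 0) - (if i = i0 then int (w k) * int (w i) else 0))"
      using False by (intro sum.cong) (auto simp: U_def)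
    then show ?thesis using False by (simp add: sum_subtractf mult.commute)
  qed (simp add: U_def u)
  have wU': "(\<Sum>i\<in>UNIV. of_nat (w i) * of_int (U k i)) = (if k = i0 then 1 else (0 :: rat))" for k
  proof -
    have "(\<Sum>i\<in>UNIV. of_nat (w i) * of_int (U k i)) = (of_int (\<Sum>i\<in>UNIV. U k i * int (w i)) :: rat)"
      by (simp add: mult.commute)
    then show ?thesis by (simp add: wU)
  qed
  have LU: "(\<Sum>i\<in>UNIV. L j i * of_int (U k i)) = (if j = k then 1 else 0)" for j k
  proof (cases "j = i0")
    case True
    then show ?thesis using wU'[of k] by (simp add: L_def)
  next
    case False
    have "(\<Sum>i\<in>UNIV. L j i * of_int (U k i))
        = (\<Sum>i\<in>UNIV. (if i = j then of_int (U k i) else 0) - of_int (u j) * (of_nat (w i) * of_int (U k i))) / of_nat (w i0)"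
      unfolding sum_divide_distrib using False by (intro sum.cong) (auto simp: L_def field_simps)
    also have "\<dots> = (of_int (U k j) - of_int (u j) * (if k = i0 then 1 else 0)) / of_nat (w i0)"
      by (simp add: sum_subtractf wU' flip: sum_distrib_left)
    also have "\<dots> = (if j = k then 1 else 0)" using False i0 by (auto simp: U_def)
    finally show ?thesis .
  qed
  define y where "y k = mon (U k)" for k
  have vy: "mval w (y k) = (if k = i0 then 1 else 0)" for k by (simp add: y_def mval_mon wU)
  have y0: "y k \<noteq> 0" for k by (simp add: y_def)
  define D where "D j z = log_deriv (L j) z / y j" for j z
  have derD: "derivation (D j)" for j
    unfolding derivation_def D_def
    by (simp add: derivation_simps[OF derivation_log_deriv] add_divide_distrib)
  have Dy: "D j (y k) = (if k = j then 1 else 0)" for j k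
    using y0[of k] unfolding D_def y_def log_deriv_mon LU by auto
  \<comment> \<open>Only \<open>y i0\<close> has positive value. Dividing by it costs 1, which the
    derivation in the direction \<open>w\<close> makes up for; the other \<open>y j\<close> are
    units.\<close>
  have DE: "D j z \<in> mval.vge w 0" if z: "z \<in> mval.vge w 0" for j z
  proof -
    have "log_deriv (L j) z \<in> mval.vge w (if j = i0 then 1 else 0)"
    proof (cases "j = i0")
      case True
      then have "L j = (\<lambda>i. of_nat (w i))" by (auto simp: L_def)
      then show ?thesis using True log_deriv_weight_vge[OF z] by simp
    qed (use log_deriv_vge[OF z] in simp)
    moreover have "1 / y j \<in> mval.vge w (- (if j = i0 then 1 else 0))"
      using y0[of j] by (simp add: mval.vge_iff mval.v_divide vy)
    ultimately have "log_deriv (L j) z * (1 / y j) \<in> mval.vge w ((if j = i0 then 1 else 0) + - (if j = i0 then 1 else 0))"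
      by (rule mval.vge_mult)
    then show ?thesis by (simp add: D_def)
  qed
  have local: "local_coordinates (mval.vge w 0) y D"
    unfolding local_coordinates_def using y0 vy derD DE Dy by (auto simp: mval.vge_iff)
  define Lm where "Lm = (\<chi> j i. (const (L j i) :: 'n funfield))"
  define Um where "Um = (\<chi> i k. (of_int (U k i) :: 'n funfield))"
  have LmUm: "Lm ** Um = mat 1"
    unfolding Lm_def Um_def
    by (simp add: vec_eq_iff matrix_matrix_mult_def mat_def LU flip: const_of_int const_simps(4) const_sum)
  have const_vge: "const c \<in> mval.vge w 0" for c
    by (cases "c = 0") (simp_all add: mval.vge_iff mval_const)
  have detL: "det Lm \<noteq> 0" "mval w (det Lm) = 0"
    using mval.det_unit[OF LmUm, of w] by (simp_all add: Lm_def Um_def const_vge flip: const_of_int)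
  define Jac where "Jac = (\<chi> i j. D j (coord i))"
  \<comment> \<open>Up to the unit \<open>det Lm\<close>, the Jacobian determinant is the product of
    the coordinates, of value |w|, divided by the product of all \<open>y j\<close>, of value
    1.\<close>
  have "Jac = (\<chi> i j. coord i * const (L j i) * (1 / y j))"
    by (simp add: Jac_def vec_eq_iff D_def log_deriv_coord mult.commute)
  then have "det Jac = prod coord UNIV * (\<Prod>j\<in>UNIV. 1 / y j) * det (\<chi> i j. const (L j i))"
    by (simp only: det_scale_rows_columns)
  also have "(\<chi> i j. const (L j i)) = transpose Lm" by (simp add: vec_eq_iff transpose_def Lm_def)
  finally have dJ: "det Jac = prod coord UNIV * (\<Prod>j\<in>UNIV. 1 / y j) * det Lm" by (simp only: det_transpose)
  have Jac: "det Jac \<noteq> 0" "mval w (det Jac) = int (\<Sum>i\<in>UNIV. w i) - 1"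
  proof -
    show "det Jac \<noteq> 0" using detL(1) y0 by (simp add: dJ)
    have "mval w (det Jac) = (\<Sum>i\<in>UNIV. int (w i)) + (\<Sum>j\<in>UNIV. - (if j = i0 then 1 else 0))"
      unfolding dJ using detL y0 by (simp add: mval.v_mult mval.v_prod mval.v_divide mval_coord vy)
    then show "mval w (det Jac) = int (\<Sum>i\<in>UNIV. w i) - 1" by (simp add: sum_negf)
  qed
  have UmLm: "Um ** Lm = mat 1" using LmUm matrix_left_right_inverse by blast
  \<comment> \<open>The difference \<Gamma> of the two sides kills every \<open>y k\<close>. For
    monomials this is a linear system in the logarithmic derivatives of the coordinates with
    invertible matrix \<open>Um\<close>, so \<Gamma> kills the coordinates.\<close>
  have chain: "\<Delta> z = (\<Sum>k\<in>UNIV. \<Delta> (y k) * D k z)" if \<Delta>: "derivation \<Delta>" for \<Delta> z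
  proof -
    define \<Gamma> where "\<Gamma> z = \<Delta> z - (\<Sum>k\<in>UNIV. \<Delta> (y k) * D k z)" for z
    have der: "derivation \<Gamma>" unfolding \<Gamma>_def by (rule derivation_combination[OF derD \<Delta>])
    have \<Gamma>y: "\<Gamma> (y k) = 0" for k by (simp add: \<Gamma>_def Dy if_distrib[of "\<lambda>x. _ * x"] cong: if_cong)
    define r where "r = (\<chi> i. \<Gamma> (coord i) / coord i)"
    have "(\<Sum>i\<in>UNIV. of_int (U k i) * (\<Gamma> (coord i) / coord i)) = 0" for k
      using \<Gamma>y[of k] unfolding y_def derivation_mon[OF der] by simp
    then have "r v* Um = 0"
      by (simp add: vec_eq_iff vector_matrix_mult_def r_def Um_def mult.commute)
    then have "r v* (Um ** Lm) = 0" by (simp flip: vector_matrix_mul_assoc)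
    then have "r = 0" by (simp add: UmLm)
    then have "\<Gamma> (coord i) = 0" for i by (simp add: r_def vec_eq_iff)
    then have "\<Gamma> z = 0" by (rule derivation_eq_0I[OF der])
    then show ?thesis by (simp add: \<Gamma>_def)
  qed
  show ?thesis
    unfolding canonical_order_def
  proof (rule the_equality)
    show "\<exists>y D. local_coordinates (mval.vge w 0) y D \<and>
        int (\<Sum>i\<in>UNIV. w i) - 1 = order_along (mval.vge w 0) (det (\<chi> i j. D j (coord i)))"
      using local V.order_along_eq[OF Jac(1)] Jac(2) unfolding Jac_def by metis
    fix k assume "\<exists>y D. local_coordinates (mval.vge w 0) y D \<and> k = order_along (mval.vge w 0) (det (\<chi> i j. D j (coord i)))"
    then obtain y' D' where lc: "local_coordinates (mval.vge w 0) y' D'"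
      and k: "k = order_along (mval.vge w 0) (det (\<chi> i j. D' j (coord i)))" by blast
    have y': "y' i \<in> mval.vge w 0" and D': "derivation (D' j)" "z \<in> mval.vge w 0 \<Longrightarrow> D' j z \<in> mval.vge w 0"
      "D' j (y' i) = (if i = j then 1 else 0)" for i j z
      using lc unfolding local_coordinates_def by blast+
    \<comment> \<open>\<open>C\<close> changes between the two coordinate systems. By the chain rule
      its inverse \<open>C'\<close> also has entries in the local ring, so its determinant is a unit
      and the order is independent of the coordinates.\<close>
    define C where "C = (\<chi> j k. D' j (y k))"
    define C' where "C' = (\<chi> k i. D k (y' i))"
    have "C ** C' = mat 1"
      using chain[OF D'(1), of _ "y' _"] D'(3)
      by (simp add: C_def C'_def vec_eq_iff matrix_matrix_mult_def mat_def) (metis (no_types))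
    then have C: "det C \<noteq> 0" "mval w (det C) = 0"
      using mval.det_unit[of C C' w] D'(2) DE y' y0 vy by (auto simp: C_def C'_def mval.vge_iff)
    have "(\<chi> i j. D' j (coord i)) = Jac ** transpose C"
      using chain[OF D'(1), of _ "coord _"]
      by (simp add: C_def Jac_def vec_eq_iff matrix_matrix_mult_def transpose_def mult.commute)
    then have "det (\<chi> i j. D' j (coord i)) = det Jac * det C" by (simp add: det_mul det_transpose)
    then show "k = int (\<Sum>i\<in>UNIV. w i) - 1"
      using Jac C unfolding k by (simp add: V.order_along_eq mval.v_mult)
  qed
qed

end

section \<open>Poles and divisors\<close>

theorem theorem1p4:
  fixes I :: "('n::{finite,linorder}, int) mpolynomial set"
    and p :: nat
    and Z :: "complex \<Rightarrow> complex"
    and s :: complex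
  assumes "monomial_ideal I" and "I \<noteq> {0}" and "I \<noteq> UNIV"
    and "prime p"
    and "Z meromorphic_on UNIV"
    and "\<And>z. Re z > 0 \<Longrightarrow> Z z = igusa_zeta p I z"
    and "is_pole Z s"
  shows "\<exists>E\<in>prime_divisors (rational_ideal I).
           torus_invariant E \<and>
           ideal_order E (rational_ideal I) \<noteq> 0 \<and>
           Re s = - (real_of_int (canonical_order E) + 1) / real_of_int (ideal_order E (rational_ideal I))"
proof -
  obtain M where I: "I = monomials_ideal M"
    using assms(1) unfolding monomial_ideal_def monomials_ideal_def by blast
  have "M \<noteq> {}"
    using assms(2) by (auto simp: I monomials_ideal_def ideal_gen_def)
  \<comment> \<open>\<open>M\<close> may be infinite, but a finite dominating set of exponents
    suffices: a larger exponent never lowers the minimum at a vector with natural entries.\<close>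
  obtain N where N: "finite N" "N \<subseteq> lookup ` M"
    "\<And>m. m \<in> M \<Longrightarrow> \<exists>n\<in>N. \<forall>i. n i \<le> lookup m i"
    using dickson_on[of "UNIV :: 'n set" "lookup ` M"] by auto
  have ne: "N \<noteq> {}" using \<open>M \<noteq> {}\<close> N(3) by blast
  define L where "L = ln (real p)"
  have L: "0 < L" using prime_gt_1_nat[OF assms(4)] by (simp add: L_def)
  define P where "P z = (\<Prod>w | facet_normal N w. 1 - lattice_term N L z w)" for z
  obtain G where G: "G holomorphic_on UNIV"
    "\<And>z. 0 < Re z \<Longrightarrow> infsum (lattice_term N L z) UNIV * P z = G z"
    using lattice_sum_continuation[OF N(1) ne L] unfolding P_def by blast
  define c where "c = complex_of_real ((1 - 1 / real p) ^ CARD('n))"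
  have "P s = 0"
  proof (rule pole_of_meromorphic_continuation[OF assms(5) _ _ _ assms(7)])
    show "P holomorphic_on UNIV" unfolding P_def lattice_term_def by (intro holomorphic_intros)
    show "(\<lambda>z. c * G z) holomorphic_on UNIV" by (intro holomorphic_intros G)
    fix z :: complex assume z: "0 < Re z"
    have "Z z = c * infsum (lattice_term N L z) UNIV"
      unfolding assms(6)[OF z] L_def c_def
      by (rule igusa_zeta_eq_infsum[OF assms(4) z I N(1) ne N(2,3)])
    then show "Z z * P z = c * G z" using G(2)[OF z] by simp
  qed
  then obtain w where w: "facet_normal N w" "lattice_term N L s w = 1"
    unfolding P_def using finite_facet_normals[OF N(1) ne] by auto
  interpret F: facet_divisor M N w
    using N ne w(1) by unfold_locales
  let ?a = "newton N w" and ?k = "\<Sum>i\<in>UNIV. w i"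
  \<comment> \<open>Where a factor vanishes its exponential is 1, and the norm isolates the real
    part of the exponent. Since |w| is positive, \<open>newton N w\<close> cannot be 0.\<close>
  have "norm (lattice_term N L s w) = exp (- L * (real ?k + Re s * real ?a))"
    by (simp add: lattice_term_def)
  then have "real ?k + Re s * real ?a = 0" using w(2) L by simp
  moreover have "real ?k \<noteq> 0" using w(1) unfolding of_nat_eq_0_iff by (auto simp: facet_normal_def)
  ultimately have a: "?a \<noteq> 0" by (metis add_0_right mult_zero_right of_nat_0)
  have "Re s * real ?a = - real ?k" using \<open>real ?k + Re s * real ?a = 0\<close> by linarith
  then have "Re s = - real ?k / real ?a" using a by (intro nonzero_eq_divide_eq[THEN iffD2]) auto
  then show ?thesis
    using a F.facet_prime_divisor F.torus_invariant_facet F.ideal_order_facet F.canonical_order_facet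
    unfolding I by (intro bexI[of _ "mval.vge w 0"]) auto
qed

end
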